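(* Let $\mathbb{C}\cong A_0\subset A_1\subset\cdots\subset A_l\subset\cdots$ be an inductive family of finite-dimensional semisimple complex algebras with branching graph $\Gamma$, and put $a_{l+1}=[\dim A_{l+1}/\dim A_l]$ for $l\ge 0$. Assume that for every $l\ge 0$ and every simple $A_l$-module $\lambda\in\Gamma_l$ one has $\dim(\operatorname{Ind}_{A_l}^{A_{l+1}}\lambda)=a_{l+1}\dim\lambda$, and that $\sup_l a_l=\infty$. Then: 1. every central measure on the pascalized graph $\Pi(\Gamma)$ is concentrated on the subgraph $\Gamma\subset\Pi(\Gamma)$ (i.e. it vanishes on $C_{(n,\lambda)}$ for every vertex $(n,\lambda)$ with $|\lambda|<n$), hence it coincides with a central measure on $\Gamma$; 2. consequently, there is a bijection $\operatorname{Cent}(\Gamma)\leftrightarrow\operatorname{Cent}(\Pi(\Gamma))$ between the sets of central measures, and therefore a bijection between the finite traces on the locally semisimple algebras with Bratteli diagrams $\Gamma$ and $\Pi(\Gamma)$.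
   Context: Embeddings are unital. The branching graph (Bratteli diagram) $\Gamma$ of the family is the $\mathbb{Z}_+$-graded graph whose level $\Gamma_l$ is the set of isomorphism classes of simple $A_l$-modules, with the number of edges between $\lambda\in\Gamma_l$ and $\nu\in\Gamma_{l+1}$ equal to the multiplicity of $\lambda$ in $\nu|_{A_l}$; $|\lambda|=l$ for $\lambda\in\Gamma_l$; $\dim A_l$ is the dimension of the algebra as a vector space; $[x]$ is the integer part of $x$. The pascalized graph $\Pi(\Gamma)$ is the $\mathbb{Z}_+$-graded graph whose $n$-th level consists of the pairs $(n,\lambda)$ with $\lambda\in\Gamma_i$, $i\le n$, $n-i$ even; $(n,\lambda)$ and $(n+1,\nu)$ are joined iff $\lambda,\nu$ are adjacent in $\Gamma$ (so $|\nu|=|\lambda|\pm1$), with the same number of edges as between $\lambda$ and $\nu$ in $\Gamma$. $\Gamma$ is identified with the subgraph of vertices $(n,\lambda)$ with $|\lambda|=n$. The path space of a graded graph with a single vertex at level $0$ is the compact space of infinite paths starting at that vertex and going up one level at each step; $C_d$ is the set of infinite paths through the vertex $d$. A Borel probability measure on the path space is central if, for every vertex $d$, any two finite paths from the initial vertex to $d$ determine cylinder sets (all infinite paths with that initial segment) of equal measure. $\operatorname{Cent}$ denotes the set of central measures. A locally semisimple algebra is an inductive limit $B=\varinjlim B_n$ of finite-dimensional semisimple algebras under unital embeddings, with an involution making each $B_n$ a $C^*$-algebra. A finite trace on $B$ is a linear functional $f:B\to\mathbb{C}$ with $f(1)=1$, $f(ab)=f(ba)$, and $f(a^*a)\ge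 0$. *)

theory Defs
  imports
    "HOL-Probability.Probability_Measure"
    "HOL-Library.FuncSet"
    "HOL-Library.Nonpos_Ints"
    "HOL-Library.Function_Algebras"
    "Jordan_Normal_Form.Matrix"
begin

section \<open>Complex algebras\<close>

class complex_algebra_1 = ring_1 +
  fixes scaleC :: "complex \<Rightarrow> 'a \<Rightarrow> 'a" (infixr "*\<^sub>C" 75)
  assumes scaleC_add_right: "c *\<^sub>C (x + y) = c *\<^sub>C x + c *\<^sub>C y"
    and scaleC_add_left: "(c + d) *\<^sub>C x = c *\<^sub>C x + d *\<^sub>C x"
    and scaleC_scaleC: "c *\<^sub>C (d *\<^sub>C x) = (c * d) *\<^sub>C x"
    and scaleC_one: "1 *\<^sub>C x = x"
    and mult_scaleC_left: "(c *\<^sub>C x) * y = c *\<^sub>C (x * y)"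
    and mult_scaleC_right: "x * (c *\<^sub>C y) = c *\<^sub>C (x * y)"

interpretation cvec: vector_space "scaleC :: complex \<Rightarrow> 'a \<Rightarrow> 'a::complex_algebra_1"
  by unfold_locales (simp_all add: scaleC_add_right scaleC_add_left scaleC_scaleC scaleC_one)

text \<open>Pointwise scalar multiplication: the complex vector space of sequences in an algebra.\<close>

definition scaleC_fun :: "complex \<Rightarrow> (nat \<Rightarrow> 'a) \<Rightarrow> nat \<Rightarrow> 'a::complex_algebra_1" where
  "scaleC_fun c f = (\<lambda>i. c *\<^sub>C f i)"

interpretation cfun: vector_space
    "scaleC_fun :: complex \<Rightarrow> (nat \<Rightarrow> 'a) \<Rightarrow> nat \<Rightarrow> 'a::complex_algebra_1"
  by unfold_locales
    (simp_all add: scaleC_fun_def fun_eq_iff scaleC_add_right scaleC_add_left scaleC_scaleC scaleC_one)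

definition unital_subalgebra :: "'a::complex_algebra_1 set \<Rightarrow> bool" where
  "unital_subalgebra A \<longleftrightarrow> cvec.subspace A \<and> 1 \<in> A \<and> (\<forall>x\<in>A. \<forall>y\<in>A. x * y \<in> A)"

definition finite_dimensional :: "'a::complex_algebra_1 set \<Rightarrow> bool" where
  "finite_dimensional A \<longleftrightarrow> (\<exists>S. finite S \<and> A \<subseteq> cvec.span S)"

definition left_ideal :: "'a::complex_algebra_1 set \<Rightarrow> 'a set \<Rightarrow> bool" where
  "left_ideal A I \<longleftrightarrow> I \<subseteq> A \<and> cvec.subspace I \<and> (\<forall>a\<in>A. \<forall>x\<in>I. a * x \<in> I)"

text \<open>Semisimplicity of the algebra as a left module over itself.\<close>

definition semisimple :: "'a::complex_algebra_1 set \<Rightarrow> bool" where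
  "semisimple A \<longleftrightarrow> (\<forall>I. left_ideal A I \<longrightarrow>
     (\<exists>J. left_ideal A J \<and> I \<inter> J = {0} \<and> A = {x + y | x y. x \<in> I \<and> y \<in> J}))"

text \<open>
  An inductive family of algebras with unital embeddings is taken inside one ambient algebra (for
  instance its direct limit), so that the embeddings are inclusions of subalgebras containing the
  unit of the ambient algebra.
\<close>

definition semisimple_family :: "(nat \<Rightarrow> 'a::complex_algebra_1 set) \<Rightarrow> bool" where
  "semisimple_family A \<longleftrightarrow>
     (\<forall>l. unital_subalgebra (A l) \<and> finite_dimensional (A l) \<and> semisimple (A l) \<and> A l \<subseteq> A (Suc l))"


section \<open>Modules\<close>

text \<open>
  A finite-dimensional module over a subalgebra \<open>A\<close> is given in coordinates: a pair \<open>(d, \<rho>)\<close> stands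
  for the module with underlying space the column vectors of length \<open>d\<close>, on which \<open>a \<in> A\<close> acts by the
  matrix \<open>\<rho> a\<close>. Values of \<open>\<rho>\<close> outside \<open>A\<close> are irrelevant, so that restriction to a smaller
  subalgebra leaves the pair unchanged. Simple modules over a finite-dimensional algebra are
  finite-dimensional, so no isomorphism class of simple modules is lost.
\<close>

type_synonym 'a fdmod = "nat \<times> ('a \<Rightarrow> complex mat)"

abbreviation mod_dim :: "'a fdmod \<Rightarrow> nat" where "mod_dim \<equiv> fst"
abbreviation action :: "'a fdmod \<Rightarrow> 'a \<Rightarrow> complex mat" where "action \<equiv> snd"

definition is_module :: "'a::complex_algebra_1 set \<Rightarrow> 'a fdmod \<Rightarrow> bool" where
  "is_module A M \<longleftrightarrow>
     (\<forall>a\<in>A. action M a \<in> carrier_mat (mod_dim M) (mod_dim M)) \<and>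
     action M 1 = 1\<^sub>m (mod_dim M) \<and>
     (\<forall>a\<in>A. \<forall>b\<in>A. action M (a + b) = action M a + action M b) \<and>
     (\<forall>a\<in>A. \<forall>b\<in>A. action M (a * b) = action M a * action M b) \<and>
     (\<forall>c. \<forall>a\<in>A. action M (c *\<^sub>C a) = c \<cdot>\<^sub>m action M a)"

definition is_submodule :: "'a::complex_algebra_1 set \<Rightarrow> 'a fdmod \<Rightarrow> complex vec set \<Rightarrow> bool" where
  "is_submodule A M W \<longleftrightarrow>
     W \<subseteq> carrier_vec (mod_dim M) \<and> 0\<^sub>v (mod_dim M) \<in> W \<and>
     (\<forall>v\<in>W. \<forall>w\<in>W. v + w \<in> W) \<and> (\<forall>c. \<forall>v\<in>W. c \<cdot>\<^sub>v v \<in> W) \<and>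
     (\<forall>a\<in>A. \<forall>v\<in>W. action M a *\<^sub>v v \<in> W)"

definition simple_module :: "'a::complex_algebra_1 set \<Rightarrow> 'a fdmod \<Rightarrow> bool" where
  "simple_module A M \<longleftrightarrow> is_module A M \<and> mod_dim M > 0 \<and>
     (\<forall>W. is_submodule A M W \<longrightarrow> W = {0\<^sub>v (mod_dim M)} \<or> W = carrier_vec (mod_dim M))"

definition mod_iso :: "'a set \<Rightarrow> 'a fdmod \<Rightarrow> 'a fdmod \<Rightarrow> bool" where
  "mod_iso A M N \<longleftrightarrow> mod_dim M = mod_dim N \<and>
     (\<exists>P\<in>carrier_mat (mod_dim M) (mod_dim M).
        invertible_mat P \<and> (\<forall>a\<in>A. P * action M a = action N a * P))"

definition direct_sum :: "'a fdmod list \<Rightarrow> 'a fdmod" where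
  "direct_sum Ms = (sum_list (map mod_dim Ms), \<lambda>a. diag_block_mat (map (\<lambda>M. action M a) Ms))"

definition simple_classes :: "'a::complex_algebra_1 set \<Rightarrow> 'a fdmod set set" where
  "simple_classes A = {{N. is_module A N \<and> mod_iso A M N} | M. simple_module A M}"

text \<open>The number of simple summands of \<open>N\<close> belonging to the isomorphism class \<open>\<kappa>\<close>.\<close>

definition multiplicity_in :: "'a::complex_algebra_1 set \<Rightarrow> 'a fdmod set \<Rightarrow> 'a fdmod \<Rightarrow> nat" where
  "multiplicity_in A \<kappa> N = (THE m. \<exists>Ms. (\<forall>M\<in>set Ms. simple_module A M) \<and>
     mod_iso A N (direct_sum Ms) \<and> m = length (filter (\<lambda>M. M \<in> \<kappa>) Ms))"

text \<open>
  For an \<open>A\<close>-module \<open>M\<close> on the column vectors of length \<open>d\<close>, the complex tensor product \<open>A' \<otimes> M\<close> is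
  realised as the \<open>d\<close>-tuples in \<open>A'\<close>, with \<open>b \<otimes> v = (v\<^sub>i b)\<^sub>i\<close>. The induced module \<open>A' \<otimes>\<^sub>A M\<close> is its quotient
  by the span of all \<open>ba \<otimes> v - b \<otimes> av\<close>, whose dimension is \<open>induced_dim\<close>.
\<close>

definition pure_tensor :: "'a::complex_algebra_1 \<Rightarrow> complex vec \<Rightarrow> nat \<Rightarrow> 'a" where
  "pure_tensor b v = (\<lambda>i. if i < dim_vec v then vec_index v i *\<^sub>C b else 0)"

definition tensor_space :: "'a::complex_algebra_1 set \<Rightarrow> 'a fdmod \<Rightarrow> (nat \<Rightarrow> 'a) set" where
  "tensor_space A' M = cfun.span {pure_tensor b v | b v. b \<in> A' \<and> v \<in> carrier_vec (mod_dim M)}"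

definition balancing_space ::
  "'a::complex_algebra_1 set \<Rightarrow> 'a set \<Rightarrow> 'a fdmod \<Rightarrow> (nat \<Rightarrow> 'a) set" where
  "balancing_space A A' M = cfun.span
     {pure_tensor (b * a) v - pure_tensor b (action M a *\<^sub>v v)
       | a b v. a \<in> A \<and> b \<in> A' \<and> v \<in> carrier_vec (mod_dim M)}"

definition induced_dim :: "'a::complex_algebra_1 set \<Rightarrow> 'a set \<Rightarrow> 'a fdmod \<Rightarrow> nat" where
  "induced_dim A A' M = cfun.dim (tensor_space A' M) - cfun.dim (balancing_space A A' M)"


section \<open>Graded graphs and central measures\<close>

text \<open>\<open>mult_edges G n v w\<close> is the number of edges from \<open>v\<close> on level \<open>n\<close> to \<open>w\<close> on level \<open>n + 1\<close>.\<close>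

record 'v graded_graph =
  level :: "nat \<Rightarrow> 'v set"
  mult_edges :: "nat \<Rightarrow> 'v \<Rightarrow> 'v \<Rightarrow> nat"

definition branching_graph :: "(nat \<Rightarrow> 'a::complex_algebra_1 set) \<Rightarrow> 'a fdmod set graded_graph" where
  "branching_graph A =
     \<lparr> level = (\<lambda>l. simple_classes (A l)),
       mult_edges = (\<lambda>l \<kappa> \<nu>. THE m. \<exists>N\<in>\<nu>. m = multiplicity_in (A l) \<kappa> N) \<rparr>"

text \<open>
  A vertex \<open>(i, \<lambda>)\<close> on level \<open>n\<close> of \<open>pascalized G\<close> stands for \<open>(n, \<lambda>)\<close> with \<open>\<lambda>\<close> on level \<open>i\<close> of \<open>G\<close>. The
  index \<open>i\<close> is recorded because the same element may occur on several levels of \<open>G\<close>.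
\<close>

definition pascalized :: "'v graded_graph \<Rightarrow> (nat \<times> 'v) graded_graph" where
  "pascalized G =
     \<lparr> level = (\<lambda>n. {(i, v). i \<le> n \<and> even (n - i) \<and> v \<in> level G i}),
       mult_edges = (\<lambda>n (i, v) (j, w).
          if j = Suc i then mult_edges G i v w
          else if i = Suc j then mult_edges G j w v
          else 0) \<rparr>"

text \<open>
  Paths in a multigraph are sequences of edges: \<open>\<omega> n = (v, k)\<close> means that the path is at the vertex \<open>v\<close>
  on level \<open>n\<close> and leaves it along the edge number \<open>k\<close> among those to its vertex on level \<open>n + 1\<close>.
\<close>

type_synonym 'v path = "nat \<Rightarrow> 'v \<times> nat"

definition paths :: "'v graded_graph \<Rightarrow> 'v path set" where
  "paths G = {\<omega>. \<forall>n. fst (\<omega> n) \<in> level G n \<and>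
                      snd (\<omega> n) < mult_edges G n (fst (\<omega> n)) (fst (\<omega> (Suc n)))}"

definition path_topology :: "'v graded_graph \<Rightarrow> 'v path topology" where
  "path_topology G =
     subtopology (product_topology (\<lambda>n. discrete_topology UNIV) UNIV) (paths G)"

definition path_borel :: "'v graded_graph \<Rightarrow> 'v path measure" where
  "path_borel G = sigma (paths G) {U. openin (path_topology G) U}"

text \<open>Finite paths from level \<open>0\<close> to the vertex \<open>d\<close> on level \<open>n\<close>, as lists of \<open>n\<close> edges.\<close>

definition finite_paths :: "'v graded_graph \<Rightarrow> nat \<Rightarrow> 'v \<Rightarrow> ('v \<times> nat) list set" where
  "finite_paths G n d = {p. length p = n \<and>
     (\<forall>i<n. fst (p ! i) \<in> level G i \<and>
            snd (p ! i) < mult_edges G i (fst (p ! i)) (if Suc i < n then fst (p ! Suc i) else d))}"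

definition cylinder :: "'v graded_graph \<Rightarrow> 'v \<Rightarrow> ('v \<times> nat) list \<Rightarrow> 'v path set" where
  "cylinder G d p = {\<omega>\<in>paths G. (\<forall>i<length p. \<omega> i = p ! i) \<and> fst (\<omega> (length p)) = d}"

definition paths_through :: "'v graded_graph \<Rightarrow> nat \<Rightarrow> 'v \<Rightarrow> 'v path set" where
  "paths_through G n d = {\<omega>\<in>paths G. fst (\<omega> n) = d}"

definition Cent :: "'v graded_graph \<Rightarrow> 'v path measure set" where
  "Cent G = {M. prob_space M \<and> sets M = sets (path_borel G) \<and>
     (\<forall>n. \<forall>d\<in>level G n. \<forall>p\<in>finite_paths G n d. \<forall>q\<in>finite_paths G n d.
        measure M (cylinder G d p) = measure M (cylinder G d q))}"

text \<open>Paths in \<open>G\<close> as paths in its pascalization, and measures on \<open>G\<close> as measures there.\<close>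

definition pascal_path :: "'v path \<Rightarrow> (nat \<times> 'v) path" where
  "pascal_path \<omega> = (\<lambda>n. ((n, fst (\<omega> n)), snd (\<omega> n)))"

definition pascal_measure :: "'v graded_graph \<Rightarrow> 'v path measure \<Rightarrow> (nat \<times> 'v) path measure" where
  "pascal_measure G M = distr M (path_borel (pascalized G)) pascal_path"


section \<open>Locally semisimple algebras and traces\<close>

text \<open>
  A norm making \<open>B\<close> with the involution a \<open>C\<^sup>*\<close>-algebra; its completeness is automatic in finite
  dimension.
\<close>

definition cstar_norm ::
  "'b::complex_algebra_1 set \<Rightarrow> ('b \<Rightarrow> 'b) \<Rightarrow> ('b \<Rightarrow> real) \<Rightarrow> bool" where
  "cstar_norm B star nrm \<longleftrightarrow>
     (\<forall>x\<in>B. 0 \<le> nrm x \<and> (nrm x = 0 \<longleftrightarrow> x = 0)) \<and>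
     (\<forall>c. \<forall>x\<in>B. nrm (c *\<^sub>C x) = cmod c * nrm x) \<and>
     (\<forall>x\<in>B. \<forall>y\<in>B. nrm (x + y) \<le> nrm x + nrm y) \<and>
     (\<forall>x\<in>B. \<forall>y\<in>B. nrm (x * y) \<le> nrm x * nrm y) \<and>
     (\<forall>x\<in>B. nrm (star x * x) = (nrm x)\<^sup>2)"

definition involution_on :: "'b::complex_algebra_1 set \<Rightarrow> ('b \<Rightarrow> 'b) \<Rightarrow> bool" where
  "involution_on B star \<longleftrightarrow>
     (\<forall>x\<in>B. star x \<in> B \<and> star (star x) = x) \<and>
     (\<forall>x\<in>B. \<forall>y\<in>B. star (x + y) = star x + star y) \<and>
     (\<forall>x\<in>B. \<forall>y\<in>B. star (x * y) = star y * star x) \<and>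
     (\<forall>c. \<forall>x\<in>B. star (c *\<^sub>C x) = cnj c *\<^sub>C star x)"

text \<open>The algebra itself is the union of the \<open>B n\<close>.\<close>

definition locally_semisimple ::
  "(nat \<Rightarrow> 'b::complex_algebra_1 set) \<Rightarrow> ('b \<Rightarrow> 'b) \<Rightarrow> bool" where
  "locally_semisimple B star \<longleftrightarrow> semisimple_family B \<and>
     (\<forall>n. involution_on (B n) star \<and> (\<exists>nrm. cstar_norm (B n) star nrm))"

definition graph_iso ::
  "'v graded_graph \<Rightarrow> 'w graded_graph \<Rightarrow> (nat \<Rightarrow> 'v \<Rightarrow> 'w) \<Rightarrow> bool" where
  "graph_iso G H \<phi> \<longleftrightarrow>
     (\<forall>n. bij_betw (\<phi> n) (level G n) (level H n)) \<and>
     (\<forall>n. \<forall>v\<in>level G n. \<forall>w\<in>level G (Suc n).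
        mult_edges H n (\<phi> n v) (\<phi> (Suc n) w) = mult_edges G n v w)"

definition finite_traces ::
  "(nat \<Rightarrow> 'b::complex_algebra_1 set) \<Rightarrow> ('b \<Rightarrow> 'b) \<Rightarrow> ('b \<Rightarrow> complex) set" where
  "finite_traces B star = {f \<in> extensional (\<Union>n. B n).
     (\<forall>x\<in>(\<Union>n. B n). \<forall>y\<in>(\<Union>n. B n). f (x + y) = f x + f y) \<and>
     (\<forall>c. \<forall>x\<in>(\<Union>n. B n). f (c *\<^sub>C x) = c * f x) \<and>
     f 1 = 1 \<and>
     (\<forall>x\<in>(\<Union>n. B n). \<forall>y\<in>(\<Union>n. B n). f (x * y) = f (y * x)) \<and>
     (\<forall>x\<in>(\<Union>n. B n). f (star x * x) \<in> \<real>\<^sub>\<ge>\<^sub>0)}"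

definition normalized_character :: "'b fdmod set \<Rightarrow> 'b \<Rightarrow> complex" where
  "normalized_character \<kappa> b = (THE z. \<exists>N\<in>\<kappa>.
     z = (\<Sum>i<mod_dim N. action N b $$ (i, i)) / of_nat (mod_dim N))"

text \<open>
  The standard correspondence between finite traces and central measures: for an algebra whose
  Bratteli diagram is \<open>G\<close> via \<open>\<phi>\<close>, the restriction of the trace to \<open>B n\<close> is the average of the
  normalized irreducible characters with respect to the distribution of the \<open>n\<close>-th vertex of the
  random path.
\<close>

definition trace_of_measure ::
  "'v graded_graph \<Rightarrow> (nat \<Rightarrow> 'v \<Rightarrow> 'b fdmod set) \<Rightarrow> (nat \<Rightarrow> 'b::complex_algebra_1 set) \<Rightarrow>
   ('b \<Rightarrow> complex) \<Rightarrow> 'v path measure \<Rightarrow> bool" where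
  "trace_of_measure G \<phi> B f M \<longleftrightarrow> (\<forall>n. \<forall>b\<in>B n.
     f b = (\<Sum>v\<in>level G n. of_real (measure M (paths_through G n v)) * normalized_character (\<phi> n v) b))"

end

theory Submission
  imports Defs
    "HOL-Probability.Infinite_Product_Measure"
    "Jordan_Normal_Form.Spectral_Radius"
    "Jordan_Normal_Form.Schur_Decomposition"
begin

text \<open>
  A central measure is the same as a harmonic function \<open>\<psi>\<close> on the vertices, the common measure of the
  cylinders ending there. For simple \<open>\<lambda>\<close> the dimensions satisfy \<open>\<Sum>\<^sub>\<mu> m(\<mu>, \<lambda>) dim \<mu> = dim \<lambda>\<close> by restriction and,
  by Frobenius reciprocity and the hypothesis, \<open>\<Sum>\<^sub>\<nu> m(\<lambda>, \<nu>) dim \<nu> = a\<^sub>l\<^sub>+\<^sub>1 dim \<lambda>\<close>. Hence for a central measure on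
  the pascalized graph, \<open>g(n, i) = \<Sum>\<^sub>\<lambda> dim \<lambda> \<psi>(n, \<lambda>)\<close>, summed over \<open>\<lambda>\<close> on level \<open>i\<close>, is harmonic for the weighted
  walk on the half line: \<open>g(n, i) = g(n + 1, i + 1) + a\<^sub>i g(n + 1, i - 1)\<close>. Since the weights \<open>a\<^sub>i\<close> are unbounded,
  steps down that occur early are negligible against steps down at a large height, so \<open>g\<close> vanishes for
  \<open>i < n\<close>, and harmonic functions on the two graphs correspond by extension by zero. Finally, by
  Wedderburn's theorem the traces of a locally semisimple algebra are the harmonic functions on its
  Bratteli diagram, the value of the trace on a minimal idempotent being the value of \<open>\<psi>\<close> up to the
  dimension of the root.
\<close>

unbundle no vec_syntax and no inner_syntax

subsection \<open>Central measures and harmonic functions\<close>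

text \<open>On the half line the maximum principle is applied to a strip of bounded height but
  infinite length, so it needs an a priori growth bound. The bound is imported from one height far
  above the strip, whose weight dominates the square of the growth rate inside the strip;
  unboundedness of the weights is used once to find that height and once more when the height of the
  strip itself varies.

  On the algebraic side all multiplicities and dimensions are read off from the character of a
  module at a minimal idempotent. This shows that counting simple summands does not depend on the
  decomposition, and it turns restriction and induction into identities of complex numbers. Minimal
  idempotents come from a density theorem together with faithfulness of the simple modules.

  For traces the obstacle is that the involution is abstract: it is not known to act on the blocks
  as conjugate transposition, so positivity of characters, and of a trace on minimal idempotents,
  has to be derived from definiteness of \<open>star x * x\<close>. The algebras carrying traces may
  begin with a full matrix algebra instead of the scalars, hence the root dimension in the
  formulas.\<close>

locale bratteli_graph =
  fixes G :: "'v graded_graph" and r :: 'v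
  assumes finite_level: "finite (level G n)"
    and level_0: "level G 0 = {r}"
    and pred: "v \<in> level G (Suc n) \<Longrightarrow> \<exists>u\<in>level G n. mult_edges G n u v > 0"
    and succ: "v \<in> level G n \<Longrightarrow> \<exists>w\<in>level G (Suc n). mult_edges G n v w > 0"

definition harmonic :: "'v graded_graph \<Rightarrow> (nat \<Rightarrow> 'v \<Rightarrow> real) \<Rightarrow> bool" where
  "harmonic G \<psi> \<longleftrightarrow> (\<forall>v\<in>level G 0. \<psi> 0 v = 1) \<and>
     (\<forall>n. \<forall>v\<in>level G n. 0 \<le> \<psi> n v \<and>
        \<psi> n v = (\<Sum>w\<in>level G (Suc n). of_nat (mult_edges G n v w) * \<psi> (Suc n) w))"

lemma harmonic_nonneg: "harmonic G \<psi> \<Longrightarrow> v \<in> level G n \<Longrightarrow> 0 \<le> \<psi> n v"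
  unfolding harmonic_def by blast

lemma harmonic_step:
  "harmonic G \<psi> \<Longrightarrow> v \<in> level G n \<Longrightarrow>
     \<psi> n v = (\<Sum>w\<in>level G (Suc n). of_nat (mult_edges G n v w) * \<psi> (Suc n) w)"
  unfolding harmonic_def by blast

lemma harmonic_0: "harmonic G \<psi> \<Longrightarrow> v \<in> level G 0 \<Longrightarrow> \<psi> 0 v = 1"
  unfolding harmonic_def by blast

definition num_paths :: "'v graded_graph \<Rightarrow> nat \<Rightarrow> 'v \<Rightarrow> nat" where
  "num_paths G n d = card (finite_paths G n d)"

lemma finite_paths_0: "finite_paths G 0 d = {[]}"
  by (auto simp: finite_paths_def)

lemma finite_paths_Suc:
  "finite_paths G (Suc n) d =
     (\<Union>u\<in>level G n. (\<lambda>(p, k). p @ [(u, k)]) ` (finite_paths G n u \<times> {..<mult_edges G n u d}))"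
proof (intro equalityI subsetI)
  fix q assume q: "q \<in> finite_paths G (Suc n) d"
  then have "length q = Suc n" by (simp add: finite_paths_def)
  then obtain p x where qp: "q = p @ [x]" "length p = n"
    by (metis length_Suc_conv_rev)
  obtain u k where x: "x = (u, k)" by (cases x)
  have H: "fst (q ! i) \<in> level G i \<and> snd (q ! i) < mult_edges G i (fst (q ! i))
        (if Suc i < Suc n then fst (q ! Suc i) else d)" if "i < Suc n" for i
    using q that by (simp add: finite_paths_def)
  have u: "u \<in> level G n" "k < mult_edges G n u d"
    using H[of n] by (simp_all add: qp x nth_append)
  have "fst (p ! i) \<in> level G i \<and> snd (p ! i) < mult_edges G i (fst (p ! i))
        (if Suc i < n then fst (p ! Suc i) else u)" if i: "i < n" for i
  proof (cases "Suc i < n")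
    case True then show ?thesis using H[of i] i by (simp add: qp x nth_append)
  next
    case False
    then have "n = Suc i" using i by simp
    then show ?thesis using H[of i] i by (simp add: qp x nth_append)
  qed
  then have "p \<in> finite_paths G n u" using qp by (simp add: finite_paths_def)
  then show "q \<in> (\<Union>u\<in>level G n. (\<lambda>(p, k). p @ [(u, k)]) ` (finite_paths G n u \<times> {..<mult_edges G n u d}))"
    using u qp x by force
next
  fix q assume "q \<in> (\<Union>u\<in>level G n. (\<lambda>(p, k). p @ [(u, k)]) ` (finite_paths G n u \<times> {..<mult_edges G n u d}))"
  then obtain u p k where u: "u \<in> level G n" and p: "p \<in> finite_paths G n u"
    and k: "k < mult_edges G n u d" and q: "q = p @ [(u, k)]" by auto
  have len: "length p = n" using p by (simp add: finite_paths_def)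
  have H: "fst (p ! i) \<in> level G i \<and> snd (p ! i) < mult_edges G i (fst (p ! i))
        (if Suc i < n then fst (p ! Suc i) else u)" if i: "i < n" for i
    using p i by (simp add: finite_paths_def)
  have H2: "fst (q ! i) \<in> level G i \<and> snd (q ! i) < mult_edges G i (fst (q ! i))
        (if Suc i < Suc n then fst (q ! Suc i) else d)" if "i < Suc n" for i
  proof (cases "i < n")
    case True
    show ?thesis
    proof (cases "Suc i < n")
      case True then show ?thesis using H[of i] len by (simp add: q nth_append)
    next
      case False
      then have "n = Suc i" using \<open>i < n\<close> by simp
      then show ?thesis using H[of i] len by (simp add: q nth_append)
    qed
  next
    case False
    then have "i = n" using that by simp
    then show ?thesis using u k len by (simp add: q nth_append)
  qed
  have "length q = Suc n" using len q by simp
  then show "q \<in> finite_paths G (Suc n) d" unfolding finite_paths_def using H2 by blast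
qed

text \<open>A list in \<open>finite_paths\<close> records the edges taken but not how the endpoint
  is left, so passing to the next level appends \<open>(d, k)\<close> while the new endpoint
  \<open>w\<close> becomes the vertex argument of \<open>cylinder\<close>. Additivity of a measure
  over this partition is the harmonicity equation.\<close>

lemma cylinder_split:
  assumes "d \<in> level G n" "length p = n"
  shows "cylinder G d p =
    (\<Union>(w, k)\<in>(SIGMA w:level G (Suc n). {..<mult_edges G n d w}). cylinder G w (p @ [(d, k)]))"
proof (intro equalityI subsetI)
  fix \<omega> assume w: "\<omega> \<in> cylinder G d p"
  obtain k where k: "\<omega> n = (d, k)" using w assms by (cases "\<omega> n") (auto simp: cylinder_def)
  have P: "fst (\<omega> i) \<in> level G i \<and> snd (\<omega> i) < mult_edges G i (fst (\<omega> i)) (fst (\<omega> (Suc i)))" for i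
    using w by (auto simp: cylinder_def paths_def)
  have "\<omega> \<in> cylinder G (fst (\<omega> (Suc n))) (p @ [(d, k)])"
    using w assms k by (auto simp: cylinder_def nth_append less_Suc_eq)
  moreover have "(fst (\<omega> (Suc n)), k) \<in> (SIGMA w:level G (Suc n). {..<mult_edges G n d w})"
    using P[of n] P[of "Suc n"] k by simp
  ultimately show "\<omega> \<in> (\<Union>(w, k)\<in>(SIGMA w:level G (Suc n). {..<mult_edges G n d w}). cylinder G w (p @ [(d, k)]))"
    by blast
next
  fix \<omega> assume "\<omega> \<in> (\<Union>(w, k)\<in>(SIGMA w:level G (Suc n). {..<mult_edges G n d w}). cylinder G w (p @ [(d, k)]))"
  then obtain w k where "\<omega> \<in> cylinder G w (p @ [(d, k)])" by auto
  then have a: "\<omega> \<in> paths G" "\<And>i. i < Suc n \<Longrightarrow> \<omega> i = (p @ [(d, k)]) ! i"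
    using assms by (auto simp: cylinder_def)
  have "\<omega> i = p ! i" if "i < n" for i using a(2)[of i] that assms by (simp add: nth_append)
  moreover have "\<omega> n = (d, k)" using a(2)[of n] assms by (simp add: nth_append)
  ultimately show "\<omega> \<in> cylinder G d p" using a(1) assms by (simp add: cylinder_def)
qed

lemma cylinder_disjoint_split:
  assumes "length p = n"
  shows "disjoint_family_on (\<lambda>(w, k). cylinder G w (p @ [(d, k)])) S"
proof -
  have "x = y" if "\<omega> \<in> (case x of (w, k) \<Rightarrow> cylinder G w (p @ [(d, k)]))"
    "\<omega> \<in> (case y of (w, k) \<Rightarrow> cylinder G w (p @ [(d, k)]))" for \<omega> x y
  proof -
    obtain w k w' k' where xy: "x = (w, k)" "y = (w', k')" by (cases x, cases y)
    have "\<omega> n = (d, k)" "\<omega> n = (d, k')" "fst (\<omega> (Suc n)) = w" "fst (\<omega> (Suc n)) = w'"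
      using that assms by (auto simp: cylinder_def nth_append xy)
    then show ?thesis using xy by simp
  qed
  then show ?thesis unfolding disjoint_family_on_def by blast
qed

lemma paths_through_eq_cylinders:
  assumes "d \<in> level G n"
  shows "paths_through G n d = (\<Union>p\<in>finite_paths G n d. cylinder G d p)"
proof (intro equalityI subsetI)
  fix \<omega> assume w: "\<omega> \<in> paths_through G n d"
  then have P: "fst (\<omega> i) \<in> level G i \<and> snd (\<omega> i) < mult_edges G i (fst (\<omega> i)) (fst (\<omega> (Suc i)))" for i
    by (auto simp: paths_through_def paths_def)
  have "\<omega> \<in> cylinder G d (map \<omega> [0..<n])"
    using w by (auto simp: cylinder_def paths_through_def)
  moreover have "map \<omega> [0..<n] \<in> finite_paths G n d"
  proof -
    have "fst (\<omega> (Suc i)) = d" if "i < n" "\<not> Suc i < n" for i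
    proof -
      have "Suc i = n" using that by simp
      then show ?thesis using w by (simp add: paths_through_def)
    qed
    then show ?thesis using P by (auto simp: finite_paths_def split: if_splits)
  qed
  ultimately show "\<omega> \<in> (\<Union>p\<in>finite_paths G n d. cylinder G d p)" by blast
next
  fix \<omega> assume "\<omega> \<in> (\<Union>p\<in>finite_paths G n d. cylinder G d p)"
  then show "\<omega> \<in> paths_through G n d"
    by (auto simp: cylinder_def paths_through_def finite_paths_def)
qed

lemma cylinder_disjoint:
  "disjoint_family_on (cylinder G d) (finite_paths G n d)"
proof -
  have "p = q" if "\<omega> \<in> cylinder G d p" "\<omega> \<in> cylinder G d q" "length p = n" "length q = n" for \<omega> p q
    using that by (intro nth_equalityI) (auto simp: cylinder_def)
  then show ?thesis
    unfolding disjoint_family_on_def by (auto simp: finite_paths_def)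
qed

lemma openin_cylinder: "openin (path_topology G) (cylinder G d p)"
proof -
  \<comment> \<open>Coordinate \<open>length p\<close> restricts only the vertex; the edge leaving
    it stays free.\<close>
  define S where "S = (\<lambda>i. if i < length p then {p ! i} else if i = length p then {x. fst x = d} else UNIV)"
  have "{i. S i \<noteq> UNIV} \<subseteq> {..length p}" by (auto simp: S_def)
  then have "finite {i. S i \<noteq> UNIV}" using finite_subset by blast
  then have "openin (product_topology (\<lambda>n. discrete_topology UNIV) UNIV) (PiE UNIV S)"
    by (subst openin_PiE_gen) auto
  moreover have "cylinder G d p = PiE UNIV S \<inter> paths G"
  proof (intro equalityI subsetI)
    fix \<omega> assume "\<omega> \<in> cylinder G d p"
    then show "\<omega> \<in> PiE UNIV S \<inter> paths G" by (auto simp: cylinder_def S_def PiE_def Pi_def)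
  next
    fix \<omega> assume w: "\<omega> \<in> PiE UNIV S \<inter> paths G"
    have "\<omega> i \<in> S i" for i using w by (auto simp: PiE_def Pi_def)
    note mem = this
    have "\<omega> i = p ! i" if "i < length p" for i using mem[of i] that by (simp add: S_def)
    moreover have "fst (\<omega> (length p)) = d" using mem[of "length p"] by (simp add: S_def)
    ultimately show "\<omega> \<in> cylinder G d p" using w by (auto simp: cylinder_def)
  qed
  ultimately show ?thesis unfolding path_topology_def openin_subtopology by blast
qed

lemma path_topology_sub: "{U. openin (path_topology G) U} \<subseteq> Pow (paths G)"
  by (auto simp: path_topology_def openin_subtopology)

lemma space_path_borel [simp]: "space (path_borel G) = paths G"
  unfolding path_borel_def using path_topology_sub by (rule space_measure_of)

lemma sets_path_borel: "sets (path_borel G) = sigma_sets (paths G) {U. openin (path_topology G) U}"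
  unfolding path_borel_def using path_topology_sub by (rule sets_measure_of)

lemma cylinder_sets [measurable, simp]: "cylinder G d p \<in> sets (path_borel G)"
  unfolding sets_path_borel by (rule sigma_sets.Basic) (simp add: openin_cylinder)

section \<open>Cylinders as a generator of the Borel sets\<close>

definition cylinders :: "'v graded_graph \<Rightarrow> 'v path set set" where
  "cylinders G = (\<Union>n. \<Union>d\<in>level G n. cylinder G d ` finite_paths G n d)"

text \<open>Two cylinders that meet are nested, the one with the longer list being the smaller;
  disjoint ones meet in the added empty set.\<close>

lemma Int_stable_cylinders: "Int_stable (insert {} (cylinders G))"
proof -
  have sub: "cylinder G d' p' \<subseteq> cylinder G d p"
    if \<omega>: "\<omega> \<in> cylinder G d p" "\<omega> \<in> cylinder G d' p'" and le: "length p \<le> length p'" for \<omega> d p d' p'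
  proof
    fix \<omega>' assume w': "\<omega>' \<in> cylinder G d' p'"
    have e: "\<omega>' i = \<omega> i" if "i < length p'" for i using \<omega> w' that by (auto simp: cylinder_def)
    have "fst (\<omega>' (length p)) = d"
    proof (cases "length p < length p'")
      case True then show ?thesis using e[of "length p"] \<omega> by (auto simp: cylinder_def)
    next
      case False
      then have "length p = length p'" using le by simp
      then show ?thesis using \<omega> w' by (auto simp: cylinder_def)
    qed
    then show "\<omega>' \<in> cylinder G d p" using e w' \<omega> le by (auto simp: cylinder_def)
  qed
  have "a \<inter> b \<in> insert {} (cylinders G)" if "a \<in> cylinders G" "b \<in> cylinders G" for a b
  proof (cases "a \<inter> b = {}")
    case False
    then obtain \<omega> where w: "\<omega> \<in> a" "\<omega> \<in> b" by blast
    note ab = that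
    obtain d p where a: "a = cylinder G d p" using ab(1) unfolding cylinders_def by blast
    obtain d' p' where b: "b = cylinder G d' p'" using ab(2) unfolding cylinders_def by blast
    have "a \<subseteq> b \<or> b \<subseteq> a" using sub w a b by (metis nat_le_linear)
    then have "a \<inter> b = a \<or> a \<inter> b = b" by blast
    then show ?thesis using ab by auto
  qed simp
  then show ?thesis unfolding Int_stable_def by auto
qed

context bratteli_graph
begin

lemma finite_finite_paths: "finite (finite_paths G n d)"
proof (induction n arbitrary: d)
  case (Suc n) then show ?case using finite_level by (simp add: finite_paths_Suc)
qed (simp add: finite_paths_0)

lemma num_paths_Suc: "num_paths G (Suc n) d = (\<Sum>u\<in>level G n. mult_edges G n u d * num_paths G n u)"
proof -
  have "card (finite_paths G (Suc n) d) =
    (\<Sum>u\<in>level G n. card ((\<lambda>(p, k). p @ [(u, k)]) ` (finite_paths G n u \<times> {..<mult_edges G n u d})))"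
    unfolding finite_paths_Suc by (rule card_UN_disjoint) (auto simp: finite_level finite_finite_paths)
  also have "\<dots> = (\<Sum>u\<in>level G n. mult_edges G n u d * num_paths G n u)"
    by (intro sum.cong refl, subst card_image)
       (auto simp: inj_on_def card_cartesian_product num_paths_def)
  finally show ?thesis by (simp add: num_paths_def)
qed

lemma num_paths_pos: "v \<in> level G n \<Longrightarrow> num_paths G n v > 0"
proof (induction n arbitrary: v)
  case 0 then show ?case by (simp add: num_paths_def finite_paths_0)
next
  case (Suc n)
  obtain u where u: "u \<in> level G n" "mult_edges G n u v > 0" using pred[OF Suc.prems] by blast
  have "0 < mult_edges G n u v * num_paths G n u" using u Suc.IH by simp
  also have "\<dots> \<le> num_paths G (Suc n) v" unfolding num_paths_Suc
    by (rule member_le_sum[OF u(1)]) (auto simp: finite_level)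
  finally show ?case .
qed

lemma finite_paths_nonempty: "v \<in> level G n \<Longrightarrow> \<exists>p. p \<in> finite_paths G n v"
  using num_paths_pos[of v n] by (metis card.empty ex_in_conv less_irrefl num_paths_def)

lemma paths_eq_cylinder: "paths G = cylinder G r []"
proof -
  have "fst (\<omega> 0) = r" if "\<omega> \<in> paths G" for \<omega>
  proof -
    have "fst (\<omega> 0) \<in> level G 0" using that unfolding paths_def by blast
    then show ?thesis using level_0 by simp
  qed
  then show ?thesis by (auto simp: cylinder_def)
qed

lemma countable_cylinders: "countable (cylinders G)"
  unfolding cylinders_def
  by (rule countable_UN, simp, rule countable_UN, rule countable_finite[OF finite_level],
      rule countable_image, rule countable_finite[OF finite_finite_paths])

text \<open>A basic open set of the product topology restricts finitely many coordinates. With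
  \<open>n\<close> above all of them, the level \<open>n\<close> cylinder around any path of the set
  stays inside it. Finite levels leave only countably many cylinders, so every open set is a
  countable union of them.\<close>

lemma sets_path_borel_cylinders: "sets (path_borel G) = sigma_sets (paths G) (insert {} (cylinders G))"
proof
  show "sigma_sets (paths G) (insert {} (cylinders G)) \<subseteq> sets (path_borel G)"
  proof -
    have "insert {} (cylinders G) \<subseteq> sets (path_borel G)" by (auto simp: cylinders_def)
    from sets.sigma_sets_subset[OF this] show ?thesis by simp
  qed
  have op: "U \<in> sigma_sets (paths G) (insert {} (cylinders G))" if U: "openin (path_topology G) U" for U
  proof -
    have "U = \<Union>{c\<in>cylinders G. c \<subseteq> U}"
    proof (intro equalityI subsetI)
      fix \<omega> assume w: "\<omega> \<in> U"
      obtain T where T: "openin (product_topology (\<lambda>n::nat. discrete_topology UNIV) UNIV) T"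
        and UT: "U = T \<inter> paths G" using U unfolding path_topology_def openin_subtopology by blast
      have "\<exists>S. finite {i\<in>UNIV. S i \<noteq> topspace (discrete_topology UNIV)}
              \<and> (\<forall>i\<in>UNIV. openin (discrete_topology UNIV) (S i)) \<and> \<omega> \<in> Pi\<^sub>E UNIV S \<and> Pi\<^sub>E UNIV S \<subseteq> T"
        using T w UT unfolding openin_product_topology_alt by blast
      then obtain S where S: "finite {i. S i \<noteq> UNIV}" "\<omega> \<in> PiE UNIV S" "PiE UNIV S \<subseteq> T" by auto
      obtain n where n: "\<And>i. S i \<noteq> UNIV \<Longrightarrow> i < n"
        using S(1) unfolding finite_nat_set_iff_bounded by blast
      have wp: "\<omega> \<in> paths G" using w UT by simp
      define d where "d = fst (\<omega> n)"
      have d: "d \<in> level G n" using wp by (auto simp: d_def paths_def)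
      have "\<omega> \<in> paths_through G n d" using wp by (simp add: paths_through_def d_def)
      then obtain p where p: "p \<in> finite_paths G n d" "\<omega> \<in> cylinder G d p"
        unfolding paths_through_eq_cylinders[OF d] by blast
      have "cylinder G d p \<subseteq> U"
      proof
        fix x assume x: "x \<in> cylinder G d p"
        have "x i \<in> S i" for i
        proof (cases "S i = UNIV")
          case False
          then have "i < length p" using n p by (simp add: finite_paths_def)
          then have "x i = \<omega> i" using x p by (simp add: cylinder_def)
          then show ?thesis using S(2) by auto
        qed simp
        then have "x \<in> T" using S(3) by blast
        then show "x \<in> U" using x UT by (simp add: cylinder_def)
      qed
      moreover have "cylinder G d p \<in> cylinders G" using p d by (auto simp: cylinders_def)
      ultimately show "\<omega> \<in> \<Union>{c\<in>cylinders G. c \<subseteq> U}" using p by blast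
    qed auto
    moreover have "\<Union>{c\<in>cylinders G. c \<subseteq> U} \<in> sigma_sets (paths G) (insert {} (cylinders G))"
      by (rule sigma_sets_UNION) (auto intro: countable_subset[OF _ countable_cylinders])
    ultimately show ?thesis by simp
  qed
  show "sets (path_borel G) \<subseteq> sigma_sets (paths G) (insert {} (cylinders G))"
    unfolding sets_path_borel by (rule sigma_sets_mono) (auto intro: op)
qed

lemma cylinders_Pow: "insert {} (cylinders G) \<subseteq> Pow (paths G)"
  by (auto simp: cylinders_def cylinder_def)

text \<open>Cylinders are stable under intersection and generate; the whole path space is the
  cylinder of the empty list at the root.\<close>

lemma path_measure_eqI:
  assumes M: "prob_space M" "sets M = sets (path_borel G)"
    and N: "prob_space N" "sets N = sets (path_borel G)"
    and eq: "\<And>n d p. d \<in> level G n \<Longrightarrow> p \<in> finite_paths G n d \<Longrightarrow>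
        measure M (cylinder G d p) = measure N (cylinder G d p)"
  shows "M = N"
proof (rule measure_eqI_generator_eq[OF Int_stable_cylinders cylinders_Pow])
  interpret M: prob_space M by fact
  interpret N: prob_space N by fact
  show "sets M = sigma_sets (paths G) (insert {} (cylinders G))"
    "sets N = sigma_sets (paths G) (insert {} (cylinders G))"
    using M(2) N(2) sets_path_borel_cylinders by simp_all
  show "emeasure M X = emeasure N X" if "X \<in> insert {} (cylinders G)" for X
    using that eq by (auto simp: cylinders_def M.emeasure_eq_measure N.emeasure_eq_measure)
  show "range (\<lambda>i::nat. paths G) \<subseteq> insert {} (cylinders G)"
    using paths_eq_cylinder level_0 finite_paths_0 by (fastforce simp: cylinders_def)
  show "(\<Union>i::nat. paths G) = paths G" by simp
  show "emeasure M (paths G) \<noteq> \<infinity>" by simp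
qed

lemma paths_through_sets: "d \<in> level G n \<Longrightarrow> paths_through G n d \<in> sets (path_borel G)"
  by (simp add: paths_through_eq_cylinders finite_finite_paths sets.finite_UN)

lemma measure_paths_through:
  assumes M: "prob_space M" "sets M = sets (path_borel G)" and d: "d \<in> level G n"
  shows "measure M (paths_through G n d) = (\<Sum>p\<in>finite_paths G n d. measure M (cylinder G d p))"
proof -
  interpret prob_space M by fact
  show ?thesis unfolding paths_through_eq_cylinders[OF d]
    by (rule finite_measure_finite_Union[OF finite_finite_paths _ cylinder_disjoint]) (auto simp: M(2))
qed

section \<open>Central measures and their vertex distributions\<close>

lemma Cent_cylinder:
  assumes M: "M \<in> Cent G" and d: "d \<in> level G n" and p: "p \<in> finite_paths G n d"
  shows "measure M (cylinder G d p) = measure M (paths_through G n d) / num_paths G n d"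
proof -
  have M': "prob_space M" "sets M = sets (path_borel G)" using M by (simp_all add: Cent_def)
  have c: "measure M (cylinder G d q) = measure M (cylinder G d p)" if "q \<in> finite_paths G n d" for q
    using M d p that unfolding Cent_def by blast
  have "measure M (paths_through G n d) = (\<Sum>q\<in>finite_paths G n d. measure M (cylinder G d p))"
    unfolding measure_paths_through[OF M' d] by (intro sum.cong refl c)
  then have "measure M (paths_through G n d) = num_paths G n d * measure M (cylinder G d p)"
    by (simp add: num_paths_def)
  then show ?thesis using num_paths_pos[OF d] by simp
qed

text \<open>The cylinders ending at a vertex share its mass equally, so the vertex distributions on
  all levels already fix a central measure.\<close>

lemma Cent_eqI:
  assumes M: "M \<in> Cent G" and N: "N \<in> Cent G"
    and eq: "\<And>n d. d \<in> level G n \<Longrightarrow> measure M (paths_through G n d) = measure N (paths_through G n d)"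
  shows "M = N"
proof (rule path_measure_eqI)
  show "prob_space M" "sets M = sets (path_borel G)" "prob_space N" "sets N = sets (path_borel G)"
    using M N by (auto simp: Cent_def)
  show "measure M (cylinder G d p) = measure N (cylinder G d p)"
    if "d \<in> level G n" "p \<in> finite_paths G n d" for n d p
    using that M N eq by (simp add: Cent_cylinder)
qed

text \<open>Dividing by the number of paths recovers the common mass of the cylinders at a vertex;
  splitting one of them, which exists because every vertex can be reached, gives the
  equation.\<close>

lemma Cent_harmonic:
  assumes M: "M \<in> Cent G"
  shows "harmonic G (\<lambda>n v. measure M (paths_through G n v) / num_paths G n v)"
proof -
  have M': "prob_space M" "sets M = sets (path_borel G)" using M by (auto simp: Cent_def)
  interpret prob_space M by fact
  have sp: "space M = paths G" using sets_eq_imp_space_eq[OF M'(2)] by simp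
  have "paths_through G 0 r = paths G" using level_0 by (auto simp: paths_through_def paths_def)
  then have r: "measure M (paths_through G 0 r) = 1" using prob_space sp by simp
  have e1: "measure M (paths_through G n v) / num_paths G n v =
    (\<Sum>w\<in>level G (Suc n). mult_edges G n v w * (measure M (paths_through G (Suc n) w) / num_paths G (Suc n) w))"
    if v: "v \<in> level G n" for n v
  proof -
    obtain p where p: "p \<in> finite_paths G n v" using finite_paths_nonempty[OF v] by blast
    have len: "length p = n" using p by (simp add: finite_paths_def)
    let ?S = "SIGMA w:level G (Suc n). {..<mult_edges G n v w}"
    have ext: "p @ [(v, k)] \<in> finite_paths G (Suc n) w" if "k < mult_edges G n v w" for w k
      unfolding finite_paths_Suc using v p that by force
    have "measure M (paths_through G n v) / num_paths G n v = measure M (cylinder G v p)"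
      using Cent_cylinder[OF M v p] by simp
    also have "\<dots> = (\<Sum>x\<in>?S. measure M (case x of (w, k) \<Rightarrow> cylinder G w (p @ [(v, k)])))"
      unfolding cylinder_split[OF v len]
      by (rule finite_measure_finite_Union[OF _ _ cylinder_disjoint_split[OF len]])
         (auto simp: M'(2) finite_level)
    also have "\<dots> = (\<Sum>(w, k)\<in>?S. measure M (paths_through G (Suc n) w) / num_paths G (Suc n) w)"
      by (intro sum.cong refl) (auto simp: Cent_cylinder[OF M] ext)
    also have "\<dots> = (\<Sum>w\<in>level G (Suc n). \<Sum>k<mult_edges G n v w. measure M (paths_through G (Suc n) w) / num_paths G (Suc n) w)"
      by (subst sum.Sigma) (auto simp: finite_level)
    finally show ?thesis by simp
  qed
  have e2: "measure M (paths_through G 0 v) / num_paths G 0 v = 1" if "v \<in> level G 0" for v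
    using that level_0 r by (simp add: num_paths_def finite_paths_0)
  show ?thesis unfolding harmonic_def
    by (intro conjI allI ballI, erule e2, simp, erule e1)
qed


text \<open>
  Every harmonic function comes from a central measure: at each vertex \<open>(n, v)\<close> choose independently an
  outgoing edge, the edge to \<open>w\<close> having probability \<open>\<psi> (n + 1) w / \<psi> n v\<close>, and follow the choices from the
  root. Where \<open>\<psi> n v = 0\<close> the choice does not matter and is made uniformly.
\<close>

lemma harmonic_Cent:
  assumes h: "harmonic G \<psi>"
  shows "\<exists>M\<in>Cent G. \<forall>n. \<forall>d\<in>level G n. \<forall>p\<in>finite_paths G n d. measure M (cylinder G d p) = \<psi> n d"
proof -
  have nonneg: "0 \<le> \<psi> n v" if "v \<in> level G n" for n v using harmonic_nonneg[OF h that] .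
  have step: "\<psi> n v = (\<Sum>w\<in>level G (Suc n). of_nat (mult_edges G n v w) * \<psi> (Suc n) w)"
    if "v \<in> level G n" for n v using harmonic_step[OF h that] .
  define I where "I = {(n, v). v \<in> level G n}"
  \<comment> \<open>Outgoing edges are stored as (target, edge number), whereas a path stores
    (source, edge number); \<open>path\<close> below converts between the two.\<close>
  define E where "E = (\<lambda>(n, v). SIGMA w:level G (Suc n). {..<mult_edges G n v w})"
  define q where "q = (\<lambda>(n, v) (w, k :: nat). if \<psi> n v = 0 then 1 / card (E (n, v)) else \<psi> (Suc n) w / \<psi> n v)"
  \<comment> \<open>The product construction wants a probability space at every index, so indices
    that are no vertices carry a dummy point mass.\<close>
  define K where "K = (\<lambda>i. if i \<in> I then point_measure (E i) (q i) else point_measure {undefined} (\<lambda>_. 1))"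
  have finE: "finite (E i)" for i by (cases i) (auto simp: E_def finite_level)
  have neE: "E (n, v) \<noteq> {}" if "v \<in> level G n" for n v
    using succ[OF that] by (force simp: E_def)
  have q_nonneg: "0 \<le> q (n, v) e" if "v \<in> level G n" "e \<in> E (n, v)" for n v e
    using that nonneg by (cases e) (auto simp: q_def E_def)
  have q_sum: "(\<Sum>e\<in>E (n, v). q (n, v) e) = 1" if v: "v \<in> level G n" for n v
  proof (cases "\<psi> n v = 0")
    case True
    then show ?thesis using neE[OF v] finE[of "(n, v)"]
      by (simp add: q_def case_prod_unfold)
  next
    case False
    have "(\<Sum>e\<in>E (n, v). q (n, v) e) = (\<Sum>(w, k)\<in>E (n, v). \<psi> (Suc n) w / \<psi> n v)"
      using False by (intro sum.cong) (auto simp: q_def)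
    also have "\<dots> = (\<Sum>w\<in>level G (Suc n). \<Sum>k<mult_edges G n v w. \<psi> (Suc n) w / \<psi> n v)"
      unfolding E_def prod.case by (rule sum.Sigma[symmetric]) (simp_all add: finite_level)
    also have "\<dots> = \<psi> n v / \<psi> n v"
      by (subst (2) step[OF v]) (simp add: sum_divide_distrib)
    finally show ?thesis using False by simp
  qed
  have K_space: "space (K (n, v)) = E (n, v)" if "v \<in> level G n" for n v
    using that by (simp add: K_def I_def space_point_measure)
  have K_sets: "sets (K (n, v)) = Pow (E (n, v))" if "v \<in> level G n" for n v
    using that by (simp add: K_def I_def sets_point_measure)
  have K_single: "measure (K (n, v)) {e} = q (n, v) e" if "v \<in> level G n" "e \<in> E (n, v)" for n v e
    using that q_nonneg[OF that]
    by (simp add: K_def I_def measure_def emeasure_point_measure_finite finE)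
  have K_prob: "prob_space (K i)" for i
  proof (cases "i \<in> I")
    case True
    then obtain n v where i: "i = (n, v)" "v \<in> level G n" by (auto simp: I_def)
    have "emeasure (K i) (space (K i)) = (\<Sum>e\<in>E (n, v). ennreal (q (n, v) e))"
      using True i by (simp add: K_def space_point_measure emeasure_point_measure_finite finE)
    also have "\<dots> = 1" using q_sum[OF i(2)] q_nonneg[OF i(2)] by (simp add: sum_ennreal)
    finally show ?thesis by (rule prob_spaceI)
  next
    case False
    then show ?thesis
      by (auto intro!: prob_spaceI simp: K_def space_point_measure emeasure_point_measure_finite)
  qed
  interpret K: product_prob_space K I
    by (intro product_prob_spaceI K_prob)
  define P where "P = PiM I K"
  interpret P: prob_space P unfolding P_def by (rule prob_space_PiM) (rule K_prob)
  \<comment> \<open>\<open>x (n, v)\<close> is the edge chosen at \<open>v\<close>. Following the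
    choices from \<open>r\<close> meets one vertex per level, and the remaining coordinates of
    \<open>x\<close> are never read.\<close>
  define vert where "vert = (\<lambda>x :: nat \<times> 'v \<Rightarrow> 'v \<times> nat. rec_nat r (\<lambda>n v. fst (x (n, v))))"
  define path where "path = (\<lambda>x n. (vert x n, snd (x (n, vert x n))))"
  have vert_0: "vert x 0 = r" for x by (simp add: vert_def)
  have vert_Suc: "vert x (Suc n) = fst (x (n, vert x n))" for x n by (simp add: vert_def)
  have xE: "x (n, v) \<in> E (n, v)" if "x \<in> space P" "v \<in> level G n" for x n v
    using that K_space[OF that(2)] unfolding P_def space_PiM I_def by (auto simp: PiE_def Pi_def)
  have vert_level: "vert x n \<in> level G n" if "x \<in> space P" for x n
  proof (induction n)
    case 0 then show ?case by (simp add: vert_0 level_0)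
  next
    case (Suc n)
    show ?case using xE[OF that Suc] by (auto simp: vert_Suc E_def)
  qed
  have path_paths: "path x \<in> paths G" if "x \<in> space P" for x
  proof -
    have "snd (x (n, vert x n)) < mult_edges G n (vert x n) (fst (x (n, vert x n)))" for n
      using xE[OF that vert_level[OF that, of n]] by (cases "x (n, vert x n)") (auto simp: E_def)
    then show ?thesis using vert_level[OF that] by (simp add: path_def paths_def vert_Suc)
  qed
  define nxt where "nxt = (\<lambda>d (p :: ('v \<times> nat) list) i. if i < length p then fst (p ! i) else d)"
  have cyl: "path -` cylinder G d p \<inter> space P \<in> sets P \<and>
      measure P (path -` cylinder G d p \<inter> space P) = \<psi> n d"
    if d: "d \<in> level G n" and p: "p \<in> finite_paths G n d" for n d p
  proof -
    have len: "length p = n" using p by (simp add: finite_paths_def)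
    have nl: "nxt d p i \<in> level G i" if "i \<le> n" for i
      using that d p len by (cases "i = n") (auto simp: nxt_def finite_paths_def)
    have ne: "(nxt d p (Suc i), snd (p ! i)) \<in> E (i, nxt d p i)" if "i < n" for i
      using nl[of "Suc i"] that p len by (auto simp: E_def nxt_def finite_paths_def)
    have n0: "nxt d p 0 = r" using nl[of 0] level_0 by simp
    let ?T = "\<lambda>i. {(nxt d p (Suc i), snd (p ! i))}"
    let ?J = "(\<lambda>i. (i, nxt d p i)) ` {..<n}"
    have inj: "inj_on (\<lambda>i. (i, nxt d p i)) {..<n}" by (auto simp: inj_on_def)
    \<comment> \<open>Following \<open>p\<close> constrains exactly the coordinates at the vertices
      of \<open>p\<close>. These are distinct because each carries its own level, so independence
      turns the probability into a product.\<close>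
    have pre: "path -` cylinder G d p \<inter> space P = K.emb I ?J (PiE ?J (\<lambda>j. ?T (fst j)))"
    proof (intro equalityI subsetI)
      fix x assume x: "x \<in> path -` cylinder G d p \<inter> space P"
      have px: "path x i = p ! i" if "i < n" for i using x that len by (simp add: cylinder_def)
      have pn: "fst (path x n) = d" using x len by (simp add: cylinder_def)
      have vp: "vert x i = fst (path x i)" "snd (x (i, vert x i)) = snd (path x i)" for i
        by (simp_all add: path_def)
      have 1: "vert x i = nxt d p i" if "i \<le> n" for i
        using that px[of i] pn vp(1)[of i] len by (cases "i = n") (simp_all add: nxt_def)
      have 2: "snd (x (i, vert x i)) = snd (p ! i)" if "i < n" for i
        using px[OF that] vp(2)[of i] by simp
      have "x (i, nxt d p i) = (nxt d p (Suc i), snd (p ! i))" if "i < n" for i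
        using 1[of i] 1[of "Suc i"] 2[of i] that vert_Suc[of x i] by (simp add: prod_eq_iff)
      then show "x \<in> K.emb I ?J (PiE ?J (\<lambda>j. ?T (fst j)))"
        using x by (auto simp: prod_emb_def P_def space_PiM restrict_def PiE_def Pi_def extensional_def)
    next
      fix x assume x: "x \<in> K.emb I ?J (PiE ?J (\<lambda>j. ?T (fst j)))"
      then have sp: "x \<in> space P" by (simp add: prod_emb_def P_def space_PiM)
      have e: "x (i, nxt d p i) = (nxt d p (Suc i), snd (p ! i))" if "i < n" for i
      proof -
        have a: "restrict x ?J \<in> PiE ?J (\<lambda>j. ?T (fst j))" using x by (simp add: prod_emb_def)
        have b: "(i, nxt d p i) \<in> ?J" using that by simp
        show ?thesis using PiE_mem[OF a b] b by simp
      qed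
      have v: "vert x i = nxt d p i" if "i \<le> n" for i
        using that by (induction i) (simp_all add: vert_0 n0 vert_Suc e)
      have "path x i = p ! i" if "i < n" for i
        using v[of i] e[OF that] that len by (simp add: path_def prod_eq_iff nxt_def)
      moreover have "fst (path x n) = d" using v[of n] len by (simp add: path_def nxt_def)
      ultimately show "x \<in> path -` cylinder G d p \<inter> space P"
        using sp path_paths[OF sp] len by (simp add: cylinder_def)
    qed
    have J: "?J \<subseteq> I" using nl by (auto simp: I_def)
    have TK: "?T (fst j) \<in> sets (K j)" if "j \<in> ?J" for j
      using that nl ne by (auto simp: K_sets)
    have "measure P (path -` cylinder G d p \<inter> space P) = (\<Prod>j\<in>?J. measure (K j) (?T (fst j)))"
      unfolding pre unfolding P_def by (rule K.measure_PiM_emb[OF J]) (auto intro: TK)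
    also have "\<dots> = (\<Prod>i<n. q (i, nxt d p i) (nxt d p (Suc i), snd (p ! i)))"
      by (subst prod.reindex[OF inj]) (auto intro!: prod.cong simp: K_single nl ne)
    also have "\<dots> = \<psi> n (nxt d p n)"
    proof -
      \<comment> \<open>The quotients telescope as long as \<psi> stays positive along the
        path.\<close>
      have "(\<Prod>i<j. q (i, nxt d p i) (nxt d p (Suc i), snd (p ! i))) = \<psi> j (nxt d p j)" if "j \<le> n" for j
        using that
      proof (induction j)
        case 0
        then show ?case using harmonic_0[OF h] level_0 n0 by simp
      next
        case (Suc j)
        let ?v = "nxt d p j" and ?w = "nxt d p (Suc j)"
        have vl: "?v \<in> level G j" and wl: "?w \<in> level G (Suc j)" using Suc nl by auto
        have m: "mult_edges G j ?v ?w > 0" using ne[of j] Suc by (auto simp: E_def)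
        show ?case
        proof (cases "\<psi> j ?v = 0")
          case True
          \<comment> \<open>Once \<psi> is 0 at a vertex, a sum of nonnegative terms vanishes; the
            edge used by \<open>p\<close> has positive multiplicity, so \<psi> is 0 at the next
            vertex too, whatever the uniform choice contributes.\<close>
          have "(\<Sum>w\<in>level G (Suc j). of_nat (mult_edges G j ?v w) * \<psi> (Suc j) w) = 0"
            using step[OF vl] True by simp
          then have "of_nat (mult_edges G j ?v ?w) * \<psi> (Suc j) ?w = 0"
            using wl nonneg by (subst (asm) sum_nonneg_eq_0_iff) (auto simp: finite_level)
          then show ?thesis using Suc True m by simp
        next
          case False
          then show ?thesis using Suc by (simp add: q_def)
        qed
      qed
      then show ?thesis by simp
    qed
    finally have "measure P (path -` cylinder G d p \<inter> space P) = \<psi> n d" using len by (simp add: nxt_def)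
    moreover have "path -` cylinder G d p \<inter> space P \<in> sets P"
      unfolding pre unfolding P_def by (rule sets_PiM_I[OF _ J]) (simp, blast intro: TK)
    ultimately show ?thesis by blast
  qed
  have meas: "path \<in> measurable P (path_borel G)"
  proof (rule measurable_sigma_sets[OF sets_path_borel_cylinders cylinders_Pow])
    show "path \<in> space P \<rightarrow> paths G" using path_paths by simp
    show "path -` y \<inter> space P \<in> sets P" if "y \<in> insert {} (cylinders G)" for y
      using that cyl by (auto simp: cylinders_def)
  qed
  define M where "M = distr P (path_borel G) path"
  have "prob_space M" unfolding M_def by (rule P.prob_space_distr[OF meas])
  moreover have "sets M = sets (path_borel G)" by (simp add: M_def)
  moreover have c: "measure M (cylinder G d p) = \<psi> n d" if "d \<in> level G n" "p \<in> finite_paths G n d" for n d p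
    using cyl[OF that] by (simp add: M_def measure_distr[OF meas])
  ultimately have "M \<in> Cent G" by (simp add: Cent_def)
  then show ?thesis using c by blast
qed

lemma harmonic_Cent_paths_through:
  fixes \<psi> :: "nat \<Rightarrow> 'v \<Rightarrow> real"
  assumes h: "harmonic G \<psi>"
  shows "\<exists>M\<in>Cent G. \<forall>n. \<forall>d\<in>level G n. measure M (paths_through G n d) = num_paths G n d * \<psi> n d"
proof -
  obtain M where M: "M \<in> Cent G"
    and c: "\<And>n d p. d \<in> level G n \<Longrightarrow> p \<in> finite_paths G n d \<Longrightarrow> measure M (cylinder G d p) = \<psi> n d"
    using harmonic_Cent[OF h] by blast
  have "measure M (paths_through G n d) = num_paths G n d * \<psi> n d" if "d \<in> level G n" for n d
    using measure_paths_through[of M d n] M that c by (simp add: Cent_def num_paths_def)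
  then show ?thesis using M by blast
qed

end


subsection \<open>The pascalized graph\<close>

lemma level_pascalized: "level (pascalized G) n = {(i, v). i \<le> n \<and> even (n - i) \<and> v \<in> level G i}"
  by (simp add: pascalized_def)

lemma mult_pascalized:
  "mult_edges (pascalized G) n (i, v) (j, w) =
     (if j = Suc i then mult_edges G i v w else if i = Suc j then mult_edges G j w v else 0)"
  by (simp add: pascalized_def)

text \<open>Steps up supply a successor everywhere and a predecessor away from height 0. A vertex of
  height 0 on a positive level can only be entered by a step down, from a successor of its element
  in \<open>G\<close>.\<close>

lemma bratteli_pascalized:
  assumes "bratteli_graph G r"
  shows "bratteli_graph (pascalized G) (0, r)"
proof -
  interpret bratteli_graph G r by fact
  show ?thesis
  proof
    fix n
    have "level (pascalized G) n \<subseteq> (SIGMA i:{..n}. level G i)" by (auto simp: level_pascalized)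
    then show "finite (level (pascalized G) n)"
      by (rule finite_subset) (simp add: finite_level)
  next
    show "level (pascalized G) 0 = {(0, r)}" using level_0 by (auto simp: level_pascalized)
  next
    fix n x assume x: "x \<in> level (pascalized G) (Suc n)"
    obtain i v where xv: "x = (i, v)" by (cases x)
    have i: "i \<le> Suc n" "even (Suc n - i)" "v \<in> level G i" using x by (auto simp: xv level_pascalized)
    show "\<exists>u\<in>level (pascalized G) n. 0 < mult_edges (pascalized G) n u x"
    proof (cases i)
      case 0
      then have n: "n \<ge> 1" "odd n" using i by (auto elim: oddE)
      obtain w where "w \<in> level G (Suc 0)" "mult_edges G 0 v w > 0" using succ i 0 by auto
      then show ?thesis using n 0 xv
        by (intro bexI[of _ "(1, w)"]) (auto simp: mult_pascalized level_pascalized)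
    next
      case (Suc i')
      obtain u where "u \<in> level G i'" "mult_edges G i' u v > 0" using pred i Suc by auto
      then show ?thesis using i Suc xv
        by (intro bexI[of _ "(i', u)"]) (auto simp: mult_pascalized level_pascalized)
    qed
  next
    fix n x assume x: "x \<in> level (pascalized G) n"
    obtain i v where xv: "x = (i, v)" by (cases x)
    have i: "i \<le> n" "even (n - i)" "v \<in> level G i" using x by (auto simp: xv level_pascalized)
    obtain w where "w \<in> level G (Suc i)" "mult_edges G i v w > 0" using succ i by auto
    then show "\<exists>w\<in>level (pascalized G) (Suc n). 0 < mult_edges (pascalized G) n x w" using i xv
      by (intro bexI[of _ "(Suc i, w)"]) (auto simp: mult_pascalized level_pascalized)
  qed
qed

lemma pascal_path_paths [simp]: "pascal_path \<omega> \<in> paths (pascalized G) \<longleftrightarrow> \<omega> \<in> paths G"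
  by (simp add: pascal_path_def paths_def level_pascalized mult_pascalized)

lemma vimage_pascal_paths_through:
  "pascal_path -` paths_through (pascalized G) n (n, v) \<inter> paths G = paths_through G n v"
  by (auto simp: paths_through_def) (auto simp: pascal_path_def)

text \<open>A finite path reaching \<open>(n, v)\<close> with \<open>|v| = n\<close> has gone up in every step.\<close>

lemma finite_path_pascalized_full:
  assumes p: "p \<in> finite_paths (pascalized G) n (n, v)" and v: "v \<in> level G n"
  shows "map (\<lambda>((i, u), k). (u, k)) p \<in> finite_paths G n v"
    and "pascal_path -` cylinder (pascalized G) (n, v) p \<inter> paths G =
      cylinder G v (map (\<lambda>((i, u), k). (u, k)) p)"
proof -
  have len: "length p = n" using p by (simp add: finite_paths_def)
  define nx where "nx i = (if i < n then fst (p ! i) else (n, v))" for i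
  have P: "fst (p ! i) \<in> level (pascalized G) i"
      "snd (p ! i) < mult_edges (pascalized G) i (fst (p ! i)) (nx (Suc i))" if "i < n" for i
    using p that by (auto simp: finite_paths_def nx_def)
  \<comment> \<open>Backward induction: the height is \<open>n\<close> at the end, changes by one in
    each step and never exceeds the level, so it equals the level throughout.\<close>
  have up: "fst (nx i) = i" if "i \<le> n" for i
    using that
  proof (induction rule: inc_induct)
    case (step i)
    obtain j u where ju: "fst (p ! i) = (j, u)" by (cases "fst (p ! i)")
    obtain w where w: "nx (Suc i) = (Suc i, w)" using step by (cases "nx (Suc i)") auto
    have "snd (p ! i) < mult_edges (pascalized G) i (j, u) (Suc i, w)" using P(2)[of i] step ju w by simp
    then have "j = i \<or> j = Suc (Suc i)" by (auto simp: mult_pascalized split: if_splits)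
    moreover have "j \<le> i" using P(1)[of i] step ju by (auto simp: level_pascalized)
    ultimately show ?case using step ju by (simp add: nx_def)
  qed (simp add: nx_def)
  define f where "f = (\<lambda>((i :: nat, u :: 'a), k :: nat). (u, k))"
  have f: "f x = (snd (fst x), snd x)" for x by (cases x) (auto simp: f_def)
  have ui: "p ! i = ((i, fst (f (p ! i))), snd (f (p ! i)))" if "i < n" for i
    using up[of i] that by (simp add: nx_def f prod_eq_iff)
  have nxf: "nx i = (i, if i < n then fst (f (p ! i)) else v)" if "i \<le> n" for i
    using up[of i] that by (auto simp: nx_def f prod_eq_iff)
  have "fst (f (p ! i)) \<in> level G i \<and>
      snd (f (p ! i)) < mult_edges G i (fst (f (p ! i))) (if Suc i < n then fst (f (p ! Suc i)) else v)"
    if i: "i < n" for i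
  proof -
    have n1: "nx (Suc i) = (Suc i, if Suc i < n then fst (f (p ! Suc i)) else v)" using nxf[of "Suc i"] i by simp
    have e: "fst (p ! i) = (i, fst (f (p ! i)))" using arg_cong[OF ui[OF i], of fst] by simp
    have "snd (f (p ! i)) = snd (p ! i)" by (simp add: f)
    then show ?thesis using P[OF i] unfolding n1 e by (simp add: level_pascalized mult_pascalized)
  qed
  note F = this
  have F': "\<forall>i<n. fst (map f p ! i) \<in> level G i \<and>
      snd (map f p ! i) < mult_edges G i (fst (map f p ! i)) (if Suc i < n then fst (map f p ! Suc i) else v)"
  proof (intro allI impI)
    fix i assume i: "i < n"
    show "fst (map f p ! i) \<in> level G i \<and>
      snd (map f p ! i) < mult_edges G i (fst (map f p ! i)) (if Suc i < n then fst (map f p ! Suc i) else v)"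
      using F[OF i] i len by (cases "Suc i < n") simp_all
  qed
  have "length (map f p) = n" using len by simp
  then show "map (\<lambda>((i, u), k). (u, k)) p \<in> finite_paths G n v"
    unfolding f_def[symmetric] finite_paths_def using F' by blast
  have "pascal_path \<omega> i = p ! i \<longleftrightarrow> \<omega> i = f (p ! i)" if "i < n" for \<omega> i
    using ui[OF that] by (auto simp: pascal_path_def prod_eq_iff f)
  then show "pascal_path -` cylinder (pascalized G) (n, v) p \<inter> paths G =
      cylinder G v (map (\<lambda>((i, u), k). (u, k)) p)"
    unfolding f_def[symmetric] by (auto simp: cylinder_def len) (auto simp: pascal_path_def)
qed

lemma vimage_pascal_cylinder_lower:
  assumes "i < n" "length p = n"
  shows "pascal_path -` cylinder (pascalized G) (i, v) p = {}"
  using assms by (auto simp: cylinder_def pascal_path_def)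

section \<open>Transport of central measures between the two graphs\<close>

context bratteli_graph
begin

text \<open>Cylinders at a vertex of full height pull back to cylinders, all others to the empty
  set.\<close>

lemma pascal_path_measurable: "pascal_path \<in> measurable (path_borel G) (path_borel (pascalized G))"
proof -
  interpret P: bratteli_graph "pascalized G" "(0, r)" by (rule bratteli_pascalized) unfold_locales
  show ?thesis
  proof (rule measurable_sigma_sets[OF P.sets_path_borel_cylinders P.cylinders_Pow])
    show "pascal_path \<in> space (path_borel G) \<rightarrow> paths (pascalized G)" by simp
    fix y assume y: "y \<in> insert {} (cylinders (pascalized G))"
    show "pascal_path -` y \<inter> space (path_borel G) \<in> sets (path_borel G)"
    proof (cases "y = {}")
      case False
      then obtain n i v p where iv: "(i, v) \<in> level (pascalized G) n"
        and p: "p \<in> finite_paths (pascalized G) n (i, v)" and y: "y = cylinder (pascalized G) (i, v) p"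
        using y by (auto simp: cylinders_def)
      show ?thesis
      proof (cases "i = n")
        case True
        then show ?thesis using iv p y by (simp add: finite_path_pascalized_full(2) level_pascalized)
      next
        case False
        then have "i < n" using iv by (auto simp: level_pascalized)
        then show ?thesis using p y by (simp add: vimage_pascal_cylinder_lower finite_paths_def)
      qed
    qed simp
  qed
qed

lemma pascal_measure:
  assumes M: "M \<in> Cent G"
  shows "prob_space (pascal_measure G M)"
    and "sets (pascal_measure G M) = sets (path_borel (pascalized G))"
    and "A \<in> sets (path_borel (pascalized G)) \<Longrightarrow>
      measure (pascal_measure G M) A = measure M (pascal_path -` A \<inter> paths G)"
proof -
  have M': "prob_space M" "sets M = sets (path_borel G)" using M by (auto simp: Cent_def)
  interpret prob_space M by fact
  have sp: "space M = paths G" using sets_eq_imp_space_eq[OF M'(2)] by simp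
  have me: "pascal_path \<in> measurable M (path_borel (pascalized G))"
    using pascal_path_measurable measurable_cong_sets[OF M'(2) refl] by blast
  show "prob_space (pascal_measure G M)" unfolding pascal_measure_def by (rule prob_space_distr[OF me])
  show "sets (pascal_measure G M) = sets (path_borel (pascalized G))" by (simp add: pascal_measure_def)
  show "measure (pascal_measure G M) A = measure M (pascal_path -` A \<inter> paths G)"
    if "A \<in> sets (path_borel (pascalized G))"
    using that by (simp add: pascal_measure_def measure_distr[OF me] sp)
qed

lemma measure_pascal_cylinder:
  assumes M: "M \<in> Cent G" and iv: "(i, v) \<in> level (pascalized G) n"
    and p: "p \<in> finite_paths (pascalized G) n (i, v)"
  shows "measure (pascal_measure G M) (cylinder (pascalized G) (i, v) p) =
    (if i = n then measure M (paths_through G n v) / num_paths G n v else 0)"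
proof (cases "i = n")
  case True
  then show ?thesis using iv p Cent_cylinder[OF M, of v n]
    by (simp add: pascal_measure(3)[OF M] finite_path_pascalized_full level_pascalized)
next
  case False
  then have "i < n" using iv by (auto simp: level_pascalized)
  then show ?thesis using p
    by (simp add: pascal_measure(3)[OF M] vimage_pascal_cylinder_lower finite_paths_def)
qed

lemma pascal_measure_Cent:
  assumes M: "M \<in> Cent G"
  shows "pascal_measure G M \<in> Cent (pascalized G)"
  unfolding Cent_def using pascal_measure(1,2)[OF M] measure_pascal_cylinder[OF M] by auto

lemma inj_on_pascal_measure: "inj_on (pascal_measure G) (Cent G)"
proof (rule inj_onI)
  interpret P: bratteli_graph "pascalized G" "(0, r)" by (rule bratteli_pascalized) unfold_locales
  fix M N assume M: "M \<in> Cent G" and N: "N \<in> Cent G" and eq: "pascal_measure G M = pascal_measure G N"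
  show "M = N"
  proof (rule Cent_eqI[OF M N])
    fix n v assume "v \<in> level G n"
    then have "paths_through (pascalized G) n (n, v) \<in> sets (path_borel (pascalized G))"
      by (intro P.paths_through_sets) (simp add: level_pascalized)
    then show "measure M (paths_through G n v) = measure N (paths_through G n v)"
      using pascal_measure(3)[OF M] pascal_measure(3)[OF N] eq by (metis vimage_pascal_paths_through)
  qed
qed

text \<open>Null vertices contribute nothing to harmonicity, so the values of \<psi> at the vertices
  \<open>(n, v)\<close> of full height are harmonic on \<open>G\<close> itself and come from a
  central measure there. The two measures are then compared on cylinders.\<close>

lemma ex_pascal_measure:
  assumes M: "M \<in> Cent (pascalized G)"
    and null: "\<And>n i v. (i, v) \<in> level (pascalized G) n \<Longrightarrow> i < n \<Longrightarrow>
        measure M (paths_through (pascalized G) n (i, v)) = 0"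
  shows "\<exists>M\<^sub>0\<in>Cent G. M = pascal_measure G M\<^sub>0"
proof -
  interpret P: bratteli_graph "pascalized G" "(0, r)" by (rule bratteli_pascalized) unfold_locales
  define \<psi> where "\<psi> = (\<lambda>n x. measure M (paths_through (pascalized G) n x) / num_paths (pascalized G) n x)"
  have h: "harmonic (pascalized G) \<psi>" unfolding \<psi>_def by (rule P.Cent_harmonic[OF M])
  define \<psi>0 where "\<psi>0 = (\<lambda>n v. \<psi> n (n, v))"
  have "harmonic G \<psi>0" unfolding harmonic_def
  proof (intro conjI ballI allI)
    fix v assume "v \<in> level G 0" then show "\<psi>0 0 v = 1"
      using harmonic_0[OF h, of "(0, v)"] by (simp add: \<psi>0_def level_pascalized)
  next
    fix n v assume v: "v \<in> level G n"
    then have v': "(n, v) \<in> level (pascalized G) n" by (simp add: level_pascalized)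
    show "0 \<le> \<psi>0 n v" using harmonic_nonneg[OF h v'] by (simp add: \<psi>0_def)
    have "\<psi> n (n, v) = (\<Sum>x\<in>level (pascalized G) (Suc n). mult_edges (pascalized G) n (n, v) x * \<psi> (Suc n) x)"
      by (rule harmonic_step[OF h v'])
    \<comment> \<open>Every vertex of the next level that is not of full height is null, so only the
      steps up remain in the sum.\<close>
    also have "\<dots> = (\<Sum>x\<in>Pair (Suc n) ` level G (Suc n). mult_edges (pascalized G) n (n, v) x * \<psi> (Suc n) x)"
    proof (rule sum.mono_neutral_right[OF P.finite_level])
      show "Pair (Suc n) ` level G (Suc n) \<subseteq> level (pascalized G) (Suc n)" by (auto simp: level_pascalized)
      show "\<forall>x\<in>level (pascalized G) (Suc n) - Pair (Suc n) ` level G (Suc n).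
          mult_edges (pascalized G) n (n, v) x * \<psi> (Suc n) x = 0"
      proof
        fix x assume x: "x \<in> level (pascalized G) (Suc n) - Pair (Suc n) ` level G (Suc n)"
        obtain j w where jw: "x = (j, w)" by (cases x)
        have "j < Suc n" using x jw by (cases "j = Suc n") (auto simp: level_pascalized)
        then show "mult_edges (pascalized G) n (n, v) x * \<psi> (Suc n) x = 0"
          using null[of j w "Suc n"] x jw by (simp add: \<psi>_def)
      qed
    qed
    also have "\<dots> = (\<Sum>w\<in>level G (Suc n). mult_edges G n v w * \<psi>0 (Suc n) w)"
      by (subst sum.reindex) (auto simp: inj_on_def \<psi>0_def mult_pascalized)
    finally show "\<psi>0 n v = (\<Sum>w\<in>level G (Suc n). mult_edges G n v w * \<psi>0 (Suc n) w)" by (simp add: \<psi>0_def)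
  qed
  then obtain M0 where M0: "M0 \<in> Cent G"
    and c: "\<And>n d. d \<in> level G n \<Longrightarrow> measure M0 (paths_through G n d) = num_paths G n d * \<psi>0 n d"
    using harmonic_Cent_paths_through by blast
  have "M = pascal_measure G M0"
  proof (rule P.path_measure_eqI)
    show "prob_space M" "sets M = sets (path_borel (pascalized G))" using M by (auto simp: Cent_def)
    show "prob_space (pascal_measure G M0)" "sets (pascal_measure G M0) = sets (path_borel (pascalized G))"
      using pascal_measure(1,2)[OF M0] by auto
    fix n x p assume x: "x \<in> level (pascalized G) n" and p: "p \<in> finite_paths (pascalized G) n x"
    obtain i v where iv: "x = (i, v)" by (cases x)
    have "measure M (cylinder (pascalized G) x p) = \<psi> n x"
      using P.Cent_cylinder[OF M x p] by (simp add: \<psi>_def)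
    also have "\<dots> = measure (pascal_measure G M0) (cylinder (pascalized G) x p)"
    proof (cases "i = n")
      case True
      then have v: "v \<in> level G n" using x iv by (simp add: level_pascalized)
      show ?thesis using measure_pascal_cylinder[OF M0, of i v n p] x p iv True c[OF v] num_paths_pos[OF v]
        by (simp add: \<psi>0_def)
    next
      case False
      then have "i < n" using x iv by (auto simp: level_pascalized)
      then show ?thesis using measure_pascal_cylinder[OF M0, of i v n p] x p iv null[of i v n]
        by (simp add: \<psi>_def)
    qed
    finally show "measure M (cylinder (pascalized G) x p) = measure (pascal_measure G M0) (cylinder (pascalized G) x p)" .
  qed
  then show ?thesis using M0 by blast
qed

end

section \<open>Harmonic functions on the weighted half line\<close>

lemma power_dominated_nonpos:
  fixes x K :: real
  assumes "\<And>k. x \<le> K * (1/2) ^ k"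
  shows "x \<le> 0"
proof -
  have "(\<lambda>k. K * (1/2) ^ k) \<longlonglongrightarrow> K * 0"
    by (intro tendsto_mult tendsto_const LIMSEQ_power_zero) simp
  then show ?thesis using LIMSEQ_le_const[of "\<lambda>k. K * (1/2) ^ k" 0 x] assms by auto
qed

text \<open>
  In the coordinates \<open>u d i = g (i + 2 d) i\<close>, the equation says that \<open>g\<close> is harmonic for the walk on the
  half line whose step down from \<open>i\<close> has weight \<open>a i\<close>. Inserting a step down and up at height \<open>m\<close> gains
  the factor \<open>a m\<close>, so \<open>u (d + 1) m \<le> u d m / a m\<close>. A walk confined below \<open>m\<close> has weights of fixed exponential
  growth, negligible against those of an unconfined walk, and therefore the inequality propagates by a
  maximum principle from height \<open>m\<close> to all lower heights, in particular to height \<open>0\<close>, for every \<open>m\<close>.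
\<close>

lemma harmonic_half_line:
  fixes u :: "nat \<Rightarrow> nat \<Rightarrow> real" and a :: "nat \<Rightarrow> nat"
  assumes nonneg: "\<And>d i. 0 \<le> u d i"
    and rec_0: "\<And>d. u d 0 = u d (Suc 0)"
    and rec_Suc: "\<And>d i. u d (Suc i) = u d (Suc (Suc i)) + a (Suc i) * u (Suc d) i"
    and a_pos: "\<And>i. 1 \<le> a (Suc i)"
    and unb: "\<not> bdd_above (range (\<lambda>i. a (Suc i)))"
  shows "u (Suc d) i = 0"
proof -
  have large: "\<exists>p. real (a (Suc p)) \<ge> K" for K :: real
  proof (rule ccontr)
    assume "\<not> ?thesis"
    then have "a (Suc p) \<le> nat \<lceil>K\<rceil>" for p
      by (meson le_nat_iff linorder_not_le nat_le_linear of_nat_ceiling order_less_imp_le order_trans real_nat_ceiling_ge of_nat_le_iff)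
    then show False using unb by (auto simp: bdd_above_def)
  qed
  have dec: "u d (Suc i) \<le> u d i" for d i
    using nonneg[of "Suc d" "i - 1"] rec_0 rec_Suc[of d "i - 1"] by (cases i) simp_all
  have dec_le: "u d j \<le> u d i" if "i \<le> j" for d i j
    using that by (induction rule: dec_induct) (auto intro: order_trans[OF dec])
  have down: "a (Suc i) * u (Suc d) i \<le> u d (Suc i)" for d i
    using rec_Suc[of d i] nonneg[of d "Suc (Suc i)"] by simp
  have down1: "u (Suc d) i \<le> u d (Suc i)" for d i
    using down[of i d] mult_right_mono[of 1 "real (a (Suc i))" "u (Suc d) i"] nonneg[of "Suc d" i] a_pos[of i]
    by simp
  have dec_d: "u (d + k) i \<le> u d i" for d k i
  proof (induction k)
    case (Suc k)
    have "u (Suc (d + k)) i \<le> u (d + k) i" using down1[of "d + k" i] dec[of "d + k" i] by linarith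
    then show ?case using Suc by simp
  qed simp
  have gain: "a (Suc p) * u (Suc d) (Suc p) \<le> u d (Suc p)" for p d
    using down[of p d] dec[of "Suc d" p] mult_left_mono[of "u (Suc d) (Suc p)" "u (Suc d) p" "real (a (Suc p))"]
    by simp
  have pow: "real (a (Suc p)) ^ d * u d (Suc p) \<le> u 0 (Suc p)" for p d
  proof (induction d)
    case (Suc d)
    have "real (a (Suc p)) ^ Suc d * u (Suc d) (Suc p) \<le> real (a (Suc p)) ^ d * u d (Suc p)"
      using mult_left_mono[OF gain[of p d], of "real (a (Suc p)) ^ d"] by (simp add: algebra_simps)
    then show ?case using Suc by linarith
  qed simp
  have climb: "u (d + k) i \<le> u d (i + k)" for d k i
  proof (induction k arbitrary: d)
    case (Suc k)
    have "u (d + Suc k) i \<le> u (Suc d) (i + k)" using Suc[of "Suc d"] by simp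
    then show ?case using down1[of d "i + k"] by simp
  qed simp
  have bound: "u (d + Suc p) i \<le> u d (Suc p)" if "i \<le> Suc p" for d p i
    using climb[of d "Suc p - i" i] dec_d[of "d + (Suc p - i)" i i] that by simp
  have main: "a (Suc m) * u (Suc d) 0 \<le> u d 0" for m d
  proof -
    \<comment> \<open>\<open>C\<close> bounds the total weight \<open>1 + a i\<close> of the steps
      leaving a height \<open>i \<le> m\<close>. The choice \<open>q = 2 * C\<close> leaves a factor
      \<open>1/2\<close> to spare in each step.\<close>
    define C where "C = 1 + (\<Sum>j\<le>m. real (a j))"
    have C: "1 + real (a i) \<le> C" if "i \<le> m" for i
      unfolding C_def using member_le_sum[of i "{..m}" "\<lambda>j. real (a j)"] that by simp
    have C1: "1 \<le> C" unfolding C_def by (simp add: sum_nonneg)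
    define q where "q = 2 * C"
    have q: "q > 1" using C1 by (simp add: q_def)
    \<comment> \<open>The square appears because a step down and up spends two levels: at height
      \<open>Suc p0\<close> such an excursion is worth at least \<open>q\<close> per level. The
      added sum forces \<open>p0\<close> to be at least \<open>m\<close>.\<close>
    obtain p0 where p0: "real (a (Suc p0)) \<ge> q\<^sup>2 + (\<Sum>j\<le>Suc m. real (a j))" using large by blast
    have q2: "q\<^sup>2 \<le> real (a (Suc p0))" using p0 sum_nonneg[of "{..Suc m}" "\<lambda>j. real (a j)"] by simp
    have p0m: "m \<le> p0"
    proof (rule ccontr)
      assume "\<not> m \<le> p0"
      then have "real (a (Suc p0)) \<le> (\<Sum>j\<le>Suc m. real (a j))"
        by (intro member_le_sum) auto
      then show False using p0 q by (simp add: not_le power2_eq_square)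
         (smt (verit) mult_pos_pos)
    qed
    define p where "p = Suc p0"
    \<comment> \<open>The exponent \<open>3 * p\<close> covers \<open>i + 2 * d\<close> for
      \<open>i \<le> p\<close> and \<open>d \<le> p\<close>, the range in which the crude bound
      \<open>u 0 0\<close> has to suffice.\<close>
    define K where "K = u 0 0 * q ^ (3 * p)"
    have K: "0 \<le> K" using nonneg q by (simp add: K_def)
    have est: "u d i \<le> K / q ^ (i + 2 * d)" if "i \<le> p" for d i
    proof (cases "d \<le> p")
      case True
      have "u d i \<le> u 0 0" using dec_d[of 0 d i] dec_le[of 0 i 0] by simp
      also have "\<dots> \<le> u 0 0 * (q ^ (3 * p) / q ^ (i + 2 * d))"
      proof -
        have "q ^ (i + 2 * d) \<le> q ^ (3 * p)" using True that q by (intro power_increasing) auto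
        then have "1 \<le> q ^ (3 * p) / q ^ (i + 2 * d)" using q by simp
        then show ?thesis using nonneg[of 0 0] mult_left_mono by fastforce
      qed
      finally show ?thesis by (simp add: K_def)
    next
      case False
      \<comment> \<open>Beyond \<open>p\<close>, giving up \<open>p\<close> units of
        \<open>d\<close> allows a move to height \<open>p\<close>, where the remaining
        \<open>e\<close> units are worth the factor \<open>a p ^ e\<close>, at least
        \<open>q ^ (2 * e)\<close>.\<close>
      then obtain e where d: "d = e + p" using le_iff_add[of p d] by (auto simp: add.commute)
      have "q ^ (2 * e) * u d i \<le> real (a p) ^ e * u e p"
      proof (rule mult_mono)
        show "q ^ (2 * e) \<le> real (a p) ^ e" unfolding power_mult p_def
          using q2 q by (intro power_mono) auto
        show "u d i \<le> u e p" unfolding d p_def using bound that p_def by blast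
      qed (use nonneg in auto)
      also have "\<dots> \<le> u 0 0" using pow[of p0 e] dec_le[of 0 p 0] by (simp add: p_def)
      finally have "u d i * q ^ (2 * e) \<le> u 0 0" by (simp add: mult.commute)
      then have "u d i \<le> u 0 0 / q ^ (2 * e)" using q by (simp add: pos_le_divide_eq)
      also have "\<dots> = u 0 0 * q ^ (2 * p + i) / q ^ (i + 2 * d)"
        using q by (simp add: d field_simps power_add)
      also have "\<dots> \<le> K / q ^ (i + 2 * d)"
      proof -
        have "q ^ (2 * p + i) \<le> q ^ (3 * p)" using that q by (intro power_increasing) auto
        then show ?thesis unfolding K_def using nonneg[of 0 0] q
          by (intro divide_right_mono mult_left_mono) auto
      qed
      finally show ?thesis .
    qed
    define A where "A = real (a (Suc m))"
    have A: "A \<ge> 1" using a_pos[of m] by (simp add: A_def)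
    \<comment> \<open>\<open>D\<close> obeys the same linear recursion as \<open>u\<close>, but its
      sign is unknown. It is nonpositive at the boundary height \<open>Suc m\<close>, and this is to
      be carried down to height 0.\<close>
    define D where "D = (\<lambda>d i. u (Suc d) i - u d i / A)"
    have D_top: "D d (Suc m) \<le> 0" for d
    proof -
      have "u (Suc d) (Suc m) * A \<le> u d (Suc m)" using gain[of m d] by (simp add: A_def mult.commute)
      then have "u (Suc d) (Suc m) \<le> u d (Suc m) / A" using A by (simp add: pos_le_divide_eq)
      then show ?thesis by (simp add: D_def)
    qed
    have D_0: "D d 0 = D d (Suc 0)" for d unfolding D_def using rec_0 by simp
    have D_Suc: "D d (Suc i) = D d (Suc (Suc i)) + a (Suc i) * D (Suc d) i" for d i
      unfolding D_def using rec_Suc[of d i] rec_Suc[of "Suc d" i] A by (simp add: field_simps)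
    \<comment> \<open>The recursion passes to terms on level \<open>i + 2 * d + 1\<close>, whose
      bound is smaller by the factor \<open>q\<close>, with weights of total at most
      \<open>C\<close>. Since \<open>C / q\<close> is \<open>1/2\<close>, each application halves
      the bound.\<close>
    have D_est: "D d i \<le> K / q ^ (i + 2 * d) * (1/2) ^ k" if "i \<le> m" for d i k
      using that
    proof (induction k arbitrary: d i)
      case 0
      have "D d i \<le> u (Suc d) i" using nonneg[of d i] A by (simp add: D_def)
      also have "\<dots> \<le> u d i" using dec_d[of d 1 i] by simp
      also have "\<dots> \<le> K / q ^ (i + 2 * d)" using est[of i d] 0 p0m by (simp add: p_def)
      finally show ?case by simp
    next
      case (Suc k)
      define t where "t = K / q ^ (Suc i + 2 * d) * (1/2) ^ k"
      have t: "0 \<le> t" using K q by (simp add: t_def)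
      have up: "D d (Suc i) \<le> t"
      proof (cases "i = m")
        case True then show ?thesis using D_top[of d] t by simp
      next
        case False then show ?thesis using Suc.IH[of "Suc i" d] Suc.prems by (simp add: t_def)
      qed
      have "D d i \<le> C * t"
      proof (cases i)
        case 0
        then have "D d i \<le> t" using up D_0 by simp
        also have "t \<le> C * t" using C1 t mult_right_mono[of 1 C t] by simp
        finally show ?thesis .
      next
        case (Suc j)
        have "D (Suc d) j \<le> t" using Suc.IH[of j "Suc d"] Suc Suc.prems by (simp add: t_def)
        then have "D d i \<le> t + real (a i) * t"
          using D_Suc[of d j] up mult_left_mono[of "D (Suc d) j" t "real (a i)"] Suc by simp
        also have "\<dots> = (1 + real (a i)) * t" by (simp add: algebra_simps)
        also have "\<dots> \<le> C * t" using C[of i] Suc.prems t by (intro mult_right_mono) auto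
        finally show ?thesis .
      qed
      also have "C * t = K / q ^ (i + 2 * d) * (1/2) ^ Suc k"
        using C1 by (simp add: t_def q_def field_simps)
      finally show ?case .
    qed
    have "D d 0 \<le> 0" by (rule power_dominated_nonpos[OF D_est]) simp
    then show ?thesis using A by (simp add: D_def A_def field_simps)
  qed
  \<comment> \<open>\<open>main\<close> holds for every \<open>m\<close> and the weights are
    unbounded, so \<open>u (Suc d) 0\<close> lies below arbitrarily small multiples of
    \<open>u d 0\<close>.\<close>
  have "u (Suc d) 0 = 0"
  proof (rule ccontr)
    assume "u (Suc d) 0 \<noteq> 0"
    then have pos: "u (Suc d) 0 > 0" using nonneg[of "Suc d" 0] by simp
    obtain m where "real (a (Suc m)) \<ge> u d 0 / u (Suc d) 0 + 1" using large by blast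
    then have "(u d 0 / u (Suc d) 0 + 1) * u (Suc d) 0 \<le> u d 0"
      using main[of m d] pos by (meson less_imp_le mult_right_mono order_trans)
    then have "u (Suc d) 0 * u (Suc d) 0 \<le> 0" using pos by (simp add: field_simps)
    then show False using mult_pos_pos[OF pos pos] by simp
  qed
  then show ?thesis using dec_le[of 0 i "Suc d"] nonneg[of "Suc d" i] by simp
qed

context bratteli_graph
begin

lemma harmonic_pascalized_step:
  fixes \<psi> :: "nat \<Rightarrow> nat \<times> 'v \<Rightarrow> real"
  assumes h: "harmonic (pascalized G) \<psi>" and iv: "(i, v) \<in> level (pascalized G) n"
  shows "\<psi> n (i, v) = (\<Sum>w\<in>level G (Suc i). mult_edges G i v w * \<psi> (Suc n) (Suc i, w)) +
    (if i = 0 then 0 else \<Sum>w\<in>level G (i - 1). mult_edges G (i - 1) w v * \<psi> (Suc n) (i - 1, w))"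
proof -
  interpret P: bratteli_graph "pascalized G" "(0, r)" by (rule bratteli_pascalized) unfold_locales
  let ?m = "\<lambda>x. mult_edges (pascalized G) n (i, v) x * \<psi> (Suc n) x"
  let ?U = "Pair (Suc i) ` level G (Suc i)"
  \<comment> \<open>On \<open>nat\<close>, \<open>0 - 1\<close> is 0; the case distinction keeps
    height 0 from becoming its own lower neighbour.\<close>
  let ?D = "if i = 0 then {} else Pair (i - 1) ` level G (i - 1)"
  have i: "i \<le> n" "even (n - i)" using iv by (auto simp: level_pascalized)
  have "\<psi> n (i, v) = (\<Sum>x\<in>level (pascalized G) (Suc n). ?m x)" by (rule harmonic_step[OF h iv])
  also have "\<dots> = (\<Sum>x\<in>?U \<union> ?D. ?m x)"
  proof (rule sum.mono_neutral_right[OF P.finite_level])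
    show "?U \<union> ?D \<subseteq> level (pascalized G) (Suc n)" using i by (auto simp: level_pascalized Suc_diff_le split: if_splits)
    show "\<forall>x\<in>level (pascalized G) (Suc n) - (?U \<union> ?D). ?m x = 0"
    proof
      fix x assume x: "x \<in> level (pascalized G) (Suc n) - (?U \<union> ?D)"
      obtain j w where jw: "x = (j, w)" by (cases x)
      have "w \<in> level G j" using x jw by (simp add: level_pascalized)
      then have "j \<noteq> Suc i" "i \<noteq> Suc j" using x jw by (auto split: if_splits)
      then show "?m x = 0" by (simp add: jw mult_pascalized)
    qed
  qed
  also have "\<dots> = (\<Sum>x\<in>?U. ?m x) + (\<Sum>x\<in>?D. ?m x)"
    by (rule sum.union_disjoint) (auto simp: finite_level)
  also have "(\<Sum>x\<in>?U. ?m x) = (\<Sum>w\<in>level G (Suc i). mult_edges G i v w * \<psi> (Suc n) (Suc i, w))"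
    by (subst sum.reindex) (auto simp: inj_on_def mult_pascalized)
  also have "(\<Sum>x\<in>?D. ?m x) =
      (if i = 0 then 0 else \<Sum>w\<in>level G (i - 1). mult_edges G (i - 1) w v * \<psi> (Suc n) (i - 1, w))"
    by (cases i) (auto simp: sum.reindex inj_on_def mult_pascalized)
  finally show ?thesis .
qed

text \<open>The algebras enter only through \<open>dim\<close> and its two identities. Exchanging
  the sums over adjacent levels turns \<open>down\<close> into coefficient 1 for a step up of the
  walk and \<open>up\<close> into coefficient \<open>a\<close> for a step down. Once the weighted
  sum vanishes, so do its nonnegative terms, and the dimensions are positive.\<close>

lemma Cent_pascalized_null:
  fixes dim :: "nat \<Rightarrow> 'v \<Rightarrow> nat" and a :: "nat \<Rightarrow> nat"
  assumes dim_pos: "\<And>n v. v \<in> level G n \<Longrightarrow> dim n v > 0"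
    and down: "\<And>n v. v \<in> level G (Suc n) \<Longrightarrow> (\<Sum>u\<in>level G n. mult_edges G n u v * dim n u) = dim (Suc n) v"
    and up: "\<And>n u. u \<in> level G n \<Longrightarrow>
        (\<Sum>v\<in>level G (Suc n). mult_edges G n u v * dim (Suc n) v) = a (Suc n) * dim n u"
    and a_pos: "\<And>n. 1 \<le> a (Suc n)"
    and unb: "\<not> bdd_above (range (\<lambda>n. a (Suc n)))"
    and M: "M \<in> Cent (pascalized G)"
    and iv: "(i, v) \<in> level (pascalized G) n" and i: "i < n"
  shows "measure M (paths_through (pascalized G) n (i, v)) = 0"
proof -
  interpret P: bratteli_graph "pascalized G" "(0, r)" by (rule bratteli_pascalized) unfold_locales
  define \<psi> where "\<psi> = (\<lambda>n x. measure M (paths_through (pascalized G) n x) / num_paths (pascalized G) n x)"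
  have h: "harmonic (pascalized G) \<psi>" unfolding \<psi>_def by (rule P.Cent_harmonic[OF M])
  \<comment> \<open>\<open>d\<close> counts steps down: with \<open>d\<close> of them, height
    \<open>i\<close> is reached on level \<open>i + 2 * d\<close>.\<close>
  define u where "u = (\<lambda>d i. \<Sum>v\<in>level G i. dim i v * \<psi> (i + 2 * d) (i, v))"
  have lev: "(i, v) \<in> level (pascalized G) (i + 2 * d)" if "v \<in> level G i" for i d v
    using that by (simp add: level_pascalized)
  have nonneg: "0 \<le> dim i v * \<psi> (i + 2 * d) (i, v)" if "v \<in> level G i" for i d v
    using harmonic_nonneg[OF h lev[OF that]] by simp
  have U: "(\<Sum>v\<in>level G i. dim i v * (\<Sum>w\<in>level G (Suc i). mult_edges G i v w * \<psi> (Suc (i + 2 * d)) (Suc i, w)))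
      = u d (Suc i)" for i d
  proof -
    have "(\<Sum>v\<in>level G i. dim i v * (\<Sum>w\<in>level G (Suc i). mult_edges G i v w * \<psi> (Suc (i + 2 * d)) (Suc i, w)))
      = (\<Sum>w\<in>level G (Suc i). \<Sum>v\<in>level G i. dim i v * (mult_edges G i v w * \<psi> (Suc (i + 2 * d)) (Suc i, w)))"
      unfolding sum_distrib_left by (rule sum.swap)
    also have "\<dots> = (\<Sum>w\<in>level G (Suc i). real (\<Sum>v\<in>level G i. mult_edges G i v w * dim i v) * \<psi> (Suc (i + 2 * d)) (Suc i, w))"
      unfolding of_nat_sum sum_distrib_right by (simp add: mult_ac)
    also have "\<dots> = u d (Suc i)" unfolding u_def by (simp add: down)
    finally show ?thesis .
  qed
  have L: "(\<Sum>v\<in>level G (Suc i). dim (Suc i) v * (\<Sum>w\<in>level G i. mult_edges G i w v * \<psi> (Suc (Suc i + 2 * d)) (i, w)))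
      = a (Suc i) * u (Suc d) i" for i d
  proof -
    have "(\<Sum>v\<in>level G (Suc i). dim (Suc i) v * (\<Sum>w\<in>level G i. mult_edges G i w v * \<psi> (Suc (Suc i + 2 * d)) (i, w)))
      = (\<Sum>w\<in>level G i. \<Sum>v\<in>level G (Suc i). dim (Suc i) v * (mult_edges G i w v * \<psi> (Suc (Suc i + 2 * d)) (i, w)))"
      unfolding sum_distrib_left by (rule sum.swap)
    also have "\<dots> = (\<Sum>w\<in>level G i. real (\<Sum>v\<in>level G (Suc i). mult_edges G i w v * dim (Suc i) v) * \<psi> (Suc (Suc i + 2 * d)) (i, w))"
      unfolding of_nat_sum sum_distrib_right by (simp add: mult_ac)
    also have "\<dots> = a (Suc i) * u (Suc d) i" unfolding u_def sum_distrib_left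
    proof (intro sum.cong refl)
      fix w assume w: "w \<in> level G i"
      show "real (\<Sum>v\<in>level G (Suc i). mult_edges G i w v * dim (Suc i) v) * \<psi> (Suc (Suc i + 2 * d)) (i, w) =
          a (Suc i) * (dim i w * \<psi> (i + 2 * Suc d) (i, w))"
        unfolding up[OF w] by simp
    qed
    finally show ?thesis .
  qed
  have "u (Suc d) i = 0" for d i
  proof (rule harmonic_half_line[of u a, OF _ _ _ a_pos unb])
    show "0 \<le> u d i" for d i unfolding u_def by (rule sum_nonneg) (rule nonneg)
    show "u d 0 = u d (Suc 0)" for d
      using U[of 0 d] harmonic_pascalized_step[OF h lev, of _ 0 d] by (simp add: u_def[of] cong: sum.cong)
    show "u d (Suc i) = u d (Suc (Suc i)) + a (Suc i) * u (Suc d) i" for d i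
      using U[of "Suc i" d] L[of i d] harmonic_pascalized_step[OF h lev, of _ "Suc i" d]
      by (subst u_def) (simp add: distrib_left sum.distrib cong: sum.cong)
  qed
  note u0 = this
  \<comment> \<open>Parity and \<open>i < n\<close> leave at least one step down, which matches the
    index \<open>Suc d\<close> in \<open>u0\<close>.\<close>
  obtain d where n: "n = i + 2 * Suc d"
  proof -
    have "even (n - i)" using iv unfolding level_pascalized by blast
    then obtain e where "n - i = 2 * e" by (elim evenE)
    then show ?thesis using i that[of "e - 1"] by (cases e) auto
  qed
  have v: "v \<in> level G i" using iv by (simp add: level_pascalized)
  have "dim i v * \<psi> n (i, v) = 0"
    using sum_nonneg_eq_0_iff[OF finite_level[of i], of "\<lambda>v. dim i v * \<psi> (i + 2 * Suc d) (i, v)"]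
      nonneg[of _ i "Suc d"] u0[of d i] v unfolding u_def n by blast
  then show ?thesis using dim_pos[OF v] P.num_paths_pos[OF iv] by (simp add: \<psi>_def)
qed

end


subsection \<open>Matrices\<close>

definition mat_trace :: "complex mat \<Rightarrow> complex" where
  "mat_trace X = (\<Sum>i<dim_row X. X $$ (i, i))"

lemma index_mult_mat_sum:
  "X \<in> carrier_mat n k \<Longrightarrow> Y \<in> carrier_mat k m \<Longrightarrow> i < n \<Longrightarrow> j < m \<Longrightarrow>
     (X * Y) $$ (i, j) = (\<Sum>l<k. X $$ (i, l) * Y $$ (l, j))"
  by (auto simp: scalar_prod_def lessThan_atLeast0 intro!: sum.cong)

lemma index_mult_mat_vec_sum:
  "X \<in> carrier_mat n k \<Longrightarrow> v \<in> carrier_vec k \<Longrightarrow> i < n \<Longrightarrow>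
     (X *\<^sub>v v) $ i = (\<Sum>l<k. X $$ (i, l) * v $ l)"
  by (auto simp: scalar_prod_def lessThan_atLeast0 intro!: sum.cong)

lemma mat_trace_comm:
  assumes X: "X \<in> carrier_mat n k" and Y: "Y \<in> carrier_mat k n"
  shows "mat_trace (X * Y) = mat_trace (Y * X)"
proof -
  have "mat_trace (X * Y) = (\<Sum>i<n. \<Sum>l<k. X $$ (i, l) * Y $$ (l, i))"
    unfolding mat_trace_def using X Y
    by (auto simp: index_mult_mat_sum simp del: index_mult_mat(1) intro!: sum.cong)
  also have "\<dots> = (\<Sum>l<k. \<Sum>i<n. Y $$ (l, i) * X $$ (i, l))"
    by (subst sum.swap) (simp add: mult.commute)
  also have "\<dots> = mat_trace (Y * X)"
    unfolding mat_trace_def using X Y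
    by (auto simp: index_mult_mat_sum simp del: index_mult_mat(1) intro!: sum.cong)
  finally show ?thesis .
qed

lemma mat_trace_one [simp]: "mat_trace (1\<^sub>m n) = of_nat n"
  by (simp add: mat_trace_def)

lemma mat_eq_vecI:
  assumes "X \<in> carrier_mat n m" "Y \<in> carrier_mat n m"
    and eq: "\<And>v. v \<in> carrier_vec m \<Longrightarrow> X *\<^sub>v v = Y *\<^sub>v (v :: complex vec)"
  shows "X = Y"
proof (rule eq_matI)
  fix i j assume ij: "i < dim_row Y" "j < dim_col Y"
  have "(X *\<^sub>v unit_vec m j) $ i = (Y *\<^sub>v unit_vec m j) $ i" by (subst eq) auto
  then show "X $$ (i, j) = Y $$ (i, j)" using ij assms(1,2) by simp
qed (use assms in auto)

lemma zero_mat_mult_vec: "v \<in> carrier_vec m \<Longrightarrow> 0\<^sub>m n m *\<^sub>v v = (0\<^sub>v n :: complex vec)"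
  by (intro eq_vecI) (auto simp: scalar_prod_def)

lemma scalar_mat_mult_vec:
  assumes v: "v \<in> carrier_vec m" shows "(c \<cdot>\<^sub>m 1\<^sub>m m) *\<^sub>v v = c \<cdot>\<^sub>v (v :: complex vec)"
proof (rule eq_vecI)
  fix i assume "i < dim_vec (c \<cdot>\<^sub>v v)"
  then have i: "i < m" using v by simp
  have "((c \<cdot>\<^sub>m 1\<^sub>m m) *\<^sub>v v) $ i = (\<Sum>l<m. (c \<cdot>\<^sub>m 1\<^sub>m m) $$ (i, l) * v $ l)"
    by (rule index_mult_mat_vec_sum[OF _ v i]) simp
  also have "\<dots> = (\<Sum>l<m. if i = l then c * v $ l else 0)" using i by (intro sum.cong) auto
  finally show "((c \<cdot>\<^sub>m 1\<^sub>m m) *\<^sub>v v) $ i = (c \<cdot>\<^sub>v v) $ i" using i v by simp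
qed (use v in auto)

text \<open>The dimensions agree because \<open>Q * T\<close> and \<open>T * Q\<close> have the same trace.\<close>

lemma bijective_mat:
  assumes T: "T \<in> carrier_mat n m"
    and inj: "\<And>v. v \<in> carrier_vec m \<Longrightarrow> T *\<^sub>v v = 0\<^sub>v n \<Longrightarrow> v = (0\<^sub>v m :: complex vec)"
    and surj: "\<And>w. w \<in> carrier_vec n \<Longrightarrow> \<exists>v\<in>carrier_vec m. T *\<^sub>v v = w"
  shows "n = m \<and> (\<exists>Q\<in>carrier_mat m n. T * Q = 1\<^sub>m n \<and> Q * T = 1\<^sub>m m)"
proof -
  have "\<exists>v\<in>carrier_vec m. T *\<^sub>v v = unit_vec n j" for j by (rule surj) simp
  then obtain w where w: "\<And>j. w j \<in> carrier_vec m" "\<And>j. T *\<^sub>v w j = unit_vec n j" by metis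
  define Q where "Q = mat m n (\<lambda>(i, j). w j $ i)"
  have Q: "Q \<in> carrier_mat m n" by (simp add: Q_def)
  have colQ: "col Q j = w j" if "j < n" for j
    using w(1)[of j] that by (intro eq_vecI) (auto simp: Q_def)
  have TQ: "T * Q = 1\<^sub>m n"
  proof (rule eq_matI)
    fix i j assume "i < dim_row (1\<^sub>m n :: complex mat)" "j < dim_col (1\<^sub>m n :: complex mat)"
    then have ij: "i < n" "j < n" by auto
    have "(T * Q) $$ (i, j) = (T *\<^sub>v w j) $ i" using T Q ij by (simp add: colQ)
    then show "(T * Q) $$ (i, j) = 1\<^sub>m n $$ (i, j)" using ij by (simp add: w(2) unit_vec_def eq_commute)
  qed (use T Q in auto)
  have QT: "Q * T = 1\<^sub>m m"
  proof (rule mat_eq_vecI)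
    fix v :: "complex vec" assume v: "v \<in> carrier_vec m"
    have QTv: "(Q * T) *\<^sub>v v \<in> carrier_vec m" using Q T v by auto
    have "T *\<^sub>v ((Q * T) *\<^sub>v v) = (T * (Q * T)) *\<^sub>v v"
      by (rule assoc_mult_mat_vec[symmetric, OF T mult_carrier_mat[OF Q T] v])
    also have "T * (Q * T) = (T * Q) * T" by (rule assoc_mult_mat[symmetric, OF T Q T])
    also have "\<dots> = T" using T by (simp add: TQ)
    finally have e: "T *\<^sub>v ((Q * T) *\<^sub>v v) = T *\<^sub>v v" .
    have "T *\<^sub>v ((Q * T) *\<^sub>v v - v) = T *\<^sub>v ((Q * T) *\<^sub>v v) - T *\<^sub>v v"
      by (rule mult_minus_distrib_mat_vec[OF T QTv v])
    also have "\<dots> = 0\<^sub>v n" unfolding e using T v by auto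
    finally have "(Q * T) *\<^sub>v v - v = 0\<^sub>v m" using inj QTv v by auto
    note z = this
    have "(Q * T) *\<^sub>v v = v"
    proof (rule eq_vecI)
      fix i assume "i < dim_vec v"
      then show "((Q * T) *\<^sub>v v) $ i = v $ i" using arg_cong[OF z, of "\<lambda>x. x $ i"] v by simp
    qed (use Q T v in auto)
    then show "(Q * T) *\<^sub>v v = 1\<^sub>m m *\<^sub>v v" using v by simp
  qed (use Q T in auto)
  have "of_nat n = (of_nat m :: complex)" using mat_trace_comm[OF T Q] by (simp add: TQ QT)
  then show ?thesis using Q TQ QT by auto
qed

subsection \<open>Modules in coordinates\<close>

text \<open>With entries in place of matrices, linearity and products become identities of complex
  numbers, and a sum over elements of the algebra needs no sum of matrices.\<close>

definition ent :: "'a fdmod \<Rightarrow> 'a \<Rightarrow> nat \<Rightarrow> nat \<Rightarrow> complex" where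
  "ent M a p q = action M a $$ (p, q)"

definition character :: "'a fdmod \<Rightarrow> 'a \<Rightarrow> complex" where
  "character M a = (\<Sum>i<mod_dim M. ent M a i i)"

lemma is_module_carrier: "is_module A M \<Longrightarrow> a \<in> A \<Longrightarrow> action M a \<in> carrier_mat (mod_dim M) (mod_dim M)"
  by (simp add: is_module_def)

lemma is_module_mult: "is_module A M \<Longrightarrow> a \<in> A \<Longrightarrow> b \<in> A \<Longrightarrow> action M (a * b) = action M a * action M b"
  by (simp add: is_module_def)

lemma is_module_subset: "is_module A' M \<Longrightarrow> A \<subseteq> A' \<Longrightarrow> is_module A M"
  unfolding is_module_def by blast

lemma simple_is_module: "simple_module A M \<Longrightarrow> is_module A M"
  by (simp add: simple_module_def)

lemma simple_dim: "simple_module A M \<Longrightarrow> 0 < mod_dim M"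
  by (simp add: simple_module_def)

lemma character_trace: "is_module A M \<Longrightarrow> a \<in> A \<Longrightarrow> character M a = mat_trace (action M a)"
  using is_module_carrier[of A M a] by (simp add: character_def mat_trace_def ent_def)

lemma ent_one: "is_module A M \<Longrightarrow> p < mod_dim M \<Longrightarrow> q < mod_dim M \<Longrightarrow>
    ent M 1 p q = (if p = q then 1 else 0)"
  by (simp add: is_module_def ent_def)

lemma ent_add: "is_module A M \<Longrightarrow> a \<in> A \<Longrightarrow> b \<in> A \<Longrightarrow> p < mod_dim M \<Longrightarrow> q < mod_dim M \<Longrightarrow>
    ent M (a + b) p q = ent M a p q + ent M b p q"
  using is_module_carrier[of A M a] is_module_carrier[of A M b] by (auto simp: is_module_def ent_def)

lemma ent_scale: "is_module A M \<Longrightarrow> a \<in> A \<Longrightarrow> p < mod_dim M \<Longrightarrow> q < mod_dim M \<Longrightarrow>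
    ent M (c *\<^sub>C a) p q = c * ent M a p q"
  using is_module_carrier[of A M a] by (auto simp: is_module_def ent_def)

lemma ent_mult: "is_module A M \<Longrightarrow> a \<in> A \<Longrightarrow> b \<in> A \<Longrightarrow> p < mod_dim M \<Longrightarrow> q < mod_dim M \<Longrightarrow>
    ent M (a * b) p q = (\<Sum>k<mod_dim M. ent M a p k * ent M b k q)"
  unfolding ent_def by (simp add: is_module_mult index_mult_mat_sum[OF is_module_carrier is_module_carrier])

lemma character_mult_comm:
  "is_module A M \<Longrightarrow> a \<in> A \<Longrightarrow> b \<in> A \<Longrightarrow> a * b \<in> A \<Longrightarrow> b * a \<in> A \<Longrightarrow> character M (a * b) = character M (b * a)"
  by (simp add: character_trace is_module_mult mat_trace_comm[OF is_module_carrier is_module_carrier])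

lemma mod_isoE:
  assumes "mod_iso A M N"
  obtains P Q where "mod_dim N = mod_dim M" "P \<in> carrier_mat (mod_dim M) (mod_dim M)"
    "Q \<in> carrier_mat (mod_dim M) (mod_dim M)" "P * Q = 1\<^sub>m (mod_dim M)" "Q * P = 1\<^sub>m (mod_dim M)"
    "\<And>a. a \<in> A \<Longrightarrow> P * action M a = action N a * P"
proof -
  obtain P where d: "mod_dim M = mod_dim N" and P: "P \<in> carrier_mat (mod_dim M) (mod_dim M)"
    and inv: "invertible_mat P" and c: "\<forall>a\<in>A. P * action M a = action N a * P"
    using assms by (auto simp: mod_iso_def)
  obtain Q where Q: "inverts_mat P Q" "inverts_mat Q P" using inv by (auto simp: invertible_mat_def)
  have "P * Q = 1\<^sub>m (mod_dim M)" using Q(1) P by (simp add: inverts_mat_def)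
  moreover have QP: "Q * P = 1\<^sub>m (dim_row Q)" using Q(2) by (simp add: inverts_mat_def)
  moreover have "dim_row Q = mod_dim M" using arg_cong[OF QP, of dim_col] P by simp
  moreover have "dim_col Q = mod_dim M" using arg_cong[OF \<open>P * Q = _\<close>, of dim_col] by simp
  ultimately show ?thesis using that[of P Q] d P c by (metis carrier_matI)
qed

lemma mod_isoI:
  assumes "mod_dim N = mod_dim M" "P \<in> carrier_mat (mod_dim M) (mod_dim M)"
    "Q \<in> carrier_mat (mod_dim M) (mod_dim M)" "P * Q = 1\<^sub>m (mod_dim M)" "Q * P = 1\<^sub>m (mod_dim M)"
    "\<And>a. a \<in> A \<Longrightarrow> P * action M a = action N a * P"
  shows "mod_iso A M N"
  unfolding mod_iso_def
proof (intro conjI bexI[of _ P])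
  show "invertible_mat P" using assms(2-5) by (auto simp: invertible_mat_def inverts_mat_def intro!: exI[of _ Q])
qed (use assms in auto)

lemma mod_iso_dim: "mod_iso A M N \<Longrightarrow> mod_dim N = mod_dim M"
  by (simp add: mod_iso_def)

lemma mod_iso_refl:
  assumes "is_module A M" shows "mod_iso A M M"
  by (rule mod_isoI[of _ _ "1\<^sub>m (mod_dim M)" "1\<^sub>m (mod_dim M)"])
     (simp_all add: left_mult_one_mat[OF is_module_carrier[OF assms]] right_mult_one_mat[OF is_module_carrier[OF assms]])

lemma mod_iso_sym:
  assumes iso: "mod_iso A M N" and M: "is_module A M" and N: "is_module A N"
  shows "mod_iso A N M"
proof -
  obtain P Q where PQ: "mod_dim N = mod_dim M" "P \<in> carrier_mat (mod_dim M) (mod_dim M)"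
    "Q \<in> carrier_mat (mod_dim M) (mod_dim M)" "P * Q = 1\<^sub>m (mod_dim M)" "Q * P = 1\<^sub>m (mod_dim M)"
    "\<And>a. a \<in> A \<Longrightarrow> P * action M a = action N a * P" by (rule mod_isoE[OF iso]) blast
  have "Q * action N a = action M a * Q" if a: "a \<in> A" for a
  proof -
    let ?d = "mod_dim M"
    have Ma: "action M a \<in> carrier_mat ?d ?d" and Na: "action N a \<in> carrier_mat ?d ?d"
      using is_module_carrier[OF M a] is_module_carrier[OF N a] PQ(1) by auto
    have "Q * action N a = Q * action N a * (P * Q)" using Na PQ by simp
    also have "\<dots> = Q * (action N a * P) * Q"
      using assoc_mult_mat[OF _ PQ(2,3), of "Q * action N a" ?d] assoc_mult_mat[OF PQ(3) Na PQ(2)] Na PQ(3) by simp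
    also have "\<dots> = Q * (P * action M a) * Q" using PQ(6)[OF a] by simp
    also have "\<dots> = action M a * Q" using assoc_mult_mat[OF PQ(3,2) Ma] Ma by (simp add: PQ(5))
    finally show ?thesis .
  qed
  then show ?thesis using PQ by (intro mod_isoI[of _ _ Q P]) auto
qed

lemma mod_iso_trans:
  assumes iso: "mod_iso A L M" "mod_iso A M N" and LMN: "is_module A L" "is_module A M" "is_module A N"
  shows "mod_iso A L N"
proof -
  obtain P Q where PQ: "mod_dim M = mod_dim L" "P \<in> carrier_mat (mod_dim L) (mod_dim L)"
    "Q \<in> carrier_mat (mod_dim L) (mod_dim L)" "P * Q = 1\<^sub>m (mod_dim L)" "Q * P = 1\<^sub>m (mod_dim L)"
    "\<And>a. a \<in> A \<Longrightarrow> P * action L a = action M a * P" by (rule mod_isoE[OF iso(1)]) blast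
  obtain R S where RS: "mod_dim N = mod_dim M" "R \<in> carrier_mat (mod_dim M) (mod_dim M)"
    "S \<in> carrier_mat (mod_dim M) (mod_dim M)" "R * S = 1\<^sub>m (mod_dim M)" "S * R = 1\<^sub>m (mod_dim M)"
    "\<And>a. a \<in> A \<Longrightarrow> R * action M a = action N a * R" by (rule mod_isoE[OF iso(2)]) blast
  let ?d = "mod_dim L"
  have c: "R \<in> carrier_mat ?d ?d" "S \<in> carrier_mat ?d ?d" using RS PQ by auto
  show ?thesis
  proof (rule mod_isoI[of _ _ "R * P" "Q * S"])
    have "R * P * (Q * S) = R * (P * Q * S)"
      using assoc_mult_mat[OF c(1) PQ(2), of "Q * S" ?d] assoc_mult_mat[OF PQ(2,3) c(2)] PQ(3) c by simp
    then show "R * P * (Q * S) = 1\<^sub>m ?d" using PQ RS c by simp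
    have "Q * S * (R * P) = Q * (S * R * P)"
      using assoc_mult_mat[OF PQ(3) c(2), of "R * P" ?d] assoc_mult_mat[OF c(2,1) PQ(2)] PQ(2) c by simp
    then show "Q * S * (R * P) = 1\<^sub>m ?d" using PQ RS c by simp
    fix a assume a: "a \<in> A"
    have La: "action L a \<in> carrier_mat ?d ?d" and Ma: "action M a \<in> carrier_mat ?d ?d"
      and Na: "action N a \<in> carrier_mat ?d ?d"
      using is_module_carrier[OF LMN(1) a] is_module_carrier[OF LMN(2) a] is_module_carrier[OF LMN(3) a] PQ(1) RS(1) by auto
    have "R * P * action L a = R * (action M a * P)" using assoc_mult_mat[OF c(1) PQ(2) La] PQ(6)[OF a] by simp
    also have "\<dots> = action N a * R * P" using assoc_mult_mat[OF c(1) Ma PQ(2)] RS(6)[OF a] by simp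
    also have "\<dots> = action N a * (R * P)" by (rule assoc_mult_mat[OF Na c(1) PQ(2)])
    finally show "R * P * action L a = action N a * (R * P)" .
  qed (use PQ RS c in auto)
qed

text \<open>The actions at the single element \<open>a\<close> are only required to be square of the
  right size, because the result is applied to a direct sum, for which just that much is
  established.\<close>

lemma mod_iso_trace:
  assumes iso: "mod_iso A M N" and a: "a \<in> A"
    and Ma: "action M a \<in> carrier_mat (mod_dim M) (mod_dim M)"
    and Na: "action N a \<in> carrier_mat (mod_dim N) (mod_dim N)"
  shows "character N a = character M a"
proof -
  obtain P Q where PQ: "mod_dim N = mod_dim M" "P \<in> carrier_mat (mod_dim M) (mod_dim M)"
    "Q \<in> carrier_mat (mod_dim M) (mod_dim M)" "P * Q = 1\<^sub>m (mod_dim M)" "Q * P = 1\<^sub>m (mod_dim M)"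
    "\<And>a. a \<in> A \<Longrightarrow> P * action M a = action N a * P" by (rule mod_isoE[OF iso]) blast
  let ?d = "mod_dim M"
  have Na': "action N a \<in> carrier_mat ?d ?d" using Na PQ(1) by simp
  have "action N a = action N a * P * Q" using assoc_mult_mat[OF Na' PQ(2,3)] PQ(4) Na' by simp
  also have "\<dots> = P * action M a * Q" using PQ(6)[OF a] by simp
  finally have "mat_trace (action N a) = mat_trace (Q * (P * action M a))"
    using mat_trace_comm[of "P * action M a" ?d ?d Q] PQ Ma by simp
  also have "Q * (P * action M a) = action M a" using assoc_mult_mat[OF PQ(3,2) Ma] PQ(5) Ma by simp
  finally show ?thesis using Ma Na by (simp add: character_def ent_def mat_trace_def)
qed

lemma mod_iso_character:
  assumes iso: "mod_iso A M N" and M: "is_module A M" and N: "is_module A N" and a: "a \<in> A"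
  shows "character N a = character M a"
  by (rule mod_iso_trace[OF iso a is_module_carrier[OF M a] is_module_carrier[OF N a]])

text \<open>Kernel and image of an intertwiner are submodules. Unless \<open>T\<close> is zero,
  simplicity makes the kernel trivial and the image everything.\<close>

lemma schur_iso:
  assumes M: "simple_module A M" and N: "simple_module A N"
    and T: "T \<in> carrier_mat (mod_dim N) (mod_dim M)"
    and comm: "\<And>a. a \<in> A \<Longrightarrow> action N a * T = T * action M a"
    and nz: "T \<noteq> 0\<^sub>m (mod_dim N) (mod_dim M)"
  shows "mod_iso A M N"
proof -
  let ?m = "mod_dim M" and ?n = "mod_dim N"
  have Mc: "action M a \<in> carrier_mat ?m ?m" and Nc: "action N a \<in> carrier_mat ?n ?n" if "a \<in> A" for a
    using that M N by (auto intro: is_module_carrier simple_is_module)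
  have cv: "action N a *\<^sub>v (T *\<^sub>v v) = T *\<^sub>v (action M a *\<^sub>v v)" if "a \<in> A" "v \<in> carrier_vec ?m" for a v
    using assoc_mult_mat_vec[OF Nc[OF that(1)] T that(2)] assoc_mult_mat_vec[OF T Mc[OF that(1)] that(2)]
      comm[OF that(1)] by simp
  define K where "K = {v \<in> carrier_vec ?m. T *\<^sub>v v = 0\<^sub>v ?n}"
  have "is_submodule A M K"
    unfolding is_submodule_def
  proof (intro conjI ballI allI)
    show "K \<subseteq> carrier_vec ?m" by (auto simp: K_def)
    show "0\<^sub>v ?m \<in> K" using T by (auto simp: K_def)
    show "v + w \<in> K" if "v \<in> K" "w \<in> K" for v w
      using that T by (auto simp: K_def mult_add_distrib_mat_vec)
    show "c \<cdot>\<^sub>v v \<in> K" if "v \<in> K" for c v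
      using that T by (auto simp: K_def mult_mat_vec)
    show "action M a *\<^sub>v v \<in> K" if "a \<in> A" "v \<in> K" for a v
    proof -
      have v: "v \<in> carrier_vec ?m" "T *\<^sub>v v = 0\<^sub>v ?n" using that by (auto simp: K_def)
      have "action N a *\<^sub>v 0\<^sub>v ?n = 0\<^sub>v ?n" using Nc[OF that(1)] by auto
      then show ?thesis using cv[OF that(1) v(1)] v Mc[OF that(1)] by (simp add: K_def)
    qed
  qed
  then have K: "K = {0\<^sub>v ?m} \<or> K = carrier_vec ?m" using M by (simp add: simple_module_def)
  have "K \<noteq> carrier_vec ?m"
  proof
    assume e: "K = carrier_vec ?m"
    have "T = 0\<^sub>m ?n ?m" by (rule mat_eq_vecI[OF T]) (use e in \<open>auto simp: K_def zero_mat_mult_vec\<close>)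
    then show False using nz by simp
  qed
  then have K0: "K = {0\<^sub>v ?m}" using K by blast
  define I where "I = {T *\<^sub>v v |v. v \<in> carrier_vec ?m}"
  have "is_submodule A N I"
    unfolding is_submodule_def
  proof (intro conjI ballI allI)
    show "I \<subseteq> carrier_vec ?n" using T by (auto simp: I_def)
    show "0\<^sub>v ?n \<in> I" unfolding I_def using T by (auto intro!: exI[of _ "0\<^sub>v ?m"])
    show "v + w \<in> I" if vw: "v \<in> I" "w \<in> I" for v w
    proof -
      obtain x y where "v = T *\<^sub>v x" "w = T *\<^sub>v y" "x \<in> carrier_vec ?m" "y \<in> carrier_vec ?m"
        using vw unfolding I_def by blast
      then show ?thesis unfolding I_def using T by (auto intro!: exI[of _ "x + y"] simp: mult_add_distrib_mat_vec)
    qed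
    show "c \<cdot>\<^sub>v v \<in> I" if v: "v \<in> I" for c v
    proof -
      obtain x where "v = T *\<^sub>v x" "x \<in> carrier_vec ?m" using v unfolding I_def by blast
      then show ?thesis unfolding I_def using T by (auto intro!: exI[of _ "c \<cdot>\<^sub>v x"] simp: mult_mat_vec)
    qed
    show "action N a *\<^sub>v v \<in> I" if a: "a \<in> A" and v: "v \<in> I" for a v
    proof -
      obtain x where "v = T *\<^sub>v x" "x \<in> carrier_vec ?m" using v unfolding I_def by blast
      then show ?thesis unfolding I_def using cv[OF a] Mc[OF a]
        by (auto intro!: exI[of _ "action M a *\<^sub>v x"])
    qed
  qed
  then have I: "I = {0\<^sub>v ?n} \<or> I = carrier_vec ?n" using N by (simp add: simple_module_def)
  have "I \<noteq> {0\<^sub>v ?n}"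
  proof
    assume e: "I = {0\<^sub>v ?n}"
    have "T *\<^sub>v v = 0\<^sub>v ?n" if "v \<in> carrier_vec ?m" for v using e that unfolding I_def by blast
    then have "T = 0\<^sub>m ?n ?m" by (intro mat_eq_vecI[OF T]) (auto simp: zero_mat_mult_vec)
    then show False using nz by simp
  qed
  then have I1: "I = carrier_vec ?n" using I by blast
  have "?n = ?m \<and> (\<exists>Q\<in>carrier_mat ?m ?n. T * Q = 1\<^sub>m ?n \<and> Q * T = 1\<^sub>m ?m)"
  proof (rule bijective_mat[OF T])
    show "v = 0\<^sub>v ?m" if "v \<in> carrier_vec ?m" "T *\<^sub>v v = 0\<^sub>v ?n" for v
      using K0 that unfolding K_def by blast
    show "\<exists>v\<in>carrier_vec ?m. T *\<^sub>v v = w" if "w \<in> carrier_vec ?n" for w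
    proof -
      have "w \<in> I" using I1 that by simp
      then show ?thesis unfolding I_def by blast
    qed
  qed
  then obtain Q where "?n = ?m" "Q \<in> carrier_mat ?m ?n" "T * Q = 1\<^sub>m ?n" "Q * T = 1\<^sub>m ?m" by blast
  then show ?thesis using T comm by (intro mod_isoI[of _ _ T Q]) auto
qed

text \<open>Over the complex numbers \<open>T\<close> has an eigenvalue, and the eigenspace is a
  nonzero submodule.\<close>

lemma schur_scalar:
  assumes M: "simple_module A M" and T: "T \<in> carrier_mat (mod_dim M) (mod_dim M)"
    and comm: "\<And>a. a \<in> A \<Longrightarrow> action M a * T = T * action M a"
  shows "\<exists>c. T = c \<cdot>\<^sub>m 1\<^sub>m (mod_dim M)"
proof -
  let ?m = "mod_dim M"
  have Mc: "action M a \<in> carrier_mat ?m ?m" if "a \<in> A" for a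
    using that M by (auto intro: is_module_carrier simple_is_module)
  obtain c where "eigenvalue T c"
    using spectrum_non_empty[OF T simple_dim[OF M]] by (auto simp: spectrum_def)
  then obtain v0 where v0: "v0 \<in> carrier_vec ?m" "v0 \<noteq> 0\<^sub>v ?m" "T *\<^sub>v v0 = c \<cdot>\<^sub>v v0"
    using T by (auto simp: eigenvalue_def eigenvector_def)
  define K where "K = {v \<in> carrier_vec ?m. T *\<^sub>v v = c \<cdot>\<^sub>v v}"
  have "is_submodule A M K"
    unfolding is_submodule_def
  proof (intro conjI ballI allI)
    show "K \<subseteq> carrier_vec ?m" by (auto simp: K_def)
    show "0\<^sub>v ?m \<in> K" using T by (auto simp: K_def)
    show "v + w \<in> K" if "v \<in> K" "w \<in> K" for v w
      using that T by (auto simp: K_def mult_add_distrib_mat_vec smult_add_distrib_vec)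
    show "b \<cdot>\<^sub>v v \<in> K" if "v \<in> K" for b v
      using that T by (auto simp: K_def mult_mat_vec smult_smult_assoc mult.commute)
    show "action M a *\<^sub>v v \<in> K" if a: "a \<in> A" and "v \<in> K" for a v
    proof -
      have v: "v \<in> carrier_vec ?m" "T *\<^sub>v v = c \<cdot>\<^sub>v v" using that by (auto simp: K_def)
      have "T *\<^sub>v (action M a *\<^sub>v v) = action M a *\<^sub>v (T *\<^sub>v v)"
        using assoc_mult_mat_vec[OF Mc[OF a] T v(1)] assoc_mult_mat_vec[OF T Mc[OF a] v(1)]
          comm[OF a] by simp
      then show ?thesis using v Mc[OF a] by (simp add: K_def mult_mat_vec)
    qed
  qed
  then have K: "K = {0\<^sub>v ?m} \<or> K = carrier_vec ?m" using M by (simp add: simple_module_def)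
  have "v0 \<in> K" using v0 by (simp add: K_def)
  then have "K = carrier_vec ?m" using K v0 by blast
  then have "T = c \<cdot>\<^sub>m 1\<^sub>m ?m"
    using T by (intro mat_eq_vecI[OF T]) (auto simp: K_def scalar_mat_mult_vec)
  then show ?thesis by blast
qed

lemma subalgebra_sum: "unital_subalgebra A \<Longrightarrow> (\<And>x. x \<in> S \<Longrightarrow> f x \<in> A) \<Longrightarrow> sum f S \<in> A"
  by (auto simp: unital_subalgebra_def intro: cvec.subspace_sum)

lemma subalgebra_scale: "unital_subalgebra A \<Longrightarrow> a \<in> A \<Longrightarrow> c *\<^sub>C a \<in> A"
  by (auto simp: unital_subalgebra_def intro: cvec.subspace_scale)

lemma subalgebra_add: "unital_subalgebra A \<Longrightarrow> a \<in> A \<Longrightarrow> b \<in> A \<Longrightarrow> a + b \<in> A"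
  by (auto simp: unital_subalgebra_def intro: cvec.subspace_add)

lemma subalgebra_diff: "unital_subalgebra A \<Longrightarrow> a \<in> A \<Longrightarrow> b \<in> A \<Longrightarrow> a - b \<in> A"
  by (auto simp: unital_subalgebra_def intro: cvec.subspace_diff)

lemma subalgebra_mult: "unital_subalgebra A \<Longrightarrow> a \<in> A \<Longrightarrow> b \<in> A \<Longrightarrow> a * b \<in> A"
  by (auto simp: unital_subalgebra_def)

lemma subalgebra_one: "unital_subalgebra A \<Longrightarrow> 1 \<in> A"
  by (auto simp: unital_subalgebra_def)

lemma subalgebra_zero: "unital_subalgebra A \<Longrightarrow> 0 \<in> A"
  by (auto simp: unital_subalgebra_def intro: cvec.subspace_0)

lemma scaleC_zero_left [simp]: "0 *\<^sub>C (a :: 'a::complex_algebra_1) = 0"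
  by (rule cvec.scale_zero_left)

lemma ent_zero:
  assumes "unital_subalgebra A" "is_module A M" "p < mod_dim M" "q < mod_dim M"
  shows "ent M 0 p q = 0"
  using ent_scale[OF assms(2) subalgebra_one[OF assms(1)] assms(3,4), of 0] by simp

lemma ent_diff:
  assumes A: "unital_subalgebra A" and M: "is_module A M" and a: "a \<in> A" "b \<in> A"
    and pq: "p < mod_dim M" "q < mod_dim M"
  shows "ent M (a - b) p q = ent M a p q - ent M b p q"
  using ent_add[OF M subalgebra_diff[OF A a] a(2) pq] by simp

lemma ent_sum:
  assumes A: "unital_subalgebra A" and M: "is_module A M" and f: "\<And>x. x \<in> S \<Longrightarrow> f x \<in> A"
    and pq: "p < mod_dim M" "q < mod_dim M"
  shows "ent M (sum f S) p q = (\<Sum>x\<in>S. ent M (f x) p q)"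
proof (cases "finite S")
  case True
  then show ?thesis using f
  proof (induction S rule: finite_induct)
    case (insert x F)
    have "sum f F \<in> A" using insert.prems by (intro subalgebra_sum[OF A]) auto
    then show ?case using insert by (simp add: ent_add[OF M _ _ pq])
  qed (simp add: ent_zero[OF A M pq])
qed (simp add: ent_zero[OF A M pq])

lemma character_add: "is_module A M \<Longrightarrow> a \<in> A \<Longrightarrow> b \<in> A \<Longrightarrow> character M (a + b) = character M a + character M b"
  by (simp add: character_def ent_add sum.distrib)

lemma character_scale: "is_module A M \<Longrightarrow> a \<in> A \<Longrightarrow> character M (c *\<^sub>C a) = c * character M a"
  by (simp add: character_def ent_scale sum_distrib_left)

lemma character_one: "is_module A M \<Longrightarrow> character M 1 = of_nat (mod_dim M)"
  by (simp add: character_def ent_one)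

subsection \<open>The density theorem\<close>

text \<open>The \<open>j\<close>-th columns of the elements of a left ideal form a submodule of
  \<open>K\<close>, so a single nonzero column makes all columns attainable inside
  \<open>L\<close>.\<close>

lemma column_submodule:
  assumes A: "unital_subalgebra A" and K: "simple_module A K" and j: "j < mod_dim K"
    and L: "left_ideal A L" and a0: "a0 \<in> L" "p0 < mod_dim K" "ent K a0 p0 j \<noteq> 0"
  shows "\<exists>a\<in>L. \<forall>p<mod_dim K. ent K a p j = y p"
proof -
  let ?d = "mod_dim K"
  have M: "is_module A K" by (rule simple_is_module[OF K])
  have LA: "a \<in> A" if "a \<in> L" for a using L that by (auto simp: left_ideal_def)
  have Ls: "cvec.subspace L" using L by (simp add: left_ideal_def)
  define W where "W = {vec ?d (\<lambda>p. ent K a p j) |a. a \<in> L}"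
  have "is_submodule A K W"
    unfolding is_submodule_def
  proof (intro conjI ballI allI)
    show "W \<subseteq> carrier_vec ?d" by (auto simp: W_def)
    show "0\<^sub>v ?d \<in> W" unfolding W_def
      using cvec.subspace_0[OF Ls] by (auto intro!: exI[of _ 0] simp: ent_zero[OF A M _ j])
    show "v + w \<in> W" if vw: "v \<in> W" "w \<in> W" for v w
    proof -
      obtain a b where a: "v = vec ?d (\<lambda>p. ent K a p j)" "a \<in> L" and b: "w = vec ?d (\<lambda>p. ent K b p j)" "b \<in> L"
        using vw unfolding W_def by blast
      have "v + w = vec ?d (\<lambda>p. ent K (a + b) p j)"
        by (intro eq_vecI) (simp_all add: a b ent_add[OF M LA LA _ j])
      then show ?thesis unfolding W_def using cvec.subspace_add[OF Ls a(2) b(2)] by blast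
    qed
    show "c \<cdot>\<^sub>v v \<in> W" if v: "v \<in> W" for c v
    proof -
      obtain a where a: "v = vec ?d (\<lambda>p. ent K a p j)" "a \<in> L"
        using v unfolding W_def by blast
      have "c \<cdot>\<^sub>v v = vec ?d (\<lambda>p. ent K (c *\<^sub>C a) p j)"
        by (intro eq_vecI) (simp_all add: a ent_scale[OF M LA _ j])
      then show ?thesis unfolding W_def using cvec.subspace_scale[OF Ls a(2)] by blast
    qed
    show "action K b *\<^sub>v v \<in> W" if b: "b \<in> A" and v: "v \<in> W" for b v
    proof -
      obtain a where a: "v = vec ?d (\<lambda>p. ent K a p j)" "a \<in> L"
        using v unfolding W_def by blast
      have "action K b *\<^sub>v v = vec ?d (\<lambda>p. ent K (b * a) p j)"
      proof (rule eq_vecI)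
        fix i assume "i < dim_vec (vec ?d (\<lambda>p. ent K (b * a) p j))"
        then have i: "i < ?d" by simp
        have "(action K b *\<^sub>v v) $ i = (\<Sum>l<?d. action K b $$ (i, l) * v $ l)"
          by (rule index_mult_mat_vec_sum[OF is_module_carrier[OF M b] _ i]) (simp add: a)
        also have "\<dots> = (\<Sum>l<?d. ent K b i l * ent K a l j)" by (simp add: a ent_def)
        also have "\<dots> = ent K (b * a) i j" by (rule ent_mult[OF M b LA[OF a(2)] i j, symmetric])
        finally show "(action K b *\<^sub>v v) $ i = vec ?d (\<lambda>p. ent K (b * a) p j) $ i" using i by simp
      qed (use is_module_carrier[OF M b] in auto)
      moreover have "b * a \<in> L" using L a(2) b by (simp add: left_ideal_def)
      ultimately show ?thesis unfolding W_def by blast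
    qed
  qed
  then have W: "W = {0\<^sub>v ?d} \<or> W = carrier_vec ?d" using K by (simp add: simple_module_def)
  have "vec ?d (\<lambda>p. ent K a0 p j) \<in> W" unfolding W_def using a0(1) by blast
  moreover have "vec ?d (\<lambda>p. ent K a0 p j) \<noteq> 0\<^sub>v ?d"
    using a0(2,3) by (metis index_vec index_zero_vec(1))
  ultimately have "W = carrier_vec ?d" using W by blast
  then have "vec ?d y \<in> W" by simp
  then obtain a where "a \<in> L" "vec ?d y = vec ?d (\<lambda>p. ent K a p j)" unfolding W_def by blast
  then show ?thesis by (intro bexI[of _ a]) (auto simp: vec_eq_iff)
qed

text \<open>
  Columns of pairwise non-isomorphic simple modules can be prescribed arbitrarily. A new column is
  either free on the left ideal annihilating the previous ones, or it is a linear function of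
  them; by Schur's lemma that function only involves the other columns of the same module, with scalar
  coefficients, which the identity element rules out.
\<close>

lemma density_columns:
  assumes A: "unital_subalgebra A"
    and R: "\<And>M. M \<in> R \<Longrightarrow> simple_module A M"
      "\<And>M N. M \<in> R \<Longrightarrow> N \<in> R \<Longrightarrow> mod_iso A M N \<Longrightarrow> M = N"
    and S: "finite S" "S \<subseteq> {(M, i). M \<in> R \<and> i < mod_dim M}"
  shows "\<exists>a\<in>A. \<forall>(M, i)\<in>S. \<forall>p<mod_dim M. ent M a p i = y M i p"
  using S
proof (induction S arbitrary: y rule: finite_induct)
  case empty
  then show ?case using subalgebra_one[OF A] by auto
next
  case (insert x S)
  obtain K j where x: "x = (K, j)" by (cases x)
  have K: "K \<in> R" "j < mod_dim K" using insert.prems x by auto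
  have SK: "simple_module A K" using R(1) K by blast
  have MK: "is_module A K" by (rule simple_is_module[OF SK])
  have S: "S \<subseteq> {(M, i). M \<in> R \<and> i < mod_dim M}" using insert.prems by auto
  have MM: "is_module A M" "i < mod_dim M" if "(M, i) \<in> S" for M i
  proof -
    have "M \<in> R" "i < mod_dim M" using S that by auto
    then show "is_module A M" "i < mod_dim M" using simple_is_module[OF R(1)] by blast+
  qed
  have IH: "\<exists>a\<in>A. \<forall>(M, i)\<in>S. \<forall>p<mod_dim M. ent M a p i = y M i p" for y
    using insert.IH S by blast
  define L where "L = {a\<in>A. \<forall>(M, i)\<in>S. \<forall>p<mod_dim M. ent M a p i = 0}"
  have Lm: "a \<in> L \<longleftrightarrow> a \<in> A \<and> (\<forall>M i p. (M, i) \<in> S \<longrightarrow> p < mod_dim M \<longrightarrow> ent M a p i = 0)" for a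
    unfolding L_def by blast
  have L: "left_ideal A L"
    unfolding left_ideal_def
  proof (intro conjI ballI)
    show "L \<subseteq> A" by (auto simp: L_def)
    show "cvec.subspace L"
    proof (rule cvec.subspaceI)
      show "0 \<in> L" unfolding Lm using MM by (simp add: subalgebra_zero[OF A] ent_zero[OF A])
      show "a + b \<in> L" if "a \<in> L" "b \<in> L" for a b
        using that MM unfolding Lm by (simp add: subalgebra_add[OF A] ent_add[where A = A])
      show "c *\<^sub>C a \<in> L" if "a \<in> L" for c a
        using that MM unfolding Lm by (simp add: subalgebra_scale[OF A] ent_scale[where A = A])
    qed
    show "b * a \<in> L" if "b \<in> A" "a \<in> L" for b a
      using that MM unfolding Lm by (simp add: subalgebra_mult[OF A] ent_mult[where A = A])
  qed
  show ?case
  proof (cases "\<exists>a\<in>L. \<exists>p<mod_dim K. ent K a p j \<noteq> 0")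
    case True
    then obtain a0 p0 where a0: "a0 \<in> L" "p0 < mod_dim K" "ent K a0 p0 j \<noteq> 0" by blast
    obtain a1 where a1: "a1 \<in> A" "\<forall>(M, i)\<in>S. \<forall>p<mod_dim M. ent M a1 p i = y M i p" using IH by blast
    \<comment> \<open>The correction is taken from \<open>L\<close>, so it does not disturb the
      columns already prescribed.\<close>
    obtain a2 where a2: "a2 \<in> L" "\<forall>p<mod_dim K. ent K a2 p j = y K j p - ent K a1 p j"
      using column_submodule[OF A SK K(2) L a0, of "\<lambda>p. y K j p - ent K a1 p j"] by blast
    have a2A: "a2 \<in> A" using a2(1) by (simp add: L_def)
    have "ent M (a1 + a2) p i = y M i p" if "(M, i) \<in> insert x S" "p < mod_dim M" for M i p
    proof (cases "(M, i) = x")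
      case True
      then show ?thesis using ent_add[OF MK a1(1) a2A _ K(2)] a2(2) that x by simp
    next
      case False
      then have Mi: "(M, i) \<in> S" using that by simp
      have "ent M a1 p i = y M i p" using a1(2) Mi that(2) by blast
      moreover have "ent M a2 p i = 0" using a2(1) Mi that(2) unfolding Lm by blast
      ultimately show ?thesis using ent_add[OF MM(1)[OF Mi] a1(1) a2A that(2) MM(2)[OF Mi]] by simp
    qed
    then show ?thesis using subalgebra_add[OF A a1(1) a2A] by (intro bexI[of _ "a1 + a2"]) auto
  next
    case False
    then have L0: "ent K a p j = 0" if "a \<in> L" "p < mod_dim K" for a p using that by blast
    have "\<exists>a\<in>A. \<forall>(M', i')\<in>S. \<forall>p'<mod_dim M'. ent M' a p' i' = (if (M', i') = x \<and> p' = p then 1 else 0)" for x p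
      using IH[of "\<lambda>M' i' p'. if (M', i') = x \<and> p' = p then 1 else 0"] .
    note ex = this
    \<comment> \<open>A dual basis: among the columns in \<open>S\<close>, the element
      \<open>e x p\<close> has a single 1, in row \<open>p\<close> of column
      \<open>x\<close>.\<close>
    define e where "e = (\<lambda>x p. SOME a. a \<in> A \<and> (\<forall>(M', i')\<in>S. \<forall>p'<mod_dim M'.
        ent M' a p' i' = (if (M', i') = x \<and> p' = p then 1 else 0)))"
    have e0: "e x p \<in> A \<and> (\<forall>(M', i')\<in>S. \<forall>p'<mod_dim M'.
        ent M' (e x p) p' i' = (if (M', i') = x \<and> p' = p then 1 else 0))" for x p
      unfolding e_def by (rule someI_ex) (use ex[of x p] in blast)
    have e: "e x p \<in> A" for x p using e0[of x p] by blast
    have e2: "ent M' (e x p) p' i' = (if (M', i') = x \<and> p' = p then 1 else 0)"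
      if "(M', i') \<in> S" "p' < mod_dim M'" for x p M' i' p'
      using e0[of x p] that by blast
    \<comment> \<open>\<open>c\<close> has the same columns in \<open>S\<close> as \<open>a\<close>,
      so \<open>a - c\<close> lies in \<open>L\<close> and its column \<open>j\<close> vanishes by
      \<open>L0\<close>. Column \<open>j\<close> is thus a fixed linear function of the columns in
      \<open>S\<close>.\<close>
    have lin: "ent K a q j = (\<Sum>x\<in>S. \<Sum>p<mod_dim (fst x). ent K (e x p) q j * ent (fst x) a p (snd x))"
      if a: "a \<in> A" and q: "q < mod_dim K" for a q
    proof -
      let ?t = "\<lambda>x p. ent (fst x) a p (snd x) *\<^sub>C e x p"
      define c where "c = (\<Sum>x\<in>S. \<Sum>p<mod_dim (fst x). ?t x p)"
      have tA: "?t x p \<in> A" for x p by (intro subalgebra_scale[OF A] e)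
      have t2A: "(\<Sum>p<mod_dim (fst x). ?t x p) \<in> A" for x by (intro subalgebra_sum[OF A] tA)
      have cA: "c \<in> A" unfolding c_def by (intro subalgebra_sum[OF A] t2A)
      have entc: "ent M c p i = (\<Sum>x\<in>S. \<Sum>p'<mod_dim (fst x). ent (fst x) a p' (snd x) * ent M (e x p') p i)"
        if "is_module A M" "p < mod_dim M" "i < mod_dim M" for M p i
        unfolding c_def by (simp add: ent_sum[OF A that(1) _ that(2,3)] t2A tA ent_scale[OF that(1) e that(2,3)])
      have "ent M c p i = ent M a p i" if Mi: "(M, i) \<in> S" and p: "p < mod_dim M" for M i p
      proof -
        have "ent M c p i = (\<Sum>x\<in>S. \<Sum>p'<mod_dim (fst x). if x = (M, i) \<and> p' = p then ent M a p i else 0)"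
          unfolding entc[OF MM(1)[OF Mi] p MM(2)[OF Mi]]
          by (intro sum.cong refl) (auto simp: e2[OF Mi p])
        also have "\<dots> = (\<Sum>x\<in>S. if x = (M, i) then ent M a p i else 0)"
          using p by (intro sum.cong refl) auto
        also have "\<dots> = ent M a p i" using Mi insert.hyps by simp
        finally show ?thesis .
      qed
      then have "a - c \<in> L" unfolding L_def
        using subalgebra_diff[OF A a cA] MM ent_diff[OF A _ a cA] by auto
      then have "ent K a q j = ent K c q j" using L0[OF _ q] ent_diff[OF A MK a cA q K(2)] by fastforce
      then show ?thesis unfolding entc[OF MK q K(2)] by (simp add: mult.commute)
    qed
    \<comment> \<open>The part of that function that depends on column \<open>x\<close>. Applying
      \<open>lin\<close> to \<open>b * e x p\<close> shows that it intertwines the two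
      actions.\<close>
    define T where "T = (\<lambda>x. mat (mod_dim K) (mod_dim (fst x)) (\<lambda>(q, p). ent K (e x p) q j))"
    have T: "T x \<in> carrier_mat (mod_dim K) (mod_dim (fst x))" for x by (simp add: T_def)
    have comm: "action K b * T x = T x * action (fst x) b" if b: "b \<in> A" and xS: "x \<in> S" for b x
    proof (rule eq_matI)
      obtain M i where xM: "x = (M, i)" by (cases x)
      have M: "is_module A M" "i < mod_dim M" using MM xS xM by auto
      have Kb: "action K b \<in> carrier_mat (mod_dim K) (mod_dim K)" and Mb: "action M b \<in> carrier_mat (mod_dim M) (mod_dim M)"
        using is_module_carrier[OF MK b] is_module_carrier[OF M(1) b] .
      fix q p assume "q < dim_row (T x * action (fst x) b)" "p < dim_col (T x * action (fst x) b)"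
      then have q: "q < mod_dim K" and p: "p < mod_dim M" using Mb xM by (auto simp: T_def)
      have bA: "b * e x p \<in> A" by (intro subalgebra_mult[OF A] b e)
      have "(action K b * T x) $$ (q, p) = (\<Sum>k<mod_dim K. ent K b q k * ent K (e x p) k j)"
        using index_mult_mat_sum[OF Kb T q, of p x] p xM by (simp add: T_def ent_def)
      also have "\<dots> = ent K (b * e x p) q j" by (rule ent_mult[OF MK b e q K(2), symmetric])
      also have "\<dots> = (\<Sum>z\<in>S. \<Sum>p'<mod_dim (fst z). ent K (e z p') q j * ent (fst z) (b * e x p) p' (snd z))"
        by (rule lin[OF bA q])
      also have "\<dots> = (\<Sum>z\<in>S. \<Sum>p'<mod_dim (fst z). if z = x then ent K (e x p') q j * ent M b p' p else 0)"
      proof (intro sum.cong refl)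
        fix z p' assume z: "z \<in> S" and p': "p' \<in> {..<mod_dim (fst z)}"
        obtain M' i' where zM: "z = (M', i')" by (cases z)
        have M': "is_module A M'" "i' < mod_dim M'" using MM z zM by auto
        have "ent M' (b * e x p) p' i' = (\<Sum>k<mod_dim M'. ent M' b p' k * ent M' (e x p) k i')"
          using p' zM M' by (intro ent_mult[OF M'(1) b e]) auto
        also have "\<dots> = (\<Sum>k<mod_dim M'. if k = p then (if z = x then ent M' b p' p else 0) else 0)"
          using z zM by (intro sum.cong refl) (auto simp: e2)
        also have "\<dots> = (if z = x then ent M b p' p else 0)" using p zM xM by auto
        finally show "ent K (e z p') q j * ent (fst z) (b * e x p) p' (snd z) =
            (if z = x then ent K (e x p') q j * ent M b p' p else 0)" using zM by simp
      qed
      also have "\<dots> = (\<Sum>z\<in>S. if z = x then (\<Sum>p'<mod_dim M. ent K (e x p') q j * ent M b p' p) else 0)"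
        using xM by (intro sum.cong refl) auto
      also have "\<dots> = (\<Sum>p'<mod_dim M. ent K (e x p') q j * ent M b p' p)" using xS insert.hyps by simp
      also have "\<dots> = (T x * action (fst x) b) $$ (q, p)"
        using index_mult_mat_sum[of "T x" "mod_dim K" "mod_dim M" "action M b" "mod_dim M" q p] T[of x] Mb q p xM
        by (simp add: T_def ent_def)
      finally show "(action K b * T x) $$ (q, p) = (T x * action (fst x) b) $$ (q, p)" .
    next
      have "action K b \<in> carrier_mat (mod_dim K) (mod_dim K)" "action (fst x) b \<in> carrier_mat (mod_dim (fst x)) (mod_dim (fst x))"
        using is_module_carrier[OF MK b] is_module_carrier[OF MM(1) b] xS by (auto simp: prod_eq_iff) (metis prod.collapse MM(1) is_module_carrier b)+
      then show "dim_row (action K b * T x) = dim_row (T x * action (fst x) b)"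
        "dim_col (action K b * T x) = dim_col (T x * action (fst x) b)" using T[of x] by auto
    qed
    \<comment> \<open>For \<open>M = K\<close> the matrix is scalar and the entry is off the
      diagonal, since the column \<open>(K, j)\<close> is new; otherwise the matrix is zero.\<close>
    have Tj: "ent K (e x (snd x)) j j = 0" if xS: "x \<in> S" for x
    proof -
      obtain M i where xM: "x = (M, i)" by (cases x)
      have M: "M \<in> R" "i < mod_dim M" using S xS xM by auto
      have TT: "T x $$ (j, i) = ent K (e x (snd x)) j j" using K(2) M xM by (simp add: T_def)
      show ?thesis
      proof (cases "M = K")
        case True
        then obtain c where "T x = c \<cdot>\<^sub>m 1\<^sub>m (mod_dim K)"
          using schur_scalar[OF SK, of "T x"] T[of x] comm[OF _ xS] xM by auto
        moreover have "i \<noteq> j" using insert.hyps(2) xS x xM True by auto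
        ultimately show ?thesis using TT K M True by simp
      next
        case False
        have "\<not> mod_iso A M K" using R(2) M K False by blast
        then have "T x = 0\<^sub>m (mod_dim K) (mod_dim M)"
          using schur_iso[OF R(1)[OF M(1)] SK, of "T x"] T[of x] comm[OF _ xS] xM by auto
        then show ?thesis using TT K M by simp
      qed
    qed
    \<comment> \<open>At the identity only the coefficients with \<open>p = snd x\<close> survive.
      They vanish by \<open>Tj\<close>, whereas the entry on the left is 1.\<close>
    have "ent K 1 j j = (\<Sum>x\<in>S. \<Sum>p<mod_dim (fst x). ent K (e x p) j j * ent (fst x) 1 p (snd x))"
      by (rule lin[OF subalgebra_one[OF A] K(2)])
    also have "\<dots> = (\<Sum>x\<in>S. \<Sum>p<mod_dim (fst x). 0)"
    proof (intro sum.cong refl)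
      fix x p assume xS: "x \<in> S" and p: "p \<in> {..<mod_dim (fst x)}"
      have "is_module A (fst x)" "snd x < mod_dim (fst x)" using MM xS by (metis prod.collapse)+
      then show "ent K (e x p) j j * ent (fst x) 1 p (snd x) = 0"
        using p Tj[OF xS] by (simp add: ent_one)
    qed
    finally have False using ent_one[OF MK K(2,2)] by simp
    then show ?thesis ..
  qed
qed

subsection \<open>Simple classes and matrix units\<close>

definition rep :: "'a::complex_algebra_1 set \<Rightarrow> 'a fdmod set \<Rightarrow> 'a fdmod" where
  "rep A \<kappa> = (SOME M. simple_module A M \<and> \<kappa> = {N. is_module A N \<and> mod_iso A M N})"

lemma rep:
  assumes "\<kappa> \<in> simple_classes A"
  shows rep_simple: "simple_module A (rep A \<kappa>)"
    and class_rep: "\<kappa> = {N. is_module A N \<and> mod_iso A (rep A \<kappa>) N}"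
proof -
  have "\<exists>M. simple_module A M \<and> \<kappa> = {N. is_module A N \<and> mod_iso A M N}"
    using assms by (auto simp: simple_classes_def)
  from someI_ex[OF this] show "simple_module A (rep A \<kappa>)" "\<kappa> = {N. is_module A N \<and> mod_iso A (rep A \<kappa>) N}"
    unfolding rep_def by blast+
qed

lemma rep_module: "\<kappa> \<in> simple_classes A \<Longrightarrow> is_module A (rep A \<kappa>)"
  by (rule simple_is_module[OF rep_simple])

lemma in_class_iff: "\<kappa> \<in> simple_classes A \<Longrightarrow> N \<in> \<kappa> \<longleftrightarrow> is_module A N \<and> mod_iso A (rep A \<kappa>) N"
  using class_rep by blast

lemma in_class_module: "\<kappa> \<in> simple_classes A \<Longrightarrow> N \<in> \<kappa> \<Longrightarrow> is_module A N"
  using in_class_iff by blast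

lemma in_class_iso: "\<kappa> \<in> simple_classes A \<Longrightarrow> N \<in> \<kappa> \<Longrightarrow> mod_iso A (rep A \<kappa>) N"
  using in_class_iff by blast

lemma rep_in_class: "\<kappa> \<in> simple_classes A \<Longrightarrow> rep A \<kappa> \<in> \<kappa>"
  using in_class_iff rep_module mod_iso_refl by blast

lemma class_eqI:
  assumes k: "\<kappa> \<in> simple_classes A" "\<kappa>' \<in> simple_classes A" and N: "N \<in> \<kappa>" "N \<in> \<kappa>'"
  shows "\<kappa> = \<kappa>'"
proof -
  have sub: "\<kappa> \<subseteq> \<kappa>'" if k: "\<kappa> \<in> simple_classes A" "\<kappa>' \<in> simple_classes A" and N: "N \<in> \<kappa>" "N \<in> \<kappa>'" for \<kappa> \<kappa>'
  proof
    fix L assume L: "L \<in> \<kappa>"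
    have m: "is_module A L" "is_module A N" using in_class_module[OF k(1)] L N(1) by blast+
    have "mod_iso A (rep A \<kappa>') (rep A \<kappa>)"
      by (rule mod_iso_trans[OF in_class_iso[OF k(2) N(2)] mod_iso_sym[OF in_class_iso[OF k(1) N(1)]]
            rep_module[OF k(2)] m(2) rep_module[OF k(1)]]) (intro rep_module[OF k(1)] m)+
    then have "mod_iso A (rep A \<kappa>') L"
      by (rule mod_iso_trans[OF _ in_class_iso[OF k(1) L] rep_module[OF k(2)] rep_module[OF k(1)] m(1)])
    then show "L \<in> \<kappa>'" using in_class_iff[OF k(2)] m by blast
  qed
  show ?thesis using sub[OF k N] sub[OF k(2,1) N(2,1)] by blast
qed

lemma simple_class_exists:
  assumes "simple_module A M" shows "\<exists>\<kappa>\<in>simple_classes A. M \<in> \<kappa>"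
proof -
  have "{N. is_module A N \<and> mod_iso A M N} \<in> simple_classes A"
    using assms unfolding simple_classes_def by blast
  moreover have "M \<in> {N. is_module A N \<and> mod_iso A M N}"
    using mod_iso_refl[OF simple_is_module[OF assms]] simple_is_module[OF assms] by simp
  ultimately show ?thesis by (rule bexI[rotated])
qed

lemma rep_iso_eq:
  assumes "\<kappa> \<in> simple_classes A" "\<kappa>' \<in> simple_classes A" "mod_iso A (rep A \<kappa>) (rep A \<kappa>')"
  shows "\<kappa> = \<kappa>'"
proof (rule class_eqI[OF assms(1,2)])
  show "rep A \<kappa>' \<in> \<kappa>" using in_class_iff[OF assms(1)] rep_module[OF assms(2)] assms(3) by blast
  show "rep A \<kappa>' \<in> \<kappa>'" by (rule rep_in_class[OF assms(2)])
qed

text \<open>All columns of the chosen representatives are prescribed at once, which is possible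
  because distinct classes have non-isomorphic representatives.\<close>

lemma density_classes:
  assumes A: "unital_subalgebra A" and F: "finite F" "F \<subseteq> simple_classes A"
  shows "\<exists>a\<in>A. \<forall>\<kappa>\<in>F. \<forall>p<mod_dim (rep A \<kappa>). \<forall>q<mod_dim (rep A \<kappa>). ent (rep A \<kappa>) a p q = Y \<kappa> p q"
proof -
  let ?C = "simple_classes A"
  have inj: "inj_on (rep A) ?C"
  proof (rule inj_onI)
    fix \<kappa> \<kappa>' assume k: "\<kappa> \<in> ?C" "\<kappa>' \<in> ?C" and e: "rep A \<kappa> = rep A \<kappa>'"
    show "\<kappa> = \<kappa>'" by (rule rep_iso_eq[OF k]) (simp add: e mod_iso_refl[OF rep_module[OF k(2)]])
  qed
  \<comment> \<open>\<open>density_columns\<close> prescribes values per module; injectivity of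
    \<open>rep A\<close> leads back to the class.\<close>
  define y where "y = (\<lambda>M q p. Y (the_inv_into ?C (rep A) M) p q)"
  have "\<exists>a\<in>A. \<forall>(M, i)\<in>(\<Union>\<kappa>\<in>F. Pair (rep A \<kappa>) ` {..<mod_dim (rep A \<kappa>)}). \<forall>p<mod_dim M. ent M a p i = y M i p"
  proof (rule density_columns[OF A, of "rep A ` ?C"])
    show "simple_module A M" if "M \<in> rep A ` ?C" for M using that rep_simple by blast
    show "M = N" if "M \<in> rep A ` ?C" "N \<in> rep A ` ?C" "mod_iso A M N" for M N
      using that rep_iso_eq by blast
    show "finite (\<Union>\<kappa>\<in>F. Pair (rep A \<kappa>) ` {..<mod_dim (rep A \<kappa>)})" using F by blast
    show "(\<Union>\<kappa>\<in>F. Pair (rep A \<kappa>) ` {..<mod_dim (rep A \<kappa>)}) \<subseteq> {(M, i). M \<in> rep A ` ?C \<and> i < mod_dim M}"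
      using F by auto
  qed
  then obtain a where a: "a \<in> A"
    "\<And>\<kappa> i p. \<kappa> \<in> F \<Longrightarrow> i < mod_dim (rep A \<kappa>) \<Longrightarrow> p < mod_dim (rep A \<kappa>) \<Longrightarrow> ent (rep A \<kappa>) a p i = y (rep A \<kappa>) i p"
    by blast
  have "y (rep A \<kappa>) i p = Y \<kappa> p i" if "\<kappa> \<in> F" for \<kappa> i p
    using the_inv_into_f_f[OF inj] F that by (auto simp: y_def)
  then show ?thesis using a by (intro bexI[OF _ a(1)]) simp
qed

text \<open>Elements whose entry \<open>(0, 0)\<close> is 1 on one class and 0 on the others are
  linearly independent, so a finite spanning set of \<open>A\<close> bounds the number of
  classes.\<close>

lemma finite_simple_classes:
  assumes A: "unital_subalgebra A" and fd: "finite_dimensional A"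
  shows "finite (simple_classes A)"
proof -
  obtain S where S: "finite S" "A \<subseteq> cvec.span S" using fd by (auto simp: finite_dimensional_def)
  have "card F \<le> card S" if F: "F \<subseteq> simple_classes A" "finite F" for F
  proof -
    have "\<exists>a\<in>A. \<forall>\<kappa>'\<in>F. \<forall>p<mod_dim (rep A \<kappa>'). \<forall>q<mod_dim (rep A \<kappa>'). ent (rep A \<kappa>') a p q = (if \<kappa>' = \<kappa> then 1 else 0)" for \<kappa>
      using density_classes[OF A F(2,1), of "\<lambda>\<kappa>' p q. if \<kappa>' = \<kappa> then 1 else 0"] .
    then obtain a where a: "\<And>\<kappa>. a \<kappa> \<in> A" "\<And>\<kappa> \<kappa>'. \<kappa>' \<in> F \<Longrightarrow> ent (rep A \<kappa>') (a \<kappa>) 0 0 = (if \<kappa>' = \<kappa> then 1 else 0)"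
      using simple_dim[OF rep_simple] F by (metis subsetD)
    have inj: "inj_on a F" by (rule inj_onI) (metis a(2) zero_neq_one)
    have "cvec.independent (a ` F)"
    proof (rule cvec.independent_if_scalars_zero)
      fix f x assume z: "(\<Sum>x\<in>a ` F. f x *\<^sub>C x) = 0" and x: "x \<in> a ` F"
      obtain \<kappa> where k: "\<kappa> \<in> F" "x = a \<kappa>" using x by blast
      have kc: "\<kappa> \<in> simple_classes A" using k F by blast
      have "ent (rep A \<kappa>) (\<Sum>\<kappa>'\<in>F. f (a \<kappa>') *\<^sub>C a \<kappa>') 0 0 = (\<Sum>\<kappa>'\<in>F. f (a \<kappa>') * ent (rep A \<kappa>) (a \<kappa>') 0 0)"
        using rep_module[OF kc] simple_dim[OF rep_simple[OF kc]]
        by (simp add: ent_sum[OF A] subalgebra_scale[OF A] a ent_scale[where A = A])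
      also have "\<dots> = (\<Sum>\<kappa>'\<in>F. if \<kappa>' = \<kappa> then f (a \<kappa>) else 0)" by (intro sum.cong refl) (auto simp: a(2)[OF k(1)])
      also have "\<dots> = f x" using k F by simp
      finally have "f x = ent (rep A \<kappa>) (\<Sum>x\<in>a ` F. f x *\<^sub>C x) 0 0" by (simp add: sum.reindex[OF inj])
      then show "f x = 0" using z ent_zero[OF A rep_module[OF kc]] simple_dim[OF rep_simple[OF kc]] by simp
    qed (use F in simp)
    moreover have "a ` F \<subseteq> cvec.span S" using a S by blast
    ultimately have "card (a ` F) \<le> card S" using cvec.independent_span_bound[OF S(1)] by blast
    then show ?thesis by (simp add: card_image[OF inj])
  qed
  then show ?thesis using finite_if_finite_subsets_card_bdd[of "simple_classes A" "card S"] by blast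
qed

lemma iso_ent_zero:
  assumes iso: "mod_iso A M N" and M: "is_module A M" and N: "is_module A N" and a: "a \<in> A"
    and z: "\<And>p q. p < mod_dim M \<Longrightarrow> q < mod_dim M \<Longrightarrow> ent M a p q = 0"
    and pq: "p < mod_dim N" "q < mod_dim N"
  shows "ent N a p q = 0"
proof -
  obtain P Q where PQ: "mod_dim N = mod_dim M" "P \<in> carrier_mat (mod_dim M) (mod_dim M)"
    "Q \<in> carrier_mat (mod_dim M) (mod_dim M)" "P * Q = 1\<^sub>m (mod_dim M)" "Q * P = 1\<^sub>m (mod_dim M)"
    "\<And>a. a \<in> A \<Longrightarrow> P * action M a = action N a * P" by (rule mod_isoE[OF iso]) blast
  let ?d = "mod_dim M"
  have Ma: "action M a \<in> carrier_mat ?d ?d" and Na: "action N a \<in> carrier_mat ?d ?d"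
    using is_module_carrier[OF M a] is_module_carrier[OF N a] PQ(1) by auto
  have M0: "action M a = 0\<^sub>m ?d ?d" using Ma z by (intro eq_matI) (auto simp: ent_def)
  have "action N a = action N a * P * Q" using assoc_mult_mat[OF Na PQ(2,3)] PQ(4) Na by simp
  also have "\<dots> = P * action M a * Q" using PQ(6)[OF a] by simp
  also have "\<dots> = 0\<^sub>m ?d ?d" using PQ M0 by simp
  finally show ?thesis using pq PQ(1) by (simp add: ent_def)
qed

text \<open>The dimension is the cardinality of a basis, which counts as 0 for infinite bases; the
  finite spanning set excludes these.\<close>

lemma proper_subspace_dim:
  assumes L: "cvec.subspace L'" "L' \<subset> L" and S: "finite S" "L \<subseteq> cvec.span S"
  shows "cvec.dim L' < cvec.dim (L :: 'a::complex_algebra_1 set)"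
proof -
  obtain B where B: "B \<subseteq> L" "cvec.independent B" "L \<subseteq> cvec.span B" "card B = cvec.dim L"
    using cvec.basis_exists by blast
  obtain B' where B': "B' \<subseteq> L'" "cvec.independent B'" "L' \<subseteq> cvec.span B'" "card B' = cvec.dim L'"
    using cvec.basis_exists by blast
  have fB: "finite B" using cvec.independent_span_bound[OF S(1) B(2)] B(1) S(2) by blast
  obtain x where x: "x \<in> L" "x \<notin> L'" using L(2) by blast
  have "cvec.span B' = L'" using B' L(1) by (intro cvec.span_subspace) auto
  then have ind: "cvec.independent (insert x B')" using x B'(2) by (intro cvec.independent_insertI) auto
  have sub: "insert x B' \<subseteq> cvec.span B" using x B(3) B'(1) L(2) by blast
  have "finite (insert x B')" "card (insert x B') \<le> card B"
    using cvec.independent_span_bound[OF fB ind sub] by auto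
  moreover have "x \<notin> B'" using x B' by blast
  ultimately show ?thesis using B(4) B'(4) by simp
qed

text \<open>The module is the ideal \<open>L\<close> itself, in coordinates with respect to a basis.\<close>

lemma minimal_left_ideal_module:
  assumes A: "unital_subalgebra A" and S: "finite S" "A \<subseteq> cvec.span S"
    and L: "left_ideal A L" "L \<noteq> {0}"
    and min: "\<And>L'. left_ideal A L' \<Longrightarrow> L' \<subseteq> L \<Longrightarrow> L' = {0} \<or> L' = L"
  shows "\<exists>M. simple_module A M \<and>
    (\<forall>a\<in>A. (\<forall>p<mod_dim M. \<forall>q<mod_dim M. ent M a p q = 0) \<longrightarrow> (\<forall>x\<in>L. a * x = 0))"
proof -
  have LA: "L \<subseteq> A" and Ls: "cvec.subspace L" and Lm: "\<And>a x. a \<in> A \<Longrightarrow> x \<in> L \<Longrightarrow> a * x \<in> L"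
    using L(1) by (auto simp: left_ideal_def)
  obtain B where B: "B \<subseteq> L" "cvec.independent B" "L \<subseteq> cvec.span B" "card B = cvec.dim L"
    using cvec.basis_exists by blast
  have fB: "finite B" using cvec.independent_span_bound[OF S(1) B(2)] B(1) S(2) LA by blast
  have sB: "cvec.span B = L" using B Ls by (intro cvec.span_subspace) auto
  obtain b where b: "bij_betw b {..<card B} B" using ex_bij_betw_nat_finite[OF fB] by (auto simp: lessThan_atLeast0)
  let ?d = "card B"
  have bB: "b i \<in> B" if "i < ?d" for i using b that by (auto simp: bij_betw_def)
  have bL: "b i \<in> L" if "i < ?d" for i using bB[OF that] B by blast
  have binj: "b i = b j \<longleftrightarrow> i = j" if "i < ?d" "j < ?d" for i j
    using b that by (auto simp: bij_betw_def inj_on_def)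
  define R where "R = (\<lambda>x i. cvec.representation B x (b i))"
  have R_add: "R (x + y) i = R x i + R y i" if "x \<in> L" "y \<in> L" for x y i
    using fun_cong[OF cvec.representation_add[OF B(2), of y x], of "b i"] that sB by (simp add: R_def)
  have R_scale: "R (c *\<^sub>C x) i = c * R x i" if "x \<in> L" for c x i
    using cvec.representation_scale[OF B(2), of x c] that sB by (simp add: R_def)
  have R_zero: "R 0 i = 0" for i by (simp add: R_def cvec.representation_zero)
  have R_basis: "R (b j) i = (if i = j then 1 else 0)" if "i < ?d" "j < ?d" for i j
    using cvec.representation_basis[OF B(2) bB[OF that(2)]] binj[OF that] by (auto simp: R_def)
  have R_sum: "R (sum f T) i = (\<Sum>x\<in>T. R (f x) i)" if "\<And>x. x \<in> T \<Longrightarrow> f x \<in> L" for f T i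
    using cvec.representation_sum[OF B(2), of T f] that sB by (simp add: R_def)
  have expand: "x = (\<Sum>i<?d. R x i *\<^sub>C b i)" if "x \<in> L" for x
  proof -
    have "x = (\<Sum>v\<in>B. cvec.representation B x v *\<^sub>C v)"
      by (rule cvec.sum_representation_eq[OF B(2) _ fB, symmetric]) (use that sB in auto)
    also have "\<dots> = (\<Sum>i<?d. R x i *\<^sub>C b i)"
      unfolding R_def by (rule sum.reindex_bij_betw[OF b, symmetric])
    finally show ?thesis .
  qed
  have R_mult: "R (a * x) i = (\<Sum>j<?d. R (a * b j) i * R x j)" if a: "a \<in> A" and x: "x \<in> L" for a x i
  proof -
    have "a * x = (\<Sum>j<?d. R x j *\<^sub>C (a * b j))"
      by (subst expand[OF x]) (simp add: sum_distrib_left mult_scaleC_right)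
    then have "R (a * x) i = (\<Sum>j<?d. R (R x j *\<^sub>C (a * b j)) i)"
      using R_sum[of "{..<?d}" "\<lambda>j. R x j *\<^sub>C (a * b j)" i] cvec.subspace_scale[OF Ls Lm[OF a bL]] by simp
    then show ?thesis using R_scale[OF Lm[OF a bL]] by (simp add: mult.commute)
  qed
  define M where "M = (?d, \<lambda>a. mat ?d ?d (\<lambda>(i, j). R (a * b j) i))"
  have dM [simp]: "mod_dim M = ?d" by (simp add: M_def)
  have aM: "action M a $$ (i, j) = R (a * b j) i" if "i < ?d" "j < ?d" for a i j
    using that by (simp add: M_def)
  have cM: "action M a \<in> carrier_mat ?d ?d" for a by (simp add: M_def)
  have mod: "is_module A M"
    unfolding is_module_def dM
  proof (intro conjI ballI allI)
    show "action M a \<in> carrier_mat ?d ?d" for a by (rule cM)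
    show "action M 1 = 1\<^sub>m ?d" using cM by (intro eq_matI) (auto simp: aM R_basis)
    show "action M (a + a') = action M a + action M a'" if "a \<in> A" "a' \<in> A" for a a'
      using cM[of a] cM[of a'] cM[of "a + a'"] that
      by (intro eq_matI) (auto simp: aM distrib_right R_add Lm bL)
    show "action M (c *\<^sub>C a) = c \<cdot>\<^sub>m action M a" if "a \<in> A" for c a
      using cM[of a] cM[of "c *\<^sub>C a"] that
      by (intro eq_matI) (auto simp: aM mult_scaleC_left R_scale Lm bL)
    show "action M (a * a') = action M a * action M a'" if a: "a \<in> A" "a' \<in> A" for a a'
    proof (rule eq_matI)
      fix i j assume "i < dim_row (action M a * action M a')" "j < dim_col (action M a * action M a')"
      then have ij: "i < ?d" "j < ?d" using cM[of a] cM[of a'] by auto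
      have "(action M a * action M a') $$ (i, j) = (\<Sum>k<?d. R (a * b k) i * R (a' * b j) k)"
        unfolding index_mult_mat_sum[OF cM cM ij] using ij by (simp add: aM)
      also have "\<dots> = R (a * (a' * b j)) i" using R_mult[OF a(1) Lm[OF a(2) bL[OF ij(2)]]] by simp
      finally show "action M (a * a') $$ (i, j) = (action M a * action M a') $$ (i, j)"
        using ij by (simp add: aM mult.assoc)
    qed (use cM[of a] cM[of a'] cM[of "a * a'"] in auto)
  qed
  have dpos: "0 < ?d"
  proof (rule ccontr)
    assume "\<not> 0 < ?d"
    then have "B = {}" using fB by simp
    then show False using sB L(2) by simp
  qed
  have "simple_module A M"
    unfolding simple_module_def dM
  proof (intro conjI allI impI mod dpos)
    fix W assume W: "is_submodule A M W"
    \<comment> \<open>The elements of \<open>L\<close> whose coordinate vectors lie in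
      \<open>W\<close> form a left ideal, so minimality of \<open>L\<close> decides about
      \<open>W\<close>.\<close>
    define LW where "LW = {x \<in> L. vec ?d (R x) \<in> W}"
    have Wc: "W \<subseteq> carrier_vec ?d" "0\<^sub>v ?d \<in> W" "\<And>v w. v \<in> W \<Longrightarrow> w \<in> W \<Longrightarrow> v + w \<in> W"
      "\<And>c v. v \<in> W \<Longrightarrow> c \<cdot>\<^sub>v v \<in> W" "\<And>a v. a \<in> A \<Longrightarrow> v \<in> W \<Longrightarrow> action M a *\<^sub>v v \<in> W"
      using W by (auto simp: is_submodule_def)
    have "left_ideal A LW"
      unfolding left_ideal_def
    proof (intro conjI ballI)
      show "LW \<subseteq> A" using LA by (auto simp: LW_def)
      show "cvec.subspace LW"
      proof (rule cvec.subspaceI)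
        have "vec ?d (R 0) = 0\<^sub>v ?d" by (intro eq_vecI) (auto simp: R_zero)
        then show "0 \<in> LW" using Wc(2) cvec.subspace_0[OF Ls] by (simp add: LW_def)
        show "x + y \<in> LW" if "x \<in> LW" "y \<in> LW" for x y
        proof -
          have "vec ?d (R (x + y)) = vec ?d (R x) + vec ?d (R y)"
            using that by (intro eq_vecI) (auto simp: LW_def R_add)
          then show ?thesis using that Wc(3) cvec.subspace_add[OF Ls] by (simp add: LW_def)
        qed
        show "c *\<^sub>C x \<in> LW" if "x \<in> LW" for c x
        proof -
          have "vec ?d (R (c *\<^sub>C x)) = c \<cdot>\<^sub>v vec ?d (R x)"
            using that by (intro eq_vecI) (auto simp: LW_def R_scale)
          then show ?thesis using that Wc(4) cvec.subspace_scale[OF Ls] by (simp add: LW_def)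
        qed
      qed
      show "a * x \<in> LW" if a: "a \<in> A" and x: "x \<in> LW" for a x
      proof -
        have xL: "x \<in> L" using x by (simp add: LW_def)
        have "vec ?d (R (a * x)) = action M a *\<^sub>v vec ?d (R x)"
        proof (rule eq_vecI)
          fix i assume "i < dim_vec (action M a *\<^sub>v vec ?d (R x))"
          then have i: "i < ?d" using cM[of a] by simp
          have "(action M a *\<^sub>v vec ?d (R x)) $ i = (\<Sum>j<?d. R (a * b j) i * R x j)"
            using index_mult_mat_vec_sum[OF cM[of a] _ i, of "vec ?d (R x)"] i by (simp add: aM)
          then show "vec ?d (R (a * x)) $ i = (action M a *\<^sub>v vec ?d (R x)) $ i"
            using i R_mult[OF a xL] by simp
        qed (use cM[of a] in auto)
        then show ?thesis using x Wc(5)[OF a] Lm[OF a] by (simp add: LW_def)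
      qed
    qed
    moreover have "LW \<subseteq> L" by (auto simp: LW_def)
    ultimately have "LW = {0} \<or> LW = L" by (rule min)
    moreover have lin: "\<exists>x\<in>L. vec ?d (R x) = v" if v: "v \<in> carrier_vec ?d" for v
    proof -
      let ?x = "\<Sum>j<?d. v $ j *\<^sub>C b j"
      have sL: "v $ j *\<^sub>C b j \<in> L" if "j < ?d" for j using cvec.subspace_scale[OF Ls bL[OF that]] .
      then have xL: "?x \<in> L" by (intro cvec.subspace_sum[OF Ls]) auto
      have "R ?x i = v $ i" if i: "i < ?d" for i
      proof -
        have "R ?x i = (\<Sum>j<?d. v $ j * R (b j) i)" using R_sum[of "{..<?d}" "\<lambda>j. v $ j *\<^sub>C b j" i] sL by (simp add: R_scale bL)
        also have "\<dots> = (\<Sum>j<?d. if i = j then v $ j else 0)" using i by (intro sum.cong) (auto simp: R_basis)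
        also have "\<dots> = v $ i" using i by simp
        finally show ?thesis .
      qed
      then have "vec ?d (R ?x) = v" using v by (intro eq_vecI) auto
      then show ?thesis using xL by blast
    qed
    ultimately show "W = {0\<^sub>v ?d} \<or> W = carrier_vec ?d"
    proof (elim disjE)
      assume z: "LW = {0}"
      have "v = 0\<^sub>v ?d" if v: "v \<in> W" for v
      proof -
        obtain x where x: "x \<in> L" "vec ?d (R x) = v" using lin v Wc(1) by blast
        then have "x \<in> LW" using v by (simp add: LW_def)
        then have "x = 0" using z by simp
        then show ?thesis using x(2) R_zero by (intro eq_vecI) auto
      qed
      then show ?thesis using Wc(2) by blast
    next
      assume z: "LW = L"
      have "v \<in> W" if v: "v \<in> carrier_vec ?d" for v
      proof -
        obtain x where x: "x \<in> L" "vec ?d (R x) = v" using lin v by blast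
        then have "x \<in> LW" using z by simp
        then show ?thesis using x by (simp add: LW_def)
      qed
      then show ?thesis using Wc(1) by blast
    qed
  qed
  \<comment> \<open>A vanishing matrix kills every basis element of \<open>L\<close>. This links the
    action on a simple module with multiplication inside the algebra.\<close>
  moreover have "a * x = 0" if a: "a \<in> A" and z: "\<forall>p<mod_dim M. \<forall>q<mod_dim M. ent M a p q = 0" and x: "x \<in> L" for a x
  proof -
    have "R (a * b j) i = 0" if "i < ?d" "j < ?d" for i j
      using z that unfolding dM ent_def aM[OF that, symmetric] by blast
    then have "R (a * x) i = 0" if "i < ?d" for i using R_mult[OF a x] that by simp
    then show ?thesis by (subst expand[OF Lm[OF a x]]) simp
  qed
  ultimately show ?thesis by blast
qed

section \<open>Faithfulness and matrix units\<close>

locale semisimple_algebra =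
  fixes A :: "'a::complex_algebra_1 set"
  assumes sub: "unital_subalgebra A" and fd: "finite_dimensional A" and ss: "semisimple A"
begin

abbreviation "Cl \<equiv> simple_classes A"
abbreviation "dm \<kappa> \<equiv> mod_dim (rep A \<kappa>)"
abbreviation "en \<kappa> \<equiv> ent (rep A \<kappa>)"

lemma finite_Cl: "finite Cl"
  by (rule finite_simple_classes[OF sub fd])

lemma dm_pos: "\<kappa> \<in> Cl \<Longrightarrow> 0 < dm \<kappa>"
  by (rule simple_dim[OF rep_simple])

text \<open>Semisimplicity enters here. If the common annihilator \<open>I\<close> of the simple
  modules were nonzero, it would contain a minimal left ideal \<open>L\<close>; this is itself a
  simple module, so \<open>I\<close> kills \<open>L\<close>. Take a complement \<open>J\<close> and
  write \<open>1 = f + f'\<close> accordingly. For \<open>x\<close> in \<open>L\<close> the product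
  \<open>x * f\<close> vanishes, so \<open>x = x * f'\<close> lies in \<open>J\<close>, which meets
  \<open>L\<close> only in 0.\<close>

lemma faithful:
  assumes a: "a \<in> A" and z: "\<And>\<kappa> p q. \<kappa> \<in> Cl \<Longrightarrow> p < dm \<kappa> \<Longrightarrow> q < dm \<kappa> \<Longrightarrow> en \<kappa> a p q = 0"
  shows "a = 0"
proof (rule ccontr)
  assume "a \<noteq> 0"
  obtain S where S: "finite S" "A \<subseteq> cvec.span S" using fd by (auto simp: finite_dimensional_def)
  define I where "I = {a\<in>A. \<forall>\<kappa>\<in>Cl. \<forall>p<dm \<kappa>. \<forall>q<dm \<kappa>. en \<kappa> a p q = 0}"
  have I: "left_ideal A I"
    unfolding left_ideal_def
  proof (intro conjI ballI)
    show "I \<subseteq> A" by (auto simp: I_def)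
    show "cvec.subspace I"
    proof (rule cvec.subspaceI)
      show "0 \<in> I" by (simp add: I_def subalgebra_zero[OF sub] ent_zero[OF sub rep_module])
      show "x + y \<in> I" if "x \<in> I" "y \<in> I" for x y
        using that by (simp add: I_def subalgebra_add[OF sub] ent_add[OF rep_module])
      show "c *\<^sub>C x \<in> I" if "x \<in> I" for c x
        using that by (simp add: I_def subalgebra_scale[OF sub] ent_scale[OF rep_module])
    qed
    show "b * x \<in> I" if "b \<in> A" "x \<in> I" for b x
      using that by (simp add: I_def subalgebra_mult[OF sub] ent_mult[OF rep_module])
  qed
  have aI: "a \<in> I" using a z by (simp add: I_def)
  \<comment> \<open>A nonzero left ideal of least dimension inside \<open>I\<close> is minimal,
    because proper subideals have smaller dimension.\<close>
  define P where "P = (\<lambda>L. left_ideal A L \<and> L \<subseteq> I \<and> L \<noteq> {0})"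
  have "P I" using I aI \<open>a \<noteq> 0\<close> by (auto simp: P_def)
  then obtain L where L: "P L" and Lmin: "\<And>L'. P L' \<Longrightarrow> cvec.dim L \<le> cvec.dim L'"
    using ex_has_least_nat[of P I cvec.dim] by blast
  have Li: "left_ideal A L" "L \<subseteq> I" "L \<noteq> {0}" using L by (auto simp: P_def)
  have min: "L' = {0} \<or> L' = L" if L': "left_ideal A L'" "L' \<subseteq> L" for L'
  proof (rule ccontr)
    assume n: "\<not> ?thesis"
    then have "P L'" using L' Li by (auto simp: P_def)
    moreover have "cvec.dim L' < cvec.dim L"
      by (rule proper_subspace_dim[OF _ _ S(1)]) (use L' n Li S(2) in \<open>auto simp: left_ideal_def\<close>)
    ultimately show False using Lmin by fastforce
  qed
  obtain M where M: "simple_module A M"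
    "\<And>a x. a \<in> A \<Longrightarrow> \<forall>p<mod_dim M. \<forall>q<mod_dim M. ent M a p q = 0 \<Longrightarrow> x \<in> L \<Longrightarrow> a * x = 0"
    using minimal_left_ideal_module[OF sub S Li(1,3) min] by blast
  obtain \<kappa> where k: "\<kappa> \<in> Cl" "M \<in> \<kappa>" using simple_class_exists[OF M(1)] by blast
  have IL: "a * x = 0" if aI: "a \<in> I" and x: "x \<in> L" for a x
  proof (rule M(2)[OF _ _ x])
    show aA: "a \<in> A" using aI by (simp add: I_def)
    have "mod_iso A (rep A \<kappa>) M" by (rule in_class_iso[OF k])
    from iso_ent_zero[OF this rep_module[OF k(1)] simple_is_module[OF M(1)] aA]
    show "\<forall>p<mod_dim M. \<forall>q<mod_dim M. ent M a p q = 0" using aI k(1) by (simp add: I_def)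
  qed
  obtain J where J: "left_ideal A J" "L \<inter> J = {0}" "A = {x + y |x y. x \<in> L \<and> y \<in> J}"
    using ss[unfolded semisimple_def, rule_format, OF Li(1)] by (elim exE conjE)
  obtain f f' where f: "f \<in> L" "f' \<in> J" "1 = f + f'" using subalgebra_one[OF sub] by (subst (asm) J(3)) blast
  have "x = 0" if x: "x \<in> L" for x
  proof -
    have xA: "x \<in> A" using x Li(1) by (auto simp: left_ideal_def)
    have xf: "x * f = 0" using IL x f(1) Li(2) by blast
    have "x = x * (f + f')" using f(3) by simp
    then have "x = x * f + x * f'" by (simp add: distrib_left)
    then have "x = x * f'" using xf by simp
    moreover have "x * f' \<in> J" using J(1) xA f(2) by (simp add: left_ideal_def)
    ultimately have "x \<in> J" by simp
    then show ?thesis using x J(2) by blast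
  qed
  moreover have "0 \<in> L" using Li(1) by (auto simp: left_ideal_def intro: cvec.subspace_0)
  ultimately show False using Li(3) by blast
qed

lemma ent_eqI:
  assumes a: "a \<in> A" "b \<in> A" and e: "\<And>\<kappa> p q. \<kappa> \<in> Cl \<Longrightarrow> p < dm \<kappa> \<Longrightarrow> q < dm \<kappa> \<Longrightarrow> en \<kappa> a p q = en \<kappa> b p q"
  shows "a = b"
proof -
  have "a - b = 0"
    by (rule faithful) (use a e in \<open>auto simp: subalgebra_diff[OF sub] ent_diff[OF sub rep_module]\<close>)
  then show ?thesis by simp
qed

text \<open>Existence comes from density, uniqueness within the index range from
  \<open>ent_eqI\<close>. The choice is made for arbitrary indices, so membership in
  \<open>A\<close> carries no range conditions. For a simple class \<kappa>,
  \<open>mat_unit \<kappa> 0 0\<close> serves throughout as the minimal idempotent of its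
  block.\<close>

definition mat_unit :: "'a fdmod set \<Rightarrow> nat \<Rightarrow> nat \<Rightarrow> 'a" where
  "mat_unit \<kappa> p q = (SOME a. a \<in> A \<and> (\<forall>\<kappa>'\<in>Cl. \<forall>r<dm \<kappa>'. \<forall>s<dm \<kappa>'.
     en \<kappa>' a r s = (if \<kappa>' = \<kappa> \<and> r = p \<and> s = q then 1 else 0)))"

lemma mat_unit:
  shows mat_unit_in: "mat_unit \<kappa> p q \<in> A"
    and ent_mat_unit: "\<kappa>' \<in> Cl \<Longrightarrow> r < dm \<kappa>' \<Longrightarrow> s < dm \<kappa>' \<Longrightarrow>
      en \<kappa>' (mat_unit \<kappa> p q) r s = (if \<kappa>' = \<kappa> \<and> r = p \<and> s = q then 1 else 0)"
proof -
  have "\<exists>a. a \<in> A \<and> (\<forall>\<kappa>'\<in>Cl. \<forall>r<dm \<kappa>'. \<forall>s<dm \<kappa>'.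
     en \<kappa>' a r s = (if \<kappa>' = \<kappa> \<and> r = p \<and> s = q then 1 else 0))"
    using density_classes[OF sub finite_Cl order_refl, of "\<lambda>\<kappa>' r s. if \<kappa>' = \<kappa> \<and> r = p \<and> s = q then 1 else 0"] by blast
  from someI_ex[OF this, folded mat_unit_def]
  show "mat_unit \<kappa> p q \<in> A" "\<kappa>' \<in> Cl \<Longrightarrow> r < dm \<kappa>' \<Longrightarrow> s < dm \<kappa>' \<Longrightarrow>
      en \<kappa>' (mat_unit \<kappa> p q) r s = (if \<kappa>' = \<kappa> \<and> r = p \<and> s = q then 1 else 0)"
    by blast+
qed

text \<open>Left multiplication on a column of matrix units has the coefficients of the action on
  \<open>rep A \<kappa>\<close>: each such column is a copy of the simple module inside
  \<open>A\<close>.\<close>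

lemma mult_mat_unit:
  assumes a: "a \<in> A" and k: "\<kappa> \<in> Cl" and pq: "p < dm \<kappa>" "q < dm \<kappa>"
  shows "a * mat_unit \<kappa> p q = (\<Sum>r<dm \<kappa>. en \<kappa> a r p *\<^sub>C mat_unit \<kappa> r q)"
proof (rule ent_eqI)
  show "a * mat_unit \<kappa> p q \<in> A" by (intro subalgebra_mult[OF sub] a mat_unit_in)
  have sA: "en \<kappa> a r p *\<^sub>C mat_unit \<kappa> r q \<in> A" for r by (intro subalgebra_scale[OF sub] mat_unit_in)
  show "(\<Sum>r<dm \<kappa>. en \<kappa> a r p *\<^sub>C mat_unit \<kappa> r q) \<in> A" by (intro subalgebra_sum[OF sub] sA)
  fix \<kappa>' r s assume k': "\<kappa>' \<in> Cl" and rs: "r < dm \<kappa>'" "s < dm \<kappa>'"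
  have "en \<kappa>' (a * mat_unit \<kappa> p q) r s = (\<Sum>l<dm \<kappa>'. en \<kappa>' a r l * en \<kappa>' (mat_unit \<kappa> p q) l s)"
    by (rule ent_mult[OF rep_module[OF k'] a mat_unit_in rs])
  also have "\<dots> = (\<Sum>l<dm \<kappa>'. if l = p then (if \<kappa>' = \<kappa> \<and> s = q then en \<kappa> a r p else 0) else 0)"
    by (intro sum.cong refl) (auto simp: ent_mat_unit[OF k' _ rs(2)])
  also have "\<dots> = (if \<kappa>' = \<kappa> \<and> s = q then en \<kappa> a r p else 0)" using pq by auto
  also have "\<dots> = (\<Sum>l<dm \<kappa>. if l = r then (if \<kappa>' = \<kappa> \<and> s = q then en \<kappa> a r p else 0) else 0)" using rs by auto
  also have "\<dots> = (\<Sum>l<dm \<kappa>. en \<kappa> a l p * en \<kappa>' (mat_unit \<kappa> l q) r s)"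
    by (intro sum.cong refl) (auto simp: ent_mat_unit[OF k' rs])
  also have "\<dots> = en \<kappa>' (\<Sum>r<dm \<kappa>. en \<kappa> a r p *\<^sub>C mat_unit \<kappa> r q) r s"
    using rep_module[OF k'] rs by (simp add: ent_sum[OF sub] sA ent_scale[where A = A] mat_unit_in)
  finally show "en \<kappa>' (a * mat_unit \<kappa> p q) r s = en \<kappa>' (\<Sum>r<dm \<kappa>. en \<kappa> a r p *\<^sub>C mat_unit \<kappa> r q) r s" .
qed

text \<open>Wedderburn's theorem in coordinates: both sides act alike on every simple module, and
  these modules together are faithful.\<close>

lemma expand_mat_unit:
  assumes a: "a \<in> A"
  shows "a = (\<Sum>\<kappa>\<in>Cl. \<Sum>p<dm \<kappa>. \<Sum>q<dm \<kappa>. en \<kappa> a p q *\<^sub>C mat_unit \<kappa> p q)"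
proof (rule ent_eqI[OF a])
  have sA: "en \<kappa> a p q *\<^sub>C mat_unit \<kappa> p q \<in> A" for \<kappa> p q by (intro subalgebra_scale[OF sub] mat_unit_in)
  then have sA2: "(\<Sum>q<dm \<kappa>. en \<kappa> a p q *\<^sub>C mat_unit \<kappa> p q) \<in> A" for \<kappa> p by (rule subalgebra_sum[OF sub])
  then have sA3: "(\<Sum>p<dm \<kappa>. \<Sum>q<dm \<kappa>. en \<kappa> a p q *\<^sub>C mat_unit \<kappa> p q) \<in> A" for \<kappa> by (rule subalgebra_sum[OF sub])
  then show "(\<Sum>\<kappa>\<in>Cl. \<Sum>p<dm \<kappa>. \<Sum>q<dm \<kappa>. en \<kappa> a p q *\<^sub>C mat_unit \<kappa> p q) \<in> A" by (rule subalgebra_sum[OF sub])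
  fix \<kappa>' r s assume k': "\<kappa>' \<in> Cl" and rs: "r < dm \<kappa>'" "s < dm \<kappa>'"
  have "en \<kappa>' (\<Sum>\<kappa>\<in>Cl. \<Sum>p<dm \<kappa>. \<Sum>q<dm \<kappa>. en \<kappa> a p q *\<^sub>C mat_unit \<kappa> p q) r s =
      (\<Sum>\<kappa>\<in>Cl. \<Sum>p<dm \<kappa>. \<Sum>q<dm \<kappa>. en \<kappa> a p q * en \<kappa>' (mat_unit \<kappa> p q) r s)"
    using rep_module[OF k'] rs by (simp add: ent_sum[OF sub] sA sA2 sA3 ent_scale[where A = A] mat_unit_in)
  also have "\<dots> = (\<Sum>\<kappa>\<in>Cl. \<Sum>p<dm \<kappa>. \<Sum>q<dm \<kappa>. if q = s then (if \<kappa> = \<kappa>' \<and> p = r then en \<kappa>' a r s else 0) else 0)"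
    by (intro sum.cong refl) (auto simp: ent_mat_unit[OF k' rs])
  also have "\<dots> = (\<Sum>\<kappa>\<in>Cl. \<Sum>p<dm \<kappa>. if p = r then (if \<kappa> = \<kappa>' then en \<kappa>' a r s else 0) else 0)"
    using rs by (intro sum.cong refl) auto
  also have "\<dots> = (\<Sum>\<kappa>\<in>Cl. if \<kappa> = \<kappa>' then en \<kappa>' a r s else 0)"
    using rs by (intro sum.cong refl) auto
  also have "\<dots> = en \<kappa>' a r s" using k' finite_Cl by simp
  finally show "en \<kappa>' a r s = en \<kappa>' (\<Sum>\<kappa>\<in>Cl. \<Sum>p<dm \<kappa>. \<Sum>q<dm \<kappa>. en \<kappa> a p q *\<^sub>C mat_unit \<kappa> p q) r s" by simp
qed

end

subsection \<open>Decomposition into simple modules\<close>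

lemma sum_lessThan_add: "(\<Sum>j<m + k. f j) = (\<Sum>j<m. f j) + (\<Sum>j<k. f (m + j))" for f :: "nat \<Rightarrow> 'b::comm_monoid_add"
  by (induction k) (simp_all add: add.assoc)

text \<open>Padded with zero rows to a square matrix, \<open>T\<close> has determinant 0, because
  the transpose kills a unit vector; a kernel vector of the padded matrix is also one of
  \<open>T\<close>.\<close>

lemma injective_mat_le:
  assumes T: "T \<in> carrier_mat n m"
    and inj: "\<And>v. v \<in> carrier_vec m \<Longrightarrow> T *\<^sub>v v = 0\<^sub>v n \<Longrightarrow> v = (0\<^sub>v m :: complex vec)"
  shows "m \<le> n"
proof (rule ccontr)
  assume "\<not> m \<le> n"
  then have nm: "n < m" by simp
  define T' where "T' = mat m m (\<lambda>(i, j). if i < n then T $$ (i, j) else 0)"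
  have T': "T' \<in> carrier_mat m m" by (simp add: T'_def)
  have "transpose_mat T' *\<^sub>v unit_vec m n = 0\<^sub>v m"
    using nm T' by (intro eq_vecI) (auto simp: T'_def)
  moreover have "unit_vec m n \<noteq> (0\<^sub>v m :: complex vec)" using nm by simp
  ultimately have "det (transpose_mat T') = 0"
    using det_0_iff_vec_prod_zero_field[of "transpose_mat T'" m] T' by (metis transpose_carrier_mat unit_vec_carrier)
  then have "det T' = 0" using det_transpose[OF T'] by simp
  then obtain v where v: "v \<in> carrier_vec m" "v \<noteq> 0\<^sub>v m" "T' *\<^sub>v v = 0\<^sub>v m"
    using det_0_iff_vec_prod_zero_field[OF T'] by blast
  have "T *\<^sub>v v = 0\<^sub>v n"
  proof (rule eq_vecI)
    fix i assume "i < dim_vec (0\<^sub>v n :: complex vec)"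
    then have i: "i < n" by simp
    have "(T *\<^sub>v v) $ i = (\<Sum>l<m. T $$ (i, l) * v $ l)" by (rule index_mult_mat_vec_sum[OF T v(1) i])
    also have "\<dots> = (\<Sum>l<m. T' $$ (i, l) * v $ l)" using i nm by (intro sum.cong) (auto simp: T'_def)
    also have "\<dots> = (T' *\<^sub>v v) $ i" using i nm by (intro index_mult_mat_vec_sum[OF T' v(1), symmetric]) simp
    finally have "(T *\<^sub>v v) $ i = (T' *\<^sub>v v) $ i" .
    then show "(T *\<^sub>v v) $ i = 0\<^sub>v n $ i" using v(3) i nm by simp
  qed (use T in auto)
  then show False using inj v by blast
qed

lemma mod_dim_direct_sum: "mod_dim (Defs.direct_sum Ms) = sum_list (map mod_dim Ms)"
  by (simp add: Defs.direct_sum_def)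

lemma direct_sum_carrier:
  assumes "\<And>M. M \<in> set Ms \<Longrightarrow> is_module A M" "a \<in> A"
  shows "action (Defs.direct_sum Ms) a \<in> carrier_mat (mod_dim (Defs.direct_sum Ms)) (mod_dim (Defs.direct_sum Ms))"
proof -
  have "dim_row (action M a) = mod_dim M \<and> dim_col (action M a) = mod_dim M" if "M \<in> set Ms" for M
    using is_module_carrier[OF assms(1)[OF that] assms(2)] by blast
  then have e: "map dim_row (map (\<lambda>M. action M a) Ms) = map mod_dim Ms" "map dim_col (map (\<lambda>M. action M a) Ms) = map mod_dim Ms"
    unfolding map_map comp_def by (intro map_cong; blast)+
  show ?thesis
    by (rule carrier_matI) (simp_all only: Defs.direct_sum_def fst_conv snd_conv dim_diag_block_mat e)
qed

lemma direct_sum_Cons: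
  assumes "\<And>M. M \<in> set (K # Ms) \<Longrightarrow> is_module A M" "a \<in> A"
    "i < mod_dim K + mod_dim (Defs.direct_sum Ms)" "j < mod_dim K + mod_dim (Defs.direct_sum Ms)"
  shows "action (Defs.direct_sum (K # Ms)) a $$ (i, j) =
    (if i < mod_dim K then if j < mod_dim K then action K a $$ (i, j) else 0
     else if j < mod_dim K then 0 else action (Defs.direct_sum Ms) a $$ (i - mod_dim K, j - mod_dim K))"
proof -
  have D: "action (Defs.direct_sum Ms) a \<in> carrier_mat (mod_dim (Defs.direct_sum Ms)) (mod_dim (Defs.direct_sum Ms))"
    using assms by (intro direct_sum_carrier[of _ A]) auto
  have K: "action K a \<in> carrier_mat (mod_dim K) (mod_dim K)" using assms by (intro is_module_carrier[of A]) auto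
  have "action (Defs.direct_sum (K # Ms)) a =
    four_block_mat (action K a) (0\<^sub>m (mod_dim K) (mod_dim (Defs.direct_sum Ms))) (0\<^sub>m (mod_dim (Defs.direct_sum Ms)) (mod_dim K)) (action (Defs.direct_sum Ms) a)"
    using D K by (simp add: Defs.direct_sum_def Let_def)
  then show ?thesis using assms(3,4) D K by simp
qed

lemma character_direct_sum:
  assumes "\<And>M. M \<in> set Ms \<Longrightarrow> is_module A M" "a \<in> A"
  shows "character (Defs.direct_sum Ms) a = (\<Sum>M\<leftarrow>Ms. character M a)"
  using assms
proof (induction Ms)
  case Nil
  then show ?case by (simp add: character_def mod_dim_direct_sum)
next
  case (Cons K Ms)
  have "character (Defs.direct_sum (K # Ms)) a =
      (\<Sum>i<mod_dim K + mod_dim (Defs.direct_sum Ms). action (Defs.direct_sum (K # Ms)) a $$ (i, i))"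
    by (simp add: character_def ent_def mod_dim_direct_sum)
  also have "\<dots> = (\<Sum>i<mod_dim K. action K a $$ (i, i)) + (\<Sum>i<mod_dim (Defs.direct_sum Ms). action (Defs.direct_sum Ms) a $$ (i, i))"
    unfolding sum_lessThan_add
    by (intro arg_cong2[of _ _ _ _ "(+)"] sum.cong refl) (subst direct_sum_Cons[OF Cons.prems]; simp)+
  finally show ?case using Cons by (simp add: character_def ent_def)
qed

context semisimple_algebra
begin

lemma one_eq_sum_mat_unit: "1 = (\<Sum>(\<kappa>, p)\<in>(SIGMA \<kappa>:Cl. {..<dm \<kappa>}). mat_unit \<kappa> p p)"
proof -
  have "1 = (\<Sum>\<kappa>\<in>Cl. \<Sum>p<dm \<kappa>. \<Sum>q<dm \<kappa>. en \<kappa> 1 p q *\<^sub>C mat_unit \<kappa> p q)"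
    by (rule expand_mat_unit[OF subalgebra_one[OF sub]])
  also have "\<dots> = (\<Sum>\<kappa>\<in>Cl. \<Sum>p<dm \<kappa>. \<Sum>q<dm \<kappa>. if q = p then mat_unit \<kappa> p p else 0)"
    by (intro sum.cong refl) (auto simp: ent_one[OF rep_module] scaleC_one)
  also have "\<dots> = (\<Sum>\<kappa>\<in>Cl. \<Sum>p<dm \<kappa>. mat_unit \<kappa> p p)" by (intro sum.cong refl) auto
  also have "\<dots> = (\<Sum>(\<kappa>, p)\<in>(SIGMA \<kappa>:Cl. {..<dm \<kappa>}). mat_unit \<kappa> p p)"
    by (rule sum.Sigma) (auto simp: finite_Cl)
  finally show ?thesis .
qed

lemma mat_unit_mult:
  assumes k: "\<kappa> \<in> Cl" and "p < dm \<kappa>" "q < dm \<kappa>" "r < dm \<kappa>" "s < dm \<kappa>"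
  shows "mat_unit \<kappa> p q * mat_unit \<kappa> r s = (if q = r then mat_unit \<kappa> p s else 0)"
proof -
  have "mat_unit \<kappa> p q * mat_unit \<kappa> r s = (\<Sum>l<dm \<kappa>. if l = p then (if q = r then mat_unit \<kappa> p s else 0) else 0)"
    unfolding mult_mat_unit[OF mat_unit_in k assms(4,5)]
    by (intro sum.cong refl) (auto simp: ent_mat_unit[OF k _ assms(4)] scaleC_one)
  then show ?thesis using assms by simp
qed

text \<open>
  A submodule (the range of \<open>P\<close>) that is not the whole of \<open>N\<close> misses some vector \<open>u = E\<^sub>0\<^sub>p w\<close>; the
  vectors \<open>E\<^sub>q\<^sub>0 u\<close> then span a copy of a simple module independent of that submodule.
\<close>

lemma extend_embedding:
  assumes N: "is_module A N" and Ms: "\<And>M. M \<in> set Ms \<Longrightarrow> simple_module A M"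
    and P: "P \<in> carrier_mat (mod_dim N) (mod_dim (Defs.direct_sum Ms))"
    and comm: "\<And>a. a \<in> A \<Longrightarrow> action N a * P = P * action (Defs.direct_sum Ms) a"
    and inj: "\<And>v. v \<in> carrier_vec (mod_dim (Defs.direct_sum Ms)) \<Longrightarrow> P *\<^sub>v v = 0\<^sub>v (mod_dim N) \<Longrightarrow> v = 0\<^sub>v (mod_dim (Defs.direct_sum Ms))"
    and w: "w \<in> carrier_vec (mod_dim N)" "\<And>v. v \<in> carrier_vec (mod_dim (Defs.direct_sum Ms)) \<Longrightarrow> P *\<^sub>v v \<noteq> w"
  shows "\<exists>K P'. simple_module A K \<and> P' \<in> carrier_mat (mod_dim N) (mod_dim (Defs.direct_sum (K # Ms))) \<and>
    (\<forall>a\<in>A. action N a * P' = P' * action (Defs.direct_sum (K # Ms)) a) \<and>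
    (\<forall>v\<in>carrier_vec (mod_dim (Defs.direct_sum (K # Ms))). P' *\<^sub>v v = 0\<^sub>v (mod_dim N) \<longrightarrow> v = 0\<^sub>v (mod_dim (Defs.direct_sum (K # Ms))))"
proof -
  let ?n = "mod_dim N" and ?c = "mod_dim (Defs.direct_sum Ms)"
  have MsM: "is_module A M" if "M \<in> set Ms" for M using Ms[OF that] by (rule simple_is_module)
  have Nc: "action N a \<in> carrier_mat ?n ?n" if "a \<in> A" for a using is_module_carrier[OF N that] .
  have Dc: "action (Defs.direct_sum Ms) a \<in> carrier_mat ?c ?c" if "a \<in> A" for a
    using direct_sum_carrier[OF MsM that] .
  define R where "R = {P *\<^sub>v v |v. v \<in> carrier_vec ?c}"
  have wR: "w \<notin> R" using w(2) by (auto simp: R_def)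
  have R_add: "x + y \<in> R" if "x \<in> R" "y \<in> R" for x y
  proof -
    obtain v v' where "x = P *\<^sub>v v" "y = P *\<^sub>v v'" "v \<in> carrier_vec ?c" "v' \<in> carrier_vec ?c"
      using \<open>x \<in> R\<close> \<open>y \<in> R\<close> unfolding R_def by blast
    then show ?thesis unfolding R_def using P by (auto intro!: exI[of _ "v + v'"] simp: mult_add_distrib_mat_vec)
  qed
  have R_scale: "k \<cdot>\<^sub>v x \<in> R" if "x \<in> R" for x k
  proof -
    obtain v where "x = P *\<^sub>v v" "v \<in> carrier_vec ?c" using \<open>x \<in> R\<close> unfolding R_def by blast
    then show ?thesis unfolding R_def using P by (auto intro!: exI[of _ "k \<cdot>\<^sub>v v"] simp: mult_mat_vec)
  qed
  have R_0: "0\<^sub>v ?n \<in> R" unfolding R_def using P by (auto intro!: exI[of _ "0\<^sub>v ?c"])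
  have R_act: "action N a *\<^sub>v x \<in> R" if a: "a \<in> A" and x: "x \<in> R" for a x
  proof -
    obtain v where v: "x = P *\<^sub>v v" "v \<in> carrier_vec ?c" using x unfolding R_def by blast
    have "action N a *\<^sub>v x = (action N a * P) *\<^sub>v v" unfolding v(1) by (rule assoc_mult_mat_vec[symmetric, OF Nc[OF a] P v(2)])
    also have "\<dots> = P *\<^sub>v (action (Defs.direct_sum Ms) a *\<^sub>v v)" unfolding comm[OF a] by (rule assoc_mult_mat_vec[OF P Dc[OF a] v(2)])
    finally show ?thesis unfolding R_def using Dc[OF a] v(2) by auto
  qed
  have Rc: "x \<in> carrier_vec ?n" if "x \<in> R" for x using that P by (auto simp: R_def)
  have act_mult: "action N (a * b) *\<^sub>v v = action N a *\<^sub>v (action N b *\<^sub>v v)" if "a \<in> A" "b \<in> A" "v \<in> carrier_vec ?n" for a b v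
    unfolding is_module_mult[OF N that(1,2)] by (rule assoc_mult_mat_vec[OF Nc[OF that(1)] Nc[OF that(2)] that(3)])
  \<comment> \<open>Otherwise the identity, being the sum of the diagonal matrix units, would carry
    \<open>w\<close> into \<open>R\<close>.\<close>
  have "\<exists>\<kappa> p. \<kappa> \<in> Cl \<and> p < dm \<kappa> \<and> action N (mat_unit \<kappa> p p) *\<^sub>v w \<notin> R"
  proof (rule ccontr)
    assume neg: "\<not> ?thesis"
    have "action N (\<Sum>(\<kappa>, p)\<in>T. mat_unit \<kappa> p p) *\<^sub>v w \<in> R"
      if "finite T" "T \<subseteq> (SIGMA \<kappa>:Cl. {..<dm \<kappa>})" for T
      using that
    proof (induction T rule: finite_induct)
      case empty
      have "action N 0 = 0\<^sub>m ?n ?n"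
        using Nc[OF subalgebra_zero[OF sub]] ent_zero[OF sub N] by (intro eq_matI) (auto simp: ent_def)
      then show ?case using w(1) R_0 by (simp add: zero_mat_mult_vec)
    next
      case (insert x T)
      obtain \<kappa> p where x: "x = (\<kappa>, p)" by (cases x)
      let ?s = "\<Sum>(\<kappa>, p)\<in>T. mat_unit \<kappa> p p"
      have sA: "?s \<in> A" by (rule subalgebra_sum[OF sub]) (auto intro: mat_unit_in)
      have "action N (mat_unit \<kappa> p p + ?s) = action N (mat_unit \<kappa> p p) + action N ?s"
        using N mat_unit_in sA by (simp add: is_module_def)
      then have "action N (mat_unit \<kappa> p p + ?s) *\<^sub>v w = action N (mat_unit \<kappa> p p) *\<^sub>v w + action N ?s *\<^sub>v w"
        using add_mult_distrib_mat_vec[OF Nc[OF mat_unit_in] Nc[OF sA] w(1)] by simp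
      moreover have "action N (mat_unit \<kappa> p p) *\<^sub>v w \<in> R" using neg insert.prems x by auto
      ultimately show ?case using insert R_add x by simp
    qed
    from this[OF _ order_refl] have "action N 1 *\<^sub>v w \<in> R"
      unfolding one_eq_sum_mat_unit[symmetric] by (simp add: finite_Cl)
    then show False using wR N w(1) by (simp add: is_module_def)
  qed
  then obtain \<kappa> p where k: "\<kappa> \<in> Cl" "p < dm \<kappa>" and npp: "action N (mat_unit \<kappa> p p) *\<^sub>v w \<notin> R" by blast
  let ?d = "dm \<kappa>"
  have d0: "0 < ?d" by (rule dm_pos[OF k(1)])
  \<comment> \<open>Row 0 becomes the generating position of the new copy. \<open>u\<close> lies
    outside \<open>R\<close> because \<open>mat_unit \<kappa> p 0\<close> maps it to the vector just
    found.\<close>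
  define u where "u = action N (mat_unit \<kappa> 0 p) *\<^sub>v w"
  have uc: "u \<in> carrier_vec ?n" unfolding u_def by (rule mult_mat_vec_carrier[OF Nc[OF mat_unit_in] w(1)])
  have uR: "u \<notin> R"
  proof
    assume "u \<in> R"
    then have "action N (mat_unit \<kappa> p 0) *\<^sub>v u \<in> R" by (rule R_act[OF mat_unit_in])
    then show False using npp act_mult[OF mat_unit_in mat_unit_in w(1), of \<kappa> p 0 \<kappa> 0 p] k d0
      by (simp add: u_def mat_unit_mult)
  qed
  define Q where "Q = mat ?n ?d (\<lambda>(i, q). (action N (mat_unit \<kappa> q 0) *\<^sub>v u) $ i)"
  have Q: "Q \<in> carrier_mat ?n ?d" by (simp add: Q_def)
  have Qi: "Q $$ (i, q) = (\<Sum>l<?n. ent N (mat_unit \<kappa> q 0) i l * u $ l)" if "i < ?n" "q < ?d" for i q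
    using that by (simp add: Q_def index_mult_mat_vec_sum[OF Nc[OF mat_unit_in] uc] ent_def del: index_mult_mat_vec)
  let ?K = "rep A \<kappa>"
  have K: "simple_module A ?K" "is_module A ?K" using rep_simple rep_module k(1) by auto
  have Kc: "action ?K a \<in> carrier_mat ?d ?d" if "a \<in> A" for a using is_module_carrier[OF K(2) that] .
  have Qcomm: "(\<Sum>j<?n. action N a $$ (i, j) * Q $$ (j, q)) = (\<Sum>r<?d. Q $$ (i, r) * action ?K a $$ (r, q))"
    if a: "a \<in> A" and i: "i < ?n" and q: "q < ?d" for a i q
  proof -
    have "(\<Sum>j<?n. action N a $$ (i, j) * Q $$ (j, q)) = (\<Sum>j<?n. \<Sum>l<?n. ent N a i j * ent N (mat_unit \<kappa> q 0) j l * u $ l)"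
      by (intro sum.cong refl) (simp add: Qi[OF _ q] ent_def sum_distrib_left mult.assoc)
    also have "\<dots> = (\<Sum>l<?n. \<Sum>j<?n. ent N a i j * ent N (mat_unit \<kappa> q 0) j l * u $ l)" by (rule sum.swap)
    also have "\<dots> = (\<Sum>l<?n. ent N (a * mat_unit \<kappa> q 0) i l * u $ l)"
      by (intro sum.cong refl) (simp add: ent_mult[OF N a mat_unit_in i] sum_distrib_right)
    also have "\<dots> = (\<Sum>l<?n. \<Sum>r<?d. en \<kappa> a r q * ent N (mat_unit \<kappa> r 0) i l * u $ l)"
      by (intro sum.cong refl, subst mult_mat_unit[OF a k(1) q d0])
         (simp add: ent_sum[OF sub N] subalgebra_scale[OF sub] mat_unit_in ent_scale[OF N] i sum_distrib_right)
    also have "\<dots> = (\<Sum>r<?d. \<Sum>l<?n. en \<kappa> a r q * ent N (mat_unit \<kappa> r 0) i l * u $ l)" by (rule sum.swap)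
    also have "\<dots> = (\<Sum>r<?d. Q $$ (i, r) * action ?K a $$ (r, q))"
      by (intro sum.cong refl) (simp add: Qi[OF i] ent_def sum_distrib_left sum_distrib_right mult_ac)
    finally show ?thesis .
  qed
  have QcommM: "action N a * Q = Q * action ?K a" if a: "a \<in> A" for a
    by (rule eq_matI) (use Nc[OF a] Kc[OF a] Q in \<open>auto simp: index_mult_mat_sum[OF Nc[OF a] Q] index_mult_mat_sum[OF Q Kc[OF a]] Qcomm[OF a] simp del: index_mult_mat(1)\<close>)
  have Qu: "Q *\<^sub>v unit_vec ?d 0 = u"
  proof -
    have "action N (mat_unit \<kappa> 0 0) *\<^sub>v u = u"
      using act_mult[OF mat_unit_in mat_unit_in w(1), of \<kappa> 0 0 \<kappa> 0 p] k d0 by (simp add: u_def mat_unit_mult)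
    then show ?thesis using Q uc d0 by (intro eq_vecI) (auto simp: Q_def)
  qed
  \<comment> \<open>The preimage of \<open>R\<close> under \<open>Q\<close> is a submodule of a
    simple module that misses the first unit vector, hence zero: the new summand embeds and meets
    \<open>R\<close> trivially.\<close>
  define W where "W = {x \<in> carrier_vec ?d. Q *\<^sub>v x \<in> R}"
  have "is_submodule A ?K W"
    unfolding is_submodule_def
  proof (intro conjI ballI allI)
    show "W \<subseteq> carrier_vec ?d" by (auto simp: W_def)
    have "Q *\<^sub>v 0\<^sub>v ?d = 0\<^sub>v ?n" using Q by auto
    then show "0\<^sub>v ?d \<in> W" using R_0 by (simp add: W_def)
    show "v + v' \<in> W" if "v \<in> W" "v' \<in> W" for v v'
      using that Q R_add by (auto simp: W_def mult_add_distrib_mat_vec)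
    show "c \<cdot>\<^sub>v v \<in> W" if "v \<in> W" for c v
      using that Q R_scale by (auto simp: W_def mult_mat_vec)
    show "action ?K a *\<^sub>v v \<in> W" if a: "a \<in> A" and "v \<in> W" for a v
    proof -
      have v: "v \<in> carrier_vec ?d" "Q *\<^sub>v v \<in> R" using \<open>v \<in> W\<close> by (auto simp: W_def)
      have "Q *\<^sub>v (action ?K a *\<^sub>v v) = action N a *\<^sub>v (Q *\<^sub>v v)"
        using assoc_mult_mat_vec[OF Q Kc[OF a] v(1)] assoc_mult_mat_vec[OF Nc[OF a] Q v(1)] QcommM[OF a] by simp
      then show ?thesis using R_act[OF a v(2)] Kc[OF a] v(1) by (simp add: W_def)
    qed
  qed
  then have "W = {0\<^sub>v ?d} \<or> W = carrier_vec ?d" using K(1) by (simp add: simple_module_def)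
  moreover have "unit_vec ?d 0 \<notin> W" using Qu uR by (simp add: W_def)
  ultimately have W0: "W = {0\<^sub>v ?d}" by auto
  define P' where "P' = mat ?n (?d + ?c) (\<lambda>(i, j). if j < ?d then Q $$ (i, j) else P $$ (i, j - ?d))"
  have dc: "mod_dim (Defs.direct_sum (?K # Ms)) = ?d + ?c" by (simp add: mod_dim_direct_sum)
  have P': "P' \<in> carrier_mat ?n (?d + ?c)" by (simp add: P'_def)
  have allM: "is_module A M" if "M \<in> set (?K # Ms)" for M
    using set_ConsD[OF that] MsM K(2) by blast
  have "action N a * P' = P' * action (Defs.direct_sum (?K # Ms)) a" if a: "a \<in> A" for a
  proof (rule eq_matI)
    have D: "action (Defs.direct_sum (?K # Ms)) a \<in> carrier_mat (?d + ?c) (?d + ?c)"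
      using direct_sum_carrier[of "?K # Ms" A a, OF allM a] unfolding dc .
    show "dim_row (action N a * P') = dim_row (P' * action (Defs.direct_sum (?K # Ms)) a)"
      "dim_col (action N a * P') = dim_col (P' * action (Defs.direct_sum (?K # Ms)) a)"
      using Nc[OF a] P' D by auto
    fix i j assume "i < dim_row (P' * action (Defs.direct_sum (?K # Ms)) a)" "j < dim_col (P' * action (Defs.direct_sum (?K # Ms)) a)"
    then have i: "i < ?n" and j: "j < ?d + ?c" using P' D by auto
    have L: "(action N a * P') $$ (i, j) = (\<Sum>l<?n. action N a $$ (i, l) * P' $$ (l, j))"
      by (rule index_mult_mat_sum[OF Nc[OF a] P' i j])
    have "(P' * action (Defs.direct_sum (?K # Ms)) a) $$ (i, j) = (\<Sum>l<?d + ?c. P' $$ (i, l) * action (Defs.direct_sum (?K # Ms)) a $$ (l, j))"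
      by (rule index_mult_mat_sum[OF P' D i j])
    also have "\<dots> = (\<Sum>l<?d. Q $$ (i, l) * (if j < ?d then action ?K a $$ (l, j) else 0)) +
        (\<Sum>l<?c. P $$ (i, l) * (if j < ?d then 0 else action (Defs.direct_sum Ms) a $$ (l, j - ?d)))"
      unfolding sum_lessThan_add
      by (intro arg_cong2[of _ _ _ _ "(+)"] sum.cong refl) (subst direct_sum_Cons[OF allM a]; simp add: j P'_def i)+
    also have "\<dots> = (action N a * P') $$ (i, j)"
    proof (cases "j < ?d")
      case True
      then show ?thesis unfolding L using Qcomm[OF a i True] by (simp add: P'_def)
    next
      case False
      then have jc: "j - ?d < ?c" using j by simp
      have "(action N a * P) $$ (i, j - ?d) = (P * action (Defs.direct_sum Ms) a) $$ (i, j - ?d)" using comm[OF a] by simp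
      then have "(\<Sum>l<?n. action N a $$ (i, l) * P $$ (l, j - ?d)) = (\<Sum>l<?c. P $$ (i, l) * action (Defs.direct_sum Ms) a $$ (l, j - ?d))"
        unfolding index_mult_mat_sum[OF Nc[OF a] P i jc] index_mult_mat_sum[OF P Dc[OF a] i jc] .
      then show ?thesis unfolding L using False j by (simp add: P'_def)
    qed
    finally show "(action N a * P') $$ (i, j) = (P' * action (Defs.direct_sum (?K # Ms)) a) $$ (i, j)" by simp
  qed
  moreover have "v = 0\<^sub>v (?d + ?c)" if v: "v \<in> carrier_vec (?d + ?c)" "P' *\<^sub>v v = 0\<^sub>v ?n" for v
  proof -
    define x where "x = vec ?d (\<lambda>j. v $ j)"
    define y where "y = vec ?c (\<lambda>j. v $ (?d + j))"
    have xy: "x \<in> carrier_vec ?d" "y \<in> carrier_vec ?c" by (auto simp: x_def y_def)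
    \<comment> \<open>A kernel vector of \<open>P'\<close> equates a vector of the new summand with
      one of \<open>R\<close>, so its first part lies in \<open>W\<close>.\<close>
    have e: "Q *\<^sub>v x = P *\<^sub>v ((-1) \<cdot>\<^sub>v y)"
    proof (rule eq_vecI)
      fix i assume "i < dim_vec (P *\<^sub>v ((-1) \<cdot>\<^sub>v y))"
      then have i: "i < ?n" using P by simp
      have "0 = (P' *\<^sub>v v) $ i" using v(2) i by simp
      also have "\<dots> = (\<Sum>l<?d + ?c. P' $$ (i, l) * v $ l)" by (rule index_mult_mat_vec_sum[OF P' v(1) i])
      also have "\<dots> = (\<Sum>l<?d. Q $$ (i, l) * x $ l) + (\<Sum>l<?c. P $$ (i, l) * y $ l)"
        unfolding sum_lessThan_add
        by (intro arg_cong2[of _ _ _ _ "(+)"] sum.cong refl) (simp_all add: P'_def i x_def y_def)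
      finally have "(\<Sum>l<?d. Q $$ (i, l) * x $ l) = (\<Sum>l<?c. P $$ (i, l) * - y $ l)"
        by (simp add: sum_negf eq_neg_iff_add_eq_0)
      also have "\<dots> = (\<Sum>l<?c. P $$ (i, l) * ((-1) \<cdot>\<^sub>v y) $ l)" using xy by (intro sum.cong refl) auto
      finally show "(Q *\<^sub>v x) $ i = (P *\<^sub>v ((-1) \<cdot>\<^sub>v y)) $ i"
        using xy by (simp add: index_mult_mat_vec_sum[OF Q xy(1) i] index_mult_mat_vec_sum[OF P _ i] del: index_mult_mat_vec)
    qed (use Q P in auto)
    then have "Q *\<^sub>v x \<in> R" unfolding R_def using xy(2) by auto
    then have "x \<in> W" using xy by (simp add: W_def)
    then have x0: "x = 0\<^sub>v ?d" using W0 by simp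
    have "Q *\<^sub>v 0\<^sub>v ?d = 0\<^sub>v ?n" using Q by auto
    then have "P *\<^sub>v ((-1) \<cdot>\<^sub>v y) = 0\<^sub>v ?n" using e x0 by metis
    then have y0: "(-1) \<cdot>\<^sub>v y = 0\<^sub>v ?c" using inj xy(2) by auto
    show ?thesis
    proof (rule eq_vecI)
      fix i assume "i < dim_vec (0\<^sub>v (?d + ?c) :: complex vec)"
      then have i: "i < ?d + ?c" by simp
      show "v $ i = 0\<^sub>v (?d + ?c) $ i"
      proof (cases "i < ?d")
        case True
        then show ?thesis using arg_cong[OF x0, of "\<lambda>x. x $ i"] i by (simp add: x_def)
      next
        case False
        then have "?d + (i - ?d) = i" "i - ?d < ?c" using i by auto
        then show ?thesis using arg_cong[OF y0, of "\<lambda>x. x $ (i - ?d)"] i by (simp add: y_def)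
      qed
    qed (use v in auto)
  qed
  ultimately show ?thesis using K(1) P' dc by (intro exI[of _ ?K] exI[of _ P']) auto
qed

text \<open>Among the embeddings of direct sums of simple modules into \<open>N\<close> take one of
  largest dimension, which \<open>mod_dim N\<close> bounds. If it missed a vector,
  \<open>extend_embedding\<close> would enlarge it, so it is bijective.\<close>

lemma decomposition:
  assumes N: "is_module A N"
  shows "\<exists>Ms. (\<forall>M\<in>set Ms. simple_module A M) \<and> mod_iso A N (Defs.direct_sum Ms)"
proof -
  define emb where "emb = (\<lambda>(Ms, P). (\<forall>M\<in>set Ms. simple_module A M) \<and>
    P \<in> carrier_mat (mod_dim N) (mod_dim (Defs.direct_sum Ms)) \<and>
    (\<forall>a\<in>A. action N a * P = P * action (Defs.direct_sum Ms) a) \<and>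
    (\<forall>v\<in>carrier_vec (mod_dim (Defs.direct_sum Ms)). P *\<^sub>v v = 0\<^sub>v (mod_dim N) \<longrightarrow> v = 0\<^sub>v (mod_dim (Defs.direct_sum Ms))))"
  let ?f = "\<lambda>(Ms, P :: complex mat). mod_dim (Defs.direct_sum Ms)"
  have bnd: "?f x < Suc (mod_dim N)" if "emb x" for x
  proof -
    obtain Ms P where x: "x = (Ms, P)" by (cases x)
    have "mod_dim (Defs.direct_sum Ms) \<le> mod_dim N"
      by (rule injective_mat_le[of P]) (use that in \<open>auto simp: emb_def x\<close>)
    then show ?thesis by (simp add: x)
  qed
  \<comment> \<open>The empty direct sum, embedded by a matrix without columns, starts the
    maximisation.\<close>
  have "emb ([], 0\<^sub>m (mod_dim N) 0)"
  proof -
    have "action N a * 0\<^sub>m (mod_dim N) 0 = 0\<^sub>m (mod_dim N) 0 * action (Defs.direct_sum []) a" if "a \<in> A" for a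
      using is_module_carrier[OF N that] by (intro eq_matI) (auto simp: Defs.direct_sum_def)
    then show ?thesis by (auto simp: emb_def mod_dim_direct_sum)
  qed
  then obtain x where x: "emb x" and max: "\<And>y. emb y \<Longrightarrow> ?f y \<le> ?f x"
    using ex_has_greatest_nat[of emb "([], 0\<^sub>m (mod_dim N) 0)" ?f "Suc (mod_dim N)"] bnd by blast
  obtain Ms P where xP: "x = (Ms, P)" by (cases x)
  let ?c = "mod_dim (Defs.direct_sum Ms)" and ?n = "mod_dim N"
  have Ms: "\<And>M. M \<in> set Ms \<Longrightarrow> simple_module A M" and P: "P \<in> carrier_mat ?n ?c"
    and comm: "\<And>a. a \<in> A \<Longrightarrow> action N a * P = P * action (Defs.direct_sum Ms) a"
    and inj: "\<And>v. v \<in> carrier_vec ?c \<Longrightarrow> P *\<^sub>v v = 0\<^sub>v ?n \<Longrightarrow> v = 0\<^sub>v ?c"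
    using x by (auto simp: emb_def xP)
  have surj: "\<exists>v\<in>carrier_vec ?c. P *\<^sub>v v = w" if w: "w \<in> carrier_vec ?n" for w
  proof (rule ccontr)
    assume neg: "\<not> ?thesis"
    have w2: "P *\<^sub>v v \<noteq> w" if "v \<in> carrier_vec ?c" for v using neg that by blast
    have "\<exists>K P'. simple_module A K \<and> P' \<in> carrier_mat ?n (mod_dim (Defs.direct_sum (K # Ms))) \<and>
      (\<forall>a\<in>A. action N a * P' = P' * action (Defs.direct_sum (K # Ms)) a) \<and>
      (\<forall>v\<in>carrier_vec (mod_dim (Defs.direct_sum (K # Ms))). P' *\<^sub>v v = 0\<^sub>v ?n \<longrightarrow> v = 0\<^sub>v (mod_dim (Defs.direct_sum (K # Ms))))"
      by (rule extend_embedding[OF N Ms P comm inj w w2])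
    then obtain K P' where K: "simple_module A K" and P': "P' \<in> carrier_mat ?n (mod_dim (Defs.direct_sum (K # Ms)))"
      "\<forall>a\<in>A. action N a * P' = P' * action (Defs.direct_sum (K # Ms)) a"
      "\<forall>v\<in>carrier_vec (mod_dim (Defs.direct_sum (K # Ms))). P' *\<^sub>v v = 0\<^sub>v ?n \<longrightarrow> v = 0\<^sub>v (mod_dim (Defs.direct_sum (K # Ms)))"
      by (elim exE conjE)
    have "\<forall>M\<in>set (K # Ms). simple_module A M" using K Ms by (metis set_ConsD)
    then have "emb (K # Ms, P')" unfolding emb_def prod.case using P' by (intro conjI)
    from max[OF this] have "?f (K # Ms, P') \<le> ?f x" .
    then show False using simple_dim[OF K] by (simp add: xP mod_dim_direct_sum)
  qed
  obtain Q where nc: "?n = ?c" and Q: "Q \<in> carrier_mat ?c ?n" "P * Q = 1\<^sub>m ?n" "Q * P = 1\<^sub>m ?c"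
    using bijective_mat[OF P inj surj] by blast
  have "Q * action N a = action (Defs.direct_sum Ms) a * Q" if a: "a \<in> A" for a
  proof -
    have Na: "action N a \<in> carrier_mat ?n ?n" using is_module_carrier[OF N a] .
    have D: "action (Defs.direct_sum Ms) a \<in> carrier_mat ?c ?c"
      by (rule direct_sum_carrier[OF _ a]) (use Ms simple_is_module in blast)
    have "Q * action N a = Q * (action N a * (P * Q))" using Na Q by simp
    also have "\<dots> = Q * (action N a * P * Q)" using assoc_mult_mat[OF Na P Q(1)] by simp
    also have "\<dots> = Q * (P * (action (Defs.direct_sum Ms) a * Q))" using comm[OF a] assoc_mult_mat[OF P D Q(1)] by simp
    also have "\<dots> = Q * P * (action (Defs.direct_sum Ms) a * Q)"
      by (rule assoc_mult_mat[OF Q(1) P, symmetric]) (use D Q in auto)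
    also have "\<dots> = action (Defs.direct_sum Ms) a * Q" using D Q by simp
    finally show ?thesis .
  qed
  then have "mod_iso A N (Defs.direct_sum Ms)" using Q P nc by (intro mod_isoI[of _ _ Q P]) auto
  then show ?thesis using Ms by blast
qed

end

subsection \<open>Multiplicities\<close>

context semisimple_algebra
begin

text \<open>Factor the matrix unit through index 0, as the product of those at \<open>p 0\<close>
  and \<open>0 q\<close>, and exchange the factors.\<close>

lemma tracial_mat_unit:
  assumes add: "\<And>x y. x \<in> A \<Longrightarrow> y \<in> A \<Longrightarrow> f (x + y) = f x + f y"
    and scale: "\<And>c x. x \<in> A \<Longrightarrow> f (c *\<^sub>C x) = c * f x"
    and comm: "\<And>x y. x \<in> A \<Longrightarrow> y \<in> A \<Longrightarrow> f (x * y) = f (y * x)"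
    and k: "\<kappa> \<in> Cl" "p < dm \<kappa>" "q < dm \<kappa>"
  shows "f (mat_unit \<kappa> p q) = (if p = q then f (mat_unit \<kappa> 0 0) else (0 :: complex))"
proof -
  have d0: "0 < dm \<kappa>" by (rule dm_pos[OF k(1)])
  have f0: "f 0 = 0" using scale[OF subalgebra_one[OF sub], of 0] by simp
  have "f (mat_unit \<kappa> p q) = f (mat_unit \<kappa> p 0 * mat_unit \<kappa> 0 q)" by (simp add: mat_unit_mult k d0)
  also have "\<dots> = f (mat_unit \<kappa> 0 q * mat_unit \<kappa> p 0)" by (rule comm[OF mat_unit_in mat_unit_in])
  also have "\<dots> = (if p = q then f (mat_unit \<kappa> 0 0) else 0)" using k d0 by (simp add: mat_unit_mult f0)
  finally show ?thesis .
qed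

lemma tracial_sum:
  assumes add: "\<And>x y. x \<in> A \<Longrightarrow> y \<in> A \<Longrightarrow> f (x + y) = f x + f y"
    and scale: "\<And>c x. x \<in> A \<Longrightarrow> f (c *\<^sub>C x) = c * f x"
    and S: "\<And>x. x \<in> S \<Longrightarrow> g x \<in> A"
  shows "f (sum g S) = (\<Sum>x\<in>S. f (g x) :: complex)"
proof -
  have f0: "f 0 = 0" using scale[OF subalgebra_one[OF sub], of 0] by simp
  show ?thesis
  proof (cases "finite S")
    case True
    then show ?thesis using S
    proof (induction S rule: finite_induct)
      case (insert x F)
      have "sum g F \<in> A" using insert.prems by (intro subalgebra_sum[OF sub]) auto
      then show ?case using insert by (simp add: add)
    qed (simp add: f0)
  qed (simp add: f0)
qed

text \<open>A trace is determined by one number per block. The functional is only required to be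
  tracial on \<open>A\<close>, which covers characters of modules as well as traces of the inductive
  limit.\<close>

lemma tracial_expand:
  assumes add: "\<And>x y. x \<in> A \<Longrightarrow> y \<in> A \<Longrightarrow> f (x + y) = f x + f y"
    and scale: "\<And>c x. x \<in> A \<Longrightarrow> f (c *\<^sub>C x) = c * f x"
    and comm: "\<And>x y. x \<in> A \<Longrightarrow> y \<in> A \<Longrightarrow> f (x * y) = f (y * x)"
    and a: "a \<in> A"
  shows "f a = (\<Sum>\<kappa>\<in>Cl. f (mat_unit \<kappa> 0 0) * character (rep A \<kappa>) a)"
proof -
  have tm: "f (mat_unit \<kappa> p q) = (if p = q then f (mat_unit \<kappa> 0 0) else 0)"
    if "\<kappa> \<in> Cl" "p < dm \<kappa>" "q < dm \<kappa>" for \<kappa> p q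
    by (rule tracial_mat_unit[of f, OF add scale comm that])
  have sA: "en \<kappa> a p q *\<^sub>C mat_unit \<kappa> p q \<in> A" for \<kappa> p q by (intro subalgebra_scale[OF sub] mat_unit_in)
  have sA2: "(\<Sum>q<dm \<kappa>. en \<kappa> a p q *\<^sub>C mat_unit \<kappa> p q) \<in> A" for \<kappa> p by (rule subalgebra_sum[OF sub sA])
  have sA3: "(\<Sum>p<dm \<kappa>. \<Sum>q<dm \<kappa>. en \<kappa> a p q *\<^sub>C mat_unit \<kappa> p q) \<in> A" for \<kappa> by (rule subalgebra_sum[OF sub sA2])
  have "f a = f (\<Sum>\<kappa>\<in>Cl. \<Sum>p<dm \<kappa>. \<Sum>q<dm \<kappa>. en \<kappa> a p q *\<^sub>C mat_unit \<kappa> p q)"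
    using expand_mat_unit[OF a] by simp
  also have "\<dots> = (\<Sum>\<kappa>\<in>Cl. \<Sum>p<dm \<kappa>. \<Sum>q<dm \<kappa>. f (en \<kappa> a p q *\<^sub>C mat_unit \<kappa> p q))"
  proof -
    have t3: "f (\<Sum>\<kappa>\<in>Cl. \<Sum>p<dm \<kappa>. \<Sum>q<dm \<kappa>. en \<kappa> a p q *\<^sub>C mat_unit \<kappa> p q) =
        (\<Sum>\<kappa>\<in>Cl. f (\<Sum>p<dm \<kappa>. \<Sum>q<dm \<kappa>. en \<kappa> a p q *\<^sub>C mat_unit \<kappa> p q))"
      by (rule tracial_sum[of f, OF add scale sA3])
    have t2: "f (\<Sum>p<dm \<kappa>. \<Sum>q<dm \<kappa>. en \<kappa> a p q *\<^sub>C mat_unit \<kappa> p q) =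
        (\<Sum>p<dm \<kappa>. f (\<Sum>q<dm \<kappa>. en \<kappa> a p q *\<^sub>C mat_unit \<kappa> p q))" for \<kappa>
      by (rule tracial_sum[of f, OF add scale sA2])
    have t1: "f (\<Sum>q<dm \<kappa>. en \<kappa> a p q *\<^sub>C mat_unit \<kappa> p q) =
        (\<Sum>q<dm \<kappa>. f (en \<kappa> a p q *\<^sub>C mat_unit \<kappa> p q))" for \<kappa> p
      by (rule tracial_sum[of f, OF add scale sA])
    show ?thesis unfolding t3 t2 t1 ..
  qed
  also have "\<dots> = (\<Sum>\<kappa>\<in>Cl. \<Sum>p<dm \<kappa>. \<Sum>q<dm \<kappa>. if q = p then f (mat_unit \<kappa> 0 0) * en \<kappa> a p p else 0)"
  proof (intro sum.cong refl)
    fix \<kappa> p q assume k: "\<kappa> \<in> Cl" "p \<in> {..<dm \<kappa>}" "q \<in> {..<dm \<kappa>}"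
    have "f (en \<kappa> a p q *\<^sub>C mat_unit \<kappa> p q) = en \<kappa> a p q * f (mat_unit \<kappa> p q)" by (rule scale[OF mat_unit_in])
    also have "f (mat_unit \<kappa> p q) = (if p = q then f (mat_unit \<kappa> 0 0) else 0)" using k by (intro tm) auto
    finally show "f (en \<kappa> a p q *\<^sub>C mat_unit \<kappa> p q) = (if q = p then f (mat_unit \<kappa> 0 0) * en \<kappa> a p p else 0)"
      by (simp split: if_splits)
  qed
  also have "\<dots> = (\<Sum>\<kappa>\<in>Cl. \<Sum>p<dm \<kappa>. f (mat_unit \<kappa> 0 0) * en \<kappa> a p p)"
    by (intro sum.cong refl) auto
  also have "\<dots> = (\<Sum>\<kappa>\<in>Cl. f (mat_unit \<kappa> 0 0) * character (rep A \<kappa>) a)"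
    by (simp add: character_def sum_distrib_left)
  finally show ?thesis .
qed

lemma character_expand:
  assumes N: "is_module A N" and a: "a \<in> A"
  shows "character N a = (\<Sum>\<kappa>\<in>Cl. character N (mat_unit \<kappa> 0 0) * character (rep A \<kappa>) a)"
  by (rule tracial_expand[of "character N", OF _ _ _ a])
     (auto simp: character_add[OF N] character_scale[OF N] intro!: character_mult_comm[OF N] subalgebra_mult[OF sub])

lemma character_rep_mat_unit:
  assumes "\<kappa> \<in> Cl" "\<kappa>' \<in> Cl"
  shows "character (rep A \<kappa>') (mat_unit \<kappa> 0 0) = (if \<kappa>' = \<kappa> then 1 else 0)"
proof -
  have "character (rep A \<kappa>') (mat_unit \<kappa> 0 0) = (\<Sum>i<dm \<kappa>'. if i = 0 then (if \<kappa>' = \<kappa> then 1 else 0) else 0)"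
    unfolding character_def by (intro sum.cong refl) (auto simp: ent_mat_unit assms)
  then show ?thesis using dm_pos[OF assms(2)] by simp
qed

lemma character_class:
  assumes k: "\<kappa> \<in> Cl" and M: "M \<in> \<kappa>" and a: "a \<in> A"
  shows "character M a = character (rep A \<kappa>) a"
  by (rule mod_iso_character[OF in_class_iso[OF k M] rep_module[OF k] in_class_module[OF k M] a])

lemma dim_class: "\<kappa> \<in> Cl \<Longrightarrow> M \<in> \<kappa> \<Longrightarrow> mod_dim M = dm \<kappa>"
  using mod_iso_dim[OF in_class_iso] by blast

lemma character_simple_mat_unit:
  assumes k: "\<kappa> \<in> Cl" and M: "simple_module A M"
  shows "character M (mat_unit \<kappa> 0 0) = (if M \<in> \<kappa> then 1 else 0)"
proof -
  obtain \<kappa>' where k': "\<kappa>' \<in> Cl" "M \<in> \<kappa>'" using simple_class_exists[OF M] by (elim bexE)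
  have "M \<in> \<kappa> \<longleftrightarrow> \<kappa>' = \<kappa>" using class_eqI[OF k'(1) k k'(2)] k'(2) by auto
  then show ?thesis using character_class[OF k' mat_unit_in] character_rep_mat_unit[OF k k'(1)] by simp
qed

text \<open>For every decomposition, the character at the minimal idempotent counts the summands in
  \<kappa>. The count is therefore independent of the decomposition, as the definite description
  requires, and \<open>decomposition\<close> supplies one.\<close>

lemma multiplicity_in_eq:
  assumes k: "\<kappa> \<in> Cl" and N: "is_module A N"
  shows "of_nat (multiplicity_in A \<kappa> N) = character N (mat_unit \<kappa> 0 0)"
proof -
  have cnt: "character N (mat_unit \<kappa> 0 0) = of_nat (length (filter (\<lambda>M. M \<in> \<kappa>) Ms))"
    if Ms: "\<forall>M\<in>set Ms. simple_module A M" and iso: "mod_iso A N (Defs.direct_sum Ms)" for Ms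
  proof -
    have MsM: "is_module A M" if "M \<in> set Ms" for M using Ms that simple_is_module by blast
    have "character (Defs.direct_sum Ms) (mat_unit \<kappa> 0 0) = character N (mat_unit \<kappa> 0 0)"
      by (rule mod_iso_trace[OF iso mat_unit_in is_module_carrier[OF N mat_unit_in]
            direct_sum_carrier[OF MsM mat_unit_in]])
    moreover have "character (Defs.direct_sum Ms) (mat_unit \<kappa> 0 0) = (\<Sum>M\<leftarrow>Ms. character M (mat_unit \<kappa> 0 0))"
      by (rule character_direct_sum[OF MsM mat_unit_in])
    moreover have "(\<Sum>M\<leftarrow>Ms. character M (mat_unit \<kappa> 0 0)) = of_nat (length (filter (\<lambda>M. M \<in> \<kappa>) Ms))"
      using Ms
    proof (induction Ms)
      case (Cons M Ms)
      have "character M (mat_unit \<kappa> 0 0) = (if M \<in> \<kappa> then 1 else 0)"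
        by (rule character_simple_mat_unit[OF k]) (use Cons.prems in simp)
      then show ?case using Cons by simp
    qed simp
    ultimately show ?thesis by simp
  qed
  obtain Ms where Ms: "\<forall>M\<in>set Ms. simple_module A M" "mod_iso A N (Defs.direct_sum Ms)"
    using decomposition[OF N] by (elim exE conjE)
  have "multiplicity_in A \<kappa> N = length (filter (\<lambda>M. M \<in> \<kappa>) Ms)"
    unfolding multiplicity_in_def
  proof (rule the_equality)
    show "\<exists>Ms'. (\<forall>M\<in>set Ms'. simple_module A M) \<and> mod_iso A N (Defs.direct_sum Ms') \<and>
      length (filter (\<lambda>M. M \<in> \<kappa>) Ms) = length (filter (\<lambda>M. M \<in> \<kappa>) Ms')"
      by (rule exI[of _ Ms]) (use Ms in simp)
    fix m assume "\<exists>Ms. (\<forall>M\<in>set Ms. simple_module A M) \<and> mod_iso A N (Defs.direct_sum Ms) \<and>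
      m = length (filter (\<lambda>M. M \<in> \<kappa>) Ms)"
    then obtain Ms' where Ms': "\<forall>M\<in>set Ms'. simple_module A M" "mod_iso A N (Defs.direct_sum Ms')"
      "m = length (filter (\<lambda>M. M \<in> \<kappa>) Ms')" by (elim exE conjE)
    have "(of_nat m :: complex) = of_nat (length (filter (\<lambda>M. M \<in> \<kappa>) Ms))"
      using cnt[OF Ms'(1,2)] cnt[OF Ms] Ms'(3) by simp
    then show "m = length (filter (\<lambda>M. M \<in> \<kappa>) Ms)" by simp
  qed
  then show ?thesis using cnt[OF Ms] by simp
qed

end

section \<open>Edge multiplicities as character values\<close>

lemma semisimple_familyD:
  assumes "semisimple_family A"
  shows "semisimple_algebra (A l)" "A l \<subseteq> A (Suc l)"
  using assms by (auto simp: semisimple_family_def semisimple_algebra_def)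

lemma level_branching_graph: "level (branching_graph A) l = simple_classes (A l)"
  by (simp add: branching_graph_def)

text \<open>Isomorphic modules have equal characters, so all members of \<nu> give the same
  multiplicity and the definite description in the graph denotes it. The minimal idempotent of level
  \<open>l\<close> is viewed inside \<open>A (Suc l)\<close>.\<close>

lemma mult_branching_graph:
  assumes fam: "semisimple_family A" and k: "\<kappa> \<in> simple_classes (A l)" and n: "\<nu> \<in> simple_classes (A (Suc l))"
  shows "of_nat (mult_edges (branching_graph A) l \<kappa> \<nu>) =
    character (rep (A (Suc l)) \<nu>) (semisimple_algebra.mat_unit (A l) \<kappa> 0 0)"
proof -
  interpret A: semisimple_algebra "A l" by (rule semisimple_familyD[OF fam])
  interpret A': semisimple_algebra "A (Suc l)" by (rule semisimple_familyD[OF fam])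
  have sub: "A l \<subseteq> A (Suc l)" by (rule semisimple_familyD[OF fam])
  have m: "of_nat (multiplicity_in (A l) \<kappa> N) = character (rep (A (Suc l)) \<nu>) (A.mat_unit \<kappa> 0 0)" if N: "N \<in> \<nu>" for N
  proof -
    have "is_module (A l) N" by (rule is_module_subset[OF in_class_module[OF n N] sub])
    from A.multiplicity_in_eq[OF k this] show ?thesis
      using A'.character_class[OF n N subsetD[OF sub A.mat_unit_in]] by simp
  qed
  have "mult_edges (branching_graph A) l \<kappa> \<nu> = multiplicity_in (A l) \<kappa> (rep (A (Suc l)) \<nu>)"
    unfolding branching_graph_def graded_graph.select_convs
  proof (rule the_equality)
    show "\<exists>N\<in>\<nu>. multiplicity_in (A l) \<kappa> (rep (A (Suc l)) \<nu>) = multiplicity_in (A l) \<kappa> N"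
      by (rule bexI[OF refl rep_in_class[OF n]])
    fix k assume "\<exists>N\<in>\<nu>. k = multiplicity_in (A l) \<kappa> N"
    then obtain N where N: "N \<in> \<nu>" "k = multiplicity_in (A l) \<kappa> N" by (elim bexE)
    have "(of_nat k :: complex) = of_nat (multiplicity_in (A l) \<kappa> (rep (A (Suc l)) \<nu>))"
      using m[OF N(1)] m[OF rep_in_class[OF n]] N(2) by simp
    then show "k = multiplicity_in (A l) \<kappa> (rep (A (Suc l)) \<nu>)" by simp
  qed
  then show ?thesis using m[OF rep_in_class[OF n]] by simp
qed

lemma character_restrict:
  assumes fam: "semisimple_family A" and n: "\<nu> \<in> simple_classes (A (Suc l))" and a: "a \<in> A l"
  shows "character (rep (A (Suc l)) \<nu>) a =
    (\<Sum>\<kappa>\<in>simple_classes (A l). of_nat (mult_edges (branching_graph A) l \<kappa> \<nu>) * character (rep (A l) \<kappa>) a)"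
proof -
  interpret A: semisimple_algebra "A l" by (rule semisimple_familyD[OF fam])
  have "is_module (A l) (rep (A (Suc l)) \<nu>)"
    by (rule is_module_subset[OF rep_module[OF n] semisimple_familyD(2)[OF fam]])
  from A.character_expand[OF this a] show ?thesis by (simp add: mult_branching_graph[OF fam _ n])
qed

text \<open>\<open>character_restrict\<close> at 1, where characters are dimensions.\<close>

lemma dim_restrict:
  assumes fam: "semisimple_family A" and n: "\<nu> \<in> simple_classes (A (Suc l))"
  shows "(\<Sum>\<kappa>\<in>simple_classes (A l). mult_edges (branching_graph A) l \<kappa> \<nu> * mod_dim (rep (A l) \<kappa>)) =
    mod_dim (rep (A (Suc l)) \<nu>)"
proof -
  interpret A: semisimple_algebra "A l" by (rule semisimple_familyD[OF fam])
  have "(of_nat (mod_dim (rep (A (Suc l)) \<nu>)) :: complex) =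
    of_nat (\<Sum>\<kappa>\<in>simple_classes (A l). mult_edges (branching_graph A) l \<kappa> \<nu> * mod_dim (rep (A l) \<kappa>))"
    using character_restrict[OF fam n subalgebra_one[OF A.sub]]
    by (simp add: character_one[OF rep_module[OF n]] character_one[OF rep_module])
  then show ?thesis unfolding of_nat_eq_iff by simp
qed

subsection \<open>Dimension of induced modules\<close>

text \<open>
  The dimension of the image of an idempotent is its trace, computed from a spanning family \<open>x\<close> with
  coordinate functionals \<open>c\<close>.
\<close>

lemma (in vector_space) dim_idempotent:
  assumes V: "subspace V" and J: "finite J" and x: "\<And>j. j \<in> J \<Longrightarrow> x j \<in> V"
    and c_add: "\<And>j v w. j \<in> J \<Longrightarrow> v \<in> V \<Longrightarrow> w \<in> V \<Longrightarrow> c j (v + w) = c j v + c j w"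
    and c_scale: "\<And>j k v. j \<in> J \<Longrightarrow> v \<in> V \<Longrightarrow> c j (scale k v) = k * c j v"
    and expand: "\<And>v. v \<in> V \<Longrightarrow> v = (\<Sum>j\<in>J. scale (c j v) (x j))"
    and T_V: "\<And>v. v \<in> V \<Longrightarrow> T v \<in> V"
    and T_add: "\<And>v w. v \<in> V \<Longrightarrow> w \<in> V \<Longrightarrow> T (v + w) = T v + T w"
    and T_scale: "\<And>k v. v \<in> V \<Longrightarrow> T (scale k v) = scale k (T v)"
    and idem: "\<And>v. v \<in> V \<Longrightarrow> T (T v) = T v"
  shows "of_nat (dim (T ` V)) = (\<Sum>j\<in>J. c j (T (x j)))"
proof -
  have V0: "0 \<in> V" by (rule subspace_0[OF V])
  have T0: "T 0 = 0" using T_scale[OF V0, of 0] by simp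
  have T_sum: "T (sum g S) = (\<Sum>s\<in>S. T (g s))" if "finite S" "\<And>s. s \<in> S \<Longrightarrow> g s \<in> V" for g :: "'d \<Rightarrow> 'b" and S
    using that
  proof (induction S rule: finite_induct)
    case (insert s S)
    have "sum g S \<in> V" using insert.prems by (intro subspace_sum[OF V]) auto
    then show ?case using insert by (simp add: T_add)
  qed (simp add: T0)
  have c_sum: "c j (sum g S) = (\<Sum>s\<in>S. c j (g s))" if "j \<in> J" "finite S" "\<And>s. s \<in> S \<Longrightarrow> g s \<in> V" for j and g :: "'b \<Rightarrow> 'b" and S
    using that(2,3)
  proof (induction S rule: finite_induct)
    case empty
    show ?case using c_scale[OF that(1) V0, of 0] by simp
  next
    case (insert s S)
    have "sum g S \<in> V" using insert.prems by (intro subspace_sum[OF V]) auto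
    then show ?case using insert c_add[OF that(1)] by simp
  qed
  let ?W = "T ` V"
  have WV: "?W \<subseteq> V" using T_V by blast
  have W: "subspace ?W"
  proof (rule subspaceI)
    show "0 \<in> ?W" using T0 V0 by (metis imageI)
    show "v + w \<in> ?W" if "v \<in> ?W" "w \<in> ?W" for v w
      using that T_add subspace_add[OF V] by (metis (no_types, lifting) image_iff)
    show "scale k v \<in> ?W" if "v \<in> ?W" for k v
      using that T_scale subspace_scale[OF V] by (metis (no_types, lifting) image_iff)
  qed
  obtain B where B: "B \<subseteq> ?W" "independent B" "?W \<subseteq> span B" "card B = dim ?W"
    using basis_exists by blast
  have "V \<subseteq> span (x ` J)"
  proof
    fix v assume v: "v \<in> V"
    have "(\<Sum>j\<in>J. scale (c j v) (x j)) \<in> span (x ` J)" by (intro span_sum span_scale span_base) simp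
    then show "v \<in> span (x ` J)" using expand[OF v] by simp
  qed
  then have fB: "finite B" using independent_span_bound[of "x ` J" B] B(1,2) WV J by auto
  have sB: "span B = ?W" by (rule span_subspace[OF B(1,3) W])
  define r where "r = representation B"
  have bV: "b \<in> V" if "b \<in> B" for b using that B(1) WV by blast
  have Tb: "T b = b" if b: "b \<in> B" for b
  proof -
    obtain v where "v \<in> V" "b = T v" using b B(1) by blast
    then show ?thesis using idem by simp
  qed
  \<comment> \<open>The coefficient of \<open>b\<close> in \<open>b = T b\<close>, after expanding
    \<open>b\<close> in the family \<open>x\<close>. Coordinates with respect to \<open>B\<close>
    are available because each \<open>T (x j)\<close> lies in the image.\<close>
  have one: "1 = (\<Sum>j\<in>J. c j b * r (T (x j)) b)" if b: "b \<in> B" for b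
  proof -
    have inW: "scale (c j b) (T (x j)) \<in> span B" if "j \<in> J" for j
      unfolding sB using x[OF that] by (intro subspace_scale[OF W]) simp
    have "b = T (\<Sum>j\<in>J. scale (c j b) (x j))" using Tb[OF b] expand[OF bV[OF b]] by simp
    also have "\<dots> = (\<Sum>j\<in>J. T (scale (c j b) (x j)))"
      using x by (intro T_sum[OF J] subspace_scale[OF V])
    also have "\<dots> = (\<Sum>j\<in>J. scale (c j b) (T (x j)))" by (intro sum.cong refl T_scale x)
    finally have "r b b = r (\<Sum>j\<in>J. scale (c j b) (T (x j))) b" by simp
    also have "\<dots> = (\<Sum>j\<in>J. r (scale (c j b) (T (x j))) b)"
      unfolding r_def using representation_sum[OF B(2), of J "\<lambda>j. scale (c j b) (T (x j))"] inW by simp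
    also have "\<dots> = (\<Sum>j\<in>J. c j b * r (T (x j)) b)"
    proof (intro sum.cong refl)
      fix j assume "j \<in> J"
      then have "T (x j) \<in> span B" unfolding sB using x by blast
      then show "r (scale (c j b) (T (x j))) b = c j b * r (T (x j)) b"
        unfolding r_def by (simp add: representation_scale[OF B(2)])
    qed
    finally show ?thesis using representation_basis[OF B(2) b] by (simp add: r_def)
  qed
  \<comment> \<open>Adding up these ones counts the basis; exchanging the sums and expanding
    \<open>T (x j)\<close> in \<open>B\<close> turns the count into the trace.\<close>
  have "of_nat (dim ?W) = (\<Sum>b\<in>B. \<Sum>j\<in>J. c j b * r (T (x j)) b)" using one B(4) by simp
  also have "\<dots> = (\<Sum>j\<in>J. \<Sum>b\<in>B. c j b * r (T (x j)) b)" by (rule sum.swap)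
  also have "\<dots> = (\<Sum>j\<in>J. c j (T (x j)))"
  proof (intro sum.cong refl)
    fix j assume j: "j \<in> J"
    have e: "T (x j) = (\<Sum>b\<in>B. scale (r (T (x j)) b) b)"
      unfolding r_def by (rule sum_representation_eq[OF B(2) _ fB, symmetric]) (use x[OF j] sB in auto)
    have "c j (T (x j)) = c j (\<Sum>b\<in>B. scale (r (T (x j)) b) b)" using e by simp
    also have "\<dots> = (\<Sum>b\<in>B. c j (scale (r (T (x j)) b) b))"
      using bV by (intro c_sum[OF j fB] subspace_scale[OF V])
    also have "\<dots> = (\<Sum>b\<in>B. c j b * r (T (x j)) b)"
      by (intro sum.cong refl) (simp add: c_scale[OF j bV] mult.commute)
    finally show "(\<Sum>b\<in>B. c j b * r (T (x j)) b) = c j (T (x j))" by simp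
  qed
  finally show ?thesis .
qed

context
  fixes A A' :: "'a::complex_algebra_1 set"
  assumes A: "semisimple_algebra A" and A': "semisimple_algebra A'" and AA': "A \<subseteq> A'"
begin

interpretation A: semisimple_algebra A by (rule A)
interpretation A': semisimple_algebra A' by (rule A')

text \<open>
  With \<open>E\<^sub>i\<^sub>0\<close> the first column of matrix units of the block of \<open>\<kappa>\<close>, the map \<open>(b\<^sub>i) \<mapsto> (\<Sum>\<^sub>i b\<^sub>i E\<^sub>i\<^sub>0) \<otimes> e\<^sub>0\<close> is an
  idempotent of the tensor product with kernel the balancing space; its trace is the number of
  occurrences of \<open>\<kappa>\<close> in the left regular \<open>A'\<close>-module, and gives Frobenius reciprocity.
\<close>

lemma induced_dim_eq:
  assumes k: "\<kappa> \<in> simple_classes A"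
  shows "of_nat (induced_dim A A' (rep A \<kappa>)) =
    (\<Sum>\<nu>\<in>simple_classes A'. of_nat (mod_dim (rep A' \<nu>)) * character (rep A' \<nu>) (A.mat_unit \<kappa> 0 0))"
proof -
  let ?d = "A.dm \<kappa>" and ?M = "rep A \<kappa>"
  have d0: "0 < ?d" by (rule A.dm_pos[OF k])
  have M: "is_module A ?M" by (rule rep_module[OF k])
  define E where "E = (\<lambda>i. A.mat_unit \<kappa> i 0)"
  have EA: "E i \<in> A" for i by (simp add: E_def A.mat_unit_in)
  have EA': "E i \<in> A'" for i using EA AA' by blast
  have aE: "a * E i = (\<Sum>r<?d. ent ?M a r i *\<^sub>C E r)" if "a \<in> A" "i < ?d" for a i
    unfolding E_def by (rule A.mult_mat_unit[OF that(1) k that(2) d0])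
  have EE: "E i * E 0 = E i" if "i < ?d" for i
    unfolding E_def using A.mat_unit_mult[OF k that d0 d0 d0] by simp
  \<comment> \<open>A description of the tensor space without spans: tuples over \<open>A'\<close>
    of length \<open>?d\<close>, padded by 0.\<close>
  define V where "V = {t :: nat \<Rightarrow> 'a. (\<forall>i<?d. t i \<in> A') \<and> (\<forall>i\<ge>?d. t i = 0)}"
  have V: "cfun.subspace V"
    by (rule cfun.subspaceI)
       (auto simp: V_def scaleC_fun_def subalgebra_zero[OF A'.sub] subalgebra_add[OF A'.sub] subalgebra_scale[OF A'.sub])
  define pt where "pt = (\<lambda>(b :: 'a) (i :: nat) j. if j = i then b else 0)"
  have pt: "pure_tensor b (unit_vec ?d i) = pt b i" if "i < ?d" for b i
    using that by (auto simp: pure_tensor_def pt_def fun_eq_iff scaleC_one)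
  have pureV: "pure_tensor b v \<in> V" if "b \<in> A'" "v \<in> carrier_vec ?d" for b v
    using that by (auto simp: V_def pure_tensor_def subalgebra_scale[OF A'.sub])
  have sum_pt: "t = (\<Sum>i<?d. pt (t i) i)" if t: "t \<in> V" for t
  proof
    fix j
    have "(\<Sum>i<n. pt (t i) i) j = (\<Sum>i<n. pt (t i) i j)" for n
      by (induction n) simp_all
    then have "(\<Sum>i<?d. pt (t i) i) j = (\<Sum>i<?d. pt (t i) i j)" .
    also have "\<dots> = (\<Sum>i<?d. if j = i then t i else 0)" by (simp add: pt_def)
    also have "\<dots> = t j" using t by (auto simp: V_def not_less)
    finally show "t j = (\<Sum>i<?d. pt (t i) i) j" by simp
  qed
  have tensor: "tensor_space A' ?M = V"
    unfolding tensor_space_def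
  proof (rule cfun.span_subspace)
    show "{pure_tensor b v |b v. b \<in> A' \<and> v \<in> carrier_vec ?d} \<subseteq> V" using pureV by blast
    show "V \<subseteq> cfun.span {pure_tensor b v |b v. b \<in> A' \<and> v \<in> carrier_vec ?d}"
    proof
      fix t assume t: "t \<in> V"
      have "pt (t i) i \<in> cfun.span {pure_tensor b v |b v. b \<in> A' \<and> v \<in> carrier_vec ?d}" if i: "i < ?d" for i
      proof (rule cfun.span_base)
        have "t i \<in> A'" using t i by (simp add: V_def)
        then show "pt (t i) i \<in> {pure_tensor b v |b v. b \<in> A' \<and> v \<in> carrier_vec ?d}"
          unfolding pt[OF i, symmetric] using unit_vec_carrier by blast
      qed
      then have "(\<Sum>i<?d. pt (t i) i) \<in> cfun.span {pure_tensor b v |b v. b \<in> A' \<and> v \<in> carrier_vec ?d}"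
        by (intro cfun.span_sum) simp
      then show "t \<in> cfun.span {pure_tensor b v |b v. b \<in> A' \<and> v \<in> carrier_vec ?d}" using sum_pt[OF t] by simp
    qed
  qed (rule V)
  define \<Phi> where "\<Phi> = (\<lambda>t. \<Sum>i<?d. t i * E i)"
  have \<Phi>A: "\<Phi> t \<in> A'" if "t \<in> V" for t
    unfolding \<Phi>_def using that EA' by (intro subalgebra_sum[OF A'.sub] subalgebra_mult[OF A'.sub]) (auto simp: V_def)
  have \<Phi>_add: "\<Phi> (s + t) = \<Phi> s + \<Phi> t" for s t by (simp add: \<Phi>_def distrib_right sum.distrib)
  have \<Phi>_diff: "\<Phi> (s - t) = \<Phi> s - \<Phi> t" for s t by (simp add: \<Phi>_def left_diff_distrib sum_subtractf)
  have \<Phi>_scale: "\<Phi> (scaleC_fun c t) = c *\<^sub>C \<Phi> t" for c t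
    by (simp add: \<Phi>_def scaleC_fun_def mult_scaleC_left cvec.scale_sum_right)
  have \<Phi>_pt: "\<Phi> (pt b i) = b * E i" if "i < ?d" for b i
  proof -
    have "\<Phi> (pt b i) = (\<Sum>j<?d. if j = i then b * E i else 0)"
      unfolding \<Phi>_def pt_def by (intro sum.cong refl) auto
    then show ?thesis using that by simp
  qed
  have \<Phi>E: "\<Phi> t * E 0 = \<Phi> t" for t
    unfolding \<Phi>_def sum_distrib_right by (intro sum.cong refl) (simp add: mult.assoc EE)
  define T where "T = (\<lambda>t. pt (\<Phi> t) 0)"
  have ptV: "pt b i \<in> V" if "b \<in> A'" "i < ?d" for b i
    using that by (auto simp: V_def pt_def subalgebra_zero[OF A'.sub])
  have pt_add: "pt (b + b') i = pt b i + pt b' i" for b b' i by (auto simp: pt_def fun_eq_iff)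
  have pt_scale: "pt (c *\<^sub>C b) i = scaleC_fun c (pt b i)" for c b i by (auto simp: pt_def scaleC_fun_def fun_eq_iff)
  have T_V: "T t \<in> V" if "t \<in> V" for t unfolding T_def by (rule ptV[OF \<Phi>A[OF that] d0])
  have T_add: "T (s + t) = T s + T t" for s t by (simp add: T_def \<Phi>_add pt_add)
  have T_scale: "T (scaleC_fun c t) = scaleC_fun c (T t)" for c t by (simp add: T_def \<Phi>_scale pt_scale)
  have idem: "T (T t) = T t" for t by (simp add: T_def \<Phi>_pt[OF d0] \<Phi>E)
  have T_eq_0: "T t = 0 \<longleftrightarrow> \<Phi> t = 0" for t by (auto simp: T_def pt_def fun_eq_iff)
  let ?G = "{pure_tensor (b * a) v - pure_tensor b (action ?M a *\<^sub>v v) |a b v. a \<in> A \<and> b \<in> A' \<and> v \<in> carrier_vec ?d}"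
  have bal: "balancing_space A A' ?M = {t \<in> V. T t = 0}"
    unfolding balancing_space_def
  proof (rule cfun.span_subspace)
    show "cfun.subspace {t \<in> V. T t = 0}"
    proof (rule cfun.subspaceI)
      show "0 \<in> {t \<in> V. T t = 0}" using cfun.subspace_0[OF V] T_scale[of 0 0] by simp
      show "s + t \<in> {t \<in> V. T t = 0}" if "s \<in> {t \<in> V. T t = 0}" "t \<in> {t \<in> V. T t = 0}" for s t
        using that cfun.subspace_add[OF V] by (simp add: T_add)
      show "scaleC_fun c t \<in> {t \<in> V. T t = 0}" if "t \<in> {t \<in> V. T t = 0}" for c t
        using that cfun.subspace_scale[OF V] by (simp add: T_scale)
    qed
    show "?G \<subseteq> {t \<in> V. T t = 0}"
    proof
      fix g assume "g \<in> ?G"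
      then obtain a b v where g: "g = pure_tensor (b * a) v - pure_tensor b (action ?M a *\<^sub>v v)"
        and a: "a \<in> A" and b: "b \<in> A'" and v: "v \<in> carrier_vec ?d" by (elim CollectE exE conjE)
      have Mc: "action ?M a \<in> carrier_mat ?d ?d" by (rule is_module_carrier[OF M a])
      have av: "action ?M a *\<^sub>v v \<in> carrier_vec ?d" by (rule mult_mat_vec_carrier[OF Mc v])
      have "b * a \<in> A'" using subalgebra_mult[OF A'.sub b] a AA' by blast
      then have gV: "g \<in> V" unfolding g using pureV[OF _ v] pureV[OF b av] cfun.subspace_diff[OF V] by blast
      note dv = carrier_vecD[OF v] and dav = carrier_vecD[OF av]
      have 1: "\<Phi> (pure_tensor (b * a) v) = (\<Sum>i<?d. \<Sum>r<?d. (v $ i * ent ?M a r i) *\<^sub>C (b * E r))"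
      proof -
        have "\<Phi> (pure_tensor (b * a) v) = (\<Sum>i<?d. v $ i *\<^sub>C (b * (a * E i)))"
          unfolding \<Phi>_def pure_tensor_def dv by (intro sum.cong refl) (simp add: mult_scaleC_left mult.assoc)
        also have "\<dots> = (\<Sum>i<?d. \<Sum>r<?d. (v $ i * ent ?M a r i) *\<^sub>C (b * E r))"
          by (intro sum.cong refl) (simp add: aE[OF a] sum_distrib_left mult_scaleC_right cvec.scale_sum_right scaleC_scaleC)
        finally show ?thesis .
      qed
      have "\<Phi> (pure_tensor b (action ?M a *\<^sub>v v)) = (\<Sum>r<?d. (action ?M a *\<^sub>v v) $ r *\<^sub>C (b * E r))"
        unfolding \<Phi>_def pure_tensor_def dav by (intro sum.cong refl) (simp add: mult_scaleC_left)
      also have "\<dots> = (\<Sum>r<?d. \<Sum>i<?d. (v $ i * ent ?M a r i) *\<^sub>C (b * E r))"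
      proof (intro sum.cong refl)
        fix r assume "r \<in> {..<?d}"
        then have "(action ?M a *\<^sub>v v) $ r = (\<Sum>i<?d. v $ i * ent ?M a r i)"
          by (subst index_mult_mat_vec_sum[OF Mc v]) (auto simp: ent_def mult.commute)
        then show "(action ?M a *\<^sub>v v) $ r *\<^sub>C (b * E r) = (\<Sum>i<?d. (v $ i * ent ?M a r i) *\<^sub>C (b * E r))"
          by (simp add: cvec.scale_sum_left)
      qed
      also have "\<dots> = (\<Sum>i<?d. \<Sum>r<?d. (v $ i * ent ?M a r i) *\<^sub>C (b * E r))" by (rule sum.swap)
      finally have "\<Phi> g = 0" unfolding g \<Phi>_diff 1 by simp
      then show "g \<in> {t \<in> V. T t = 0}" using gV T_eq_0 by simp
    qed
    show "{t \<in> V. T t = 0} \<subseteq> cfun.span ?G"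
    proof
      fix t assume "t \<in> {t \<in> V. T t = 0}"
      then have t: "t \<in> V" and t0: "\<Phi> t = 0" using T_eq_0 by auto
      \<comment> \<open>The generator with \<open>b = t i\<close>, \<open>a = E i\<close> and the
        first unit vector, which \<open>E i\<close> moves to the \<open>i\<close>-th one.\<close>
      have gen: "pt (t i * E i) 0 - pt (t i) i \<in> ?G" if i: "i < ?d" for i
      proof -
        have "action ?M (E i) *\<^sub>v unit_vec ?d 0 = unit_vec ?d i"
        proof (rule eq_vecI)
          fix j assume "j < dim_vec (unit_vec ?d i :: complex vec)"
          then have j: "j < ?d" by simp
          have "(action ?M (E i) *\<^sub>v unit_vec ?d 0) $ j = ent ?M (E i) j 0"
            using is_module_carrier[OF M EA[of i]] j d0 by (simp add: ent_def)
          then show "(action ?M (E i) *\<^sub>v unit_vec ?d 0) $ j = unit_vec ?d i $ j"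
            using A.ent_mat_unit[OF k j d0] j i by (simp add: E_def unit_vec_def)
        qed (use is_module_carrier[OF M EA] in auto)
        then have "pt (t i * E i) 0 - pt (t i) i =
            pure_tensor (t i * E i) (unit_vec ?d 0) - pure_tensor (t i) (action ?M (E i) *\<^sub>v unit_vec ?d 0)"
          by (simp add: pt d0 i)
        moreover have "t i \<in> A'" using t i by (simp add: V_def)
        ultimately show ?thesis using EA unit_vec_carrier by blast
      qed
      have "(\<Sum>i<?d. pt (t i * E i) 0) = pt (\<Phi> t) 0"
      proof -
        have "(\<Sum>i<n. pt (t i * E i) 0) = pt (\<Sum>i<n. t i * E i) 0" for n
          by (induction n) (simp_all add: pt_add, simp add: pt_def fun_eq_iff)
        then show ?thesis by (simp add: \<Phi>_def)
      qed
      also have "\<dots> = 0" by (simp add: t0 pt_def fun_eq_iff)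
      \<comment> \<open>In the kernel of \<Phi> the slot 0 contributions cancel, leaving
        \<open>t\<close> as minus a sum of generators.\<close>
      finally have tn: "t = - (\<Sum>i<?d. pt (t i * E i) 0 - pt (t i) i)"
        using sum_pt[OF t] by (simp add: sum_subtractf)
      have "(\<Sum>i<?d. pt (t i * E i) 0 - pt (t i) i) \<in> cfun.span ?G"
        using gen by (intro cfun.span_sum cfun.span_base) simp
      from cfun.span_neg[OF this] show "t \<in> cfun.span ?G" unfolding tn[symmetric] .
    qed
  qed
  \<comment> \<open>The coordinates on \<open>V\<close>: a matrix unit of \<open>A'\<close> placed
    in slot \<open>i\<close>, read off by the corresponding entry.\<close>
  define J where "J = (SIGMA i:{..<?d}. SIGMA \<nu>:simple_classes A'. {..<A'.dm \<nu>} \<times> {..<A'.dm \<nu>})"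
  define x where "x = (\<lambda>(i, \<nu>, p, q). pt (A'.mat_unit \<nu> p q) i)"
  define c where "c = (\<lambda>(i :: nat, \<nu>, p, q) t. ent (rep A' \<nu>) (t i :: 'a) p q)"
  have fJ: "finite J" by (simp add: J_def A'.finite_Cl)
  have J_sum: "(\<Sum>j\<in>J. f j) = (\<Sum>i<?d. \<Sum>\<nu>\<in>simple_classes A'. \<Sum>p<A'.dm \<nu>. \<Sum>q<A'.dm \<nu>. f (i, \<nu>, p, q))"
    for f :: "_ \<Rightarrow> 'e::comm_monoid_add"
  proof -
    have "(\<Sum>i<?d. \<Sum>\<nu>\<in>simple_classes A'. \<Sum>p<A'.dm \<nu>. \<Sum>q<A'.dm \<nu>. f (i, \<nu>, p, q)) =
        (\<Sum>i<?d. \<Sum>\<nu>\<in>simple_classes A'. \<Sum>pq\<in>{..<A'.dm \<nu>} \<times> {..<A'.dm \<nu>}. f (i, \<nu>, pq))"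
      by (simp add: sum.cartesian_product split_def)
    also have "\<dots> = (\<Sum>i<?d. \<Sum>y\<in>(SIGMA \<nu>:simple_classes A'. {..<A'.dm \<nu>} \<times> {..<A'.dm \<nu>}). f (i, y))"
      by (intro sum.cong refl, subst sum.Sigma) (simp_all add: A'.finite_Cl split_def)
    also have "\<dots> = (\<Sum>j\<in>J. f j)"
      unfolding J_def by (subst sum.Sigma) (simp_all add: A'.finite_Cl split_def)
    finally show ?thesis by simp
  qed
  have xV: "x j \<in> V" if "j \<in> J" for j using that ptV[OF A'.mat_unit_in] by (auto simp: J_def x_def)
  have tA: "t i \<in> A'" if "t \<in> V" "i < ?d" for t i using that by (simp add: V_def)
  have c_add: "c j (s + t) = c j s + c j t" if "j \<in> J" "s \<in> V" "t \<in> V" for j s t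
    using that by (auto simp: J_def c_def ent_add[OF rep_module tA tA])
  have c_scale: "c j (scaleC_fun k t) = k * c j t" if "j \<in> J" "t \<in> V" for j k t
    using that by (auto simp: J_def c_def scaleC_fun_def ent_scale[OF rep_module tA])
  have expand: "t = (\<Sum>j\<in>J. scaleC_fun (c j t) (x j))" if t: "t \<in> V" for t
  proof -
    have pt_sum: "pt (sum g S) i = (\<Sum>s\<in>S. pt (g s) i)" if "finite S" for g :: "nat \<Rightarrow> 'a" and S i
      using that by (induction S rule: finite_induct) (simp_all add: pt_add, simp add: pt_def fun_eq_iff)
    have pt_sum': "pt (sum g S) i = (\<Sum>s\<in>S. pt (g s) i)" if "finite S" for g :: "'a fdmod set \<Rightarrow> 'a" and S i
      using that by (induction S rule: finite_induct) (simp_all add: pt_add, simp add: pt_def fun_eq_iff)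
    have "(\<Sum>j\<in>J. scaleC_fun (c j t) (x j)) =
      (\<Sum>i<?d. pt (\<Sum>\<nu>\<in>simple_classes A'. \<Sum>p<A'.dm \<nu>. \<Sum>q<A'.dm \<nu>. ent (rep A' \<nu>) (t i) p q *\<^sub>C A'.mat_unit \<nu> p q) i)"
      unfolding J_sum by (simp add: c_def x_def pt_scale[symmetric] pt_sum pt_sum' A'.finite_Cl)
    also have "\<dots> = (\<Sum>i<?d. pt (t i) i)"
      by (intro sum.cong refl arg_cong2[of _ _ _ _ pt] A'.expand_mat_unit[symmetric] tA[OF t]) simp
    also have "\<dots> = t" using sum_pt[OF t] by simp
    finally show ?thesis by simp
  qed
  \<comment> \<open>Rank and nullity are compared through traces: the identity, \<open>T\<close> and
    its complement are idempotents, so one formula computes all three dimensions.\<close>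
  have dimV: "of_nat (cfun.dim V) = (\<Sum>j\<in>J. c j (x j))"
    using cfun.dim_idempotent[of V J x c "\<lambda>t. t", OF V fJ xV c_add c_scale expand] by simp
  have dimT: "of_nat (cfun.dim (T ` V)) = (\<Sum>j\<in>J. c j (T (x j)))"
    by (rule cfun.dim_idempotent[of V J x c T, OF V fJ xV c_add c_scale expand T_V T_add T_scale idem])
  have "T (t - T t) = 0" for t
    unfolding T_eq_0 \<Phi>_diff by (simp add: T_def \<Phi>_pt[OF d0] \<Phi>E)
  note T_res = this
  have ker: "(\<lambda>t. t - T t) ` V = {t \<in> V. T t = 0}"
  proof (intro equalityI subsetI)
    fix s assume "s \<in> (\<lambda>t. t - T t) ` V"
    then obtain t where "t \<in> V" "s = t - T t" by blast
    then show "s \<in> {t \<in> V. T t = 0}" using T_res cfun.subspace_diff[OF V _ T_V] by simp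
  next
    fix s assume "s \<in> {t \<in> V. T t = 0}"
    then show "s \<in> (\<lambda>t. t - T t) ` V" by (intro image_eqI[where x = s]) auto
  qed
  have dimK: "of_nat (cfun.dim ((\<lambda>t. t - T t) ` V)) = (\<Sum>j\<in>J. c j (x j - T (x j)))"
  proof (rule cfun.dim_idempotent[of V J x c "\<lambda>t. t - T t", OF V fJ xV c_add c_scale expand])
    show "t - T t \<in> V" if "t \<in> V" for t by (rule cfun.subspace_diff[OF V that T_V[OF that]])
    show "s + t - T (s + t) = s - T s + (t - T t)" for s t by (simp add: T_add)
    show "scaleC_fun k t - T (scaleC_fun k t) = scaleC_fun k (t - T t)" for k t
      by (simp add: T_scale cfun.scale_right_diff_distrib)
    show "t - T t - T (t - T t) = t - T t" for t using T_res[of t] by simp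
  qed
  have c_diff: "c j (x j - T (x j)) = c j (x j) - c j (T (x j))" if j: "j \<in> J" for j
    using c_add[OF j cfun.subspace_diff[OF V xV[OF j] T_V[OF xV[OF j]]] T_V[OF xV[OF j]]] by simp
  \<comment> \<open>Written as a sum, the identity makes the truncated subtraction in
    \<open>induced_dim\<close> exact.\<close>
  have "(of_nat (cfun.dim V) :: complex) = of_nat (cfun.dim {t \<in> V. T t = 0} + cfun.dim (T ` V))"
    using dimV dimT dimK unfolding ker by (simp add: c_diff sum_subtractf)
  then have "cfun.dim V = cfun.dim {t \<in> V. T t = 0} + cfun.dim (T ` V)" unfolding of_nat_eq_iff .
  then have "induced_dim A A' ?M = cfun.dim (T ` V)" unfolding induced_dim_def tensor bal by simp
  then have "of_nat (induced_dim A A' ?M) = (\<Sum>j\<in>J. c j (T (x j)))" using dimT by simp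
  \<comment> \<open>\<open>T\<close> moves everything to slot 0, so only \<open>i = 0\<close> has
    diagonal coefficients. There \<open>T\<close> is right multiplication by \<open>E 0\<close>,
    whose trace on a block of \<open>A'\<close> is the block size times the character.\<close>
  also have "\<dots> = (\<Sum>i<?d. \<Sum>\<nu>\<in>simple_classes A'. \<Sum>p<A'.dm \<nu>. \<Sum>q<A'.dm \<nu>.
      if i = 0 then ent (rep A' \<nu>) (E 0) q q else 0)"
    unfolding J_sum
  proof (intro sum.cong refl)
    fix i \<nu> p q assume i: "i \<in> {..<?d}" and n: "\<nu> \<in> simple_classes A'" and p: "p \<in> {..<A'.dm \<nu>}" and q: "q \<in> {..<A'.dm \<nu>}"
    have "c (i, \<nu>, p, q) (T (x (i, \<nu>, p, q))) = ent (rep A' \<nu>) (if i = 0 then A'.mat_unit \<nu> p q * E i else 0) p q"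
      using i by (simp add: c_def T_def x_def \<Phi>_pt) (simp add: pt_def)
    also have "\<dots> = (if i = 0 then ent (rep A' \<nu>) (E 0) q q else 0)"
    proof (cases "i = 0")
      case True
      have "ent (rep A' \<nu>) (A'.mat_unit \<nu> p q * E 0) p q =
          (\<Sum>l<A'.dm \<nu>. ent (rep A' \<nu>) (A'.mat_unit \<nu> p q) p l * ent (rep A' \<nu>) (E 0) l q)"
        using p q by (intro ent_mult[OF rep_module[OF n] A'.mat_unit_in EA']) auto
      also have "\<dots> = (\<Sum>l<A'.dm \<nu>. if l = q then ent (rep A' \<nu>) (E 0) q q else 0)"
        using p by (intro sum.cong refl) (auto simp: A'.ent_mat_unit[OF n])
      also have "\<dots> = ent (rep A' \<nu>) (E 0) q q" using q by simp
      finally show ?thesis using True by simp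
    next
      case False
      then show ?thesis using p q by (simp add: ent_zero[OF A'.sub rep_module[OF n]])
    qed
    finally show "c (i, \<nu>, p, q) (T (x (i, \<nu>, p, q))) = (if i = 0 then ent (rep A' \<nu>) (E 0) q q else 0)" .
  qed
  also have "\<dots> = (\<Sum>i<?d. if i = 0 then (\<Sum>\<nu>\<in>simple_classes A'. of_nat (A'.dm \<nu>) * character (rep A' \<nu>) (E 0)) else 0)"
    by (intro sum.cong refl) (auto simp: character_def)
  also have "\<dots> = (\<Sum>\<nu>\<in>simple_classes A'. of_nat (A'.dm \<nu>) * character (rep A' \<nu>) (E 0))" using d0 by simp
  finally show ?thesis by (simp add: E_def)
qed

end

text \<open>Frobenius reciprocity on the level of dimensions: the edge numbers that describe
  restriction also describe induction.\<close>

lemma dim_induce: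
  assumes fam: "semisimple_family A" and k: "\<kappa> \<in> simple_classes (A l)"
  shows "(\<Sum>\<nu>\<in>simple_classes (A (Suc l)). mult_edges (branching_graph A) l \<kappa> \<nu> * mod_dim (rep (A (Suc l)) \<nu>)) =
    induced_dim (A l) (A (Suc l)) (rep (A l) \<kappa>)"
proof -
  have "(of_nat (induced_dim (A l) (A (Suc l)) (rep (A l) \<kappa>)) :: complex) =
    of_nat (\<Sum>\<nu>\<in>simple_classes (A (Suc l)). mult_edges (branching_graph A) l \<kappa> \<nu> * mod_dim (rep (A (Suc l)) \<nu>))"
    unfolding induced_dim_eq[OF semisimple_familyD(1)[OF fam] semisimple_familyD(1)[OF fam] semisimple_familyD(2)[OF fam] k]
    by (simp add: mult_branching_graph[OF fam k] mult.commute)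
  then show ?thesis unfolding of_nat_eq_iff by simp
qed

subsection \<open>Positivity of characters\<close>

lemma similar_trace_square:
  assumes H: "H \<in> carrier_mat n n" and B: "B \<in> carrier_mat n n" and s: "similar_mat H (B :: complex mat)"
  shows "mat_trace (H * H) = mat_trace (B * B)"
proof -
  obtain m P Q where "{H, B, P, Q} \<subseteq> carrier_mat m m" and PQ: "P * Q = 1\<^sub>m m" "Q * P = 1\<^sub>m m" "H = P * B * Q"
    using similar_matD[OF s] by blast
  then have m: "m = n" and P: "P \<in> carrier_mat n n" and Q: "Q \<in> carrier_mat n n" using H by auto
  have PB: "P * B \<in> carrier_mat n n" using P B by simp
  have BQ: "B * Q \<in> carrier_mat n n" using B Q by simp
  have "H * H = P * B * (Q * (P * (B * Q)))"
    unfolding PQ(3) using assoc_mult_mat[OF PB Q, of "P * B * Q" n] assoc_mult_mat[OF P B Q] PB P B Q by simp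
  also have "Q * (P * (B * Q)) = B * Q"
    using assoc_mult_mat[OF Q P BQ] PQ(2) left_mult_one_mat[OF BQ] m by simp
  finally have "mat_trace (H * H) = mat_trace (B * Q * (P * B))"
    using mat_trace_comm[OF PB BQ] by simp
  also have "B * Q * (P * B) = B * (Q * (P * B))" by (rule assoc_mult_mat[OF B Q PB])
  also have "Q * (P * B) = B" using assoc_mult_mat[OF Q P B] PQ(2) left_mult_one_mat[OF B] m by simp
  finally show ?thesis .
qed

text \<open>After Schur triangularisation the trace of the square is the sum of the squares of the
  diagonal entries, and these are eigenvalues.\<close>

lemma real_eigenvalues_trace_square:
  assumes H: "H \<in> carrier_mat n n" and ev: "\<And>k. eigenvalue H k \<Longrightarrow> k \<in> \<real>"
  shows "mat_trace (H * H) \<in> \<real>\<^sub>\<ge>\<^sub>0"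
proof -
  obtain as where as: "char_poly H = (\<Prod>a\<leftarrow>as. [:- a, 1:])" using char_poly_factorized[OF H] by blast
  obtain B where B: "B \<in> carrier_mat n n" and ut: "upper_triangular B" and sim: "similar_mat H B"
    using schur_decomposition_exists[OF H as] by blast
  have diag: "B $$ (i, i) \<in> \<real>" if i: "i < n" for i
  proof -
    have "B $$ (i, i) \<in> set (diag_mat B)" using i B by (auto simp: diag_mat_def)
    then have "poly (char_poly H) (B $$ (i, i)) = 0"
      unfolding char_poly_similar[OF sim] char_poly_upper_triangular[OF B ut] poly_prod_list
      by (auto simp: prod_list_zero_iff)
    then show ?thesis using ev eigenvalue_root_char_poly[OF H] by blast
  qed
  have "mat_trace (H * H) = mat_trace (B * B)" by (rule similar_trace_square[OF H B sim])
  also have "\<dots> = (\<Sum>i<n. (B * B) $$ (i, i))" using B by (simp add: mat_trace_def)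
  also have "\<dots> = (\<Sum>i<n. B $$ (i, i) * B $$ (i, i))"
  proof (intro sum.cong refl)
    fix i assume "i \<in> {..<n}"
    then have i: "i < n" by simp
    have "(B * B) $$ (i, i) = (\<Sum>l<n. B $$ (i, l) * B $$ (l, i))" by (rule index_mult_mat_sum[OF B B i i])
    also have "\<dots> = (\<Sum>l<n. if l = i then B $$ (i, i) * B $$ (i, i) else 0)"
    proof (intro sum.cong refl)
      fix l assume "l \<in> {..<n}"
      then have l: "l < n" by simp
      show "B $$ (i, l) * B $$ (l, i) = (if l = i then B $$ (i, i) * B $$ (i, i) else 0)"
        using upper_triangularD[OF ut, of l i] upper_triangularD[OF ut, of i l] i l B
        by (cases l i rule: linorder_cases) auto
    qed
    also have "\<dots> = B $$ (i, i) * B $$ (i, i)" using i by simp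
    finally show "(B * B) $$ (i, i) = B $$ (i, i) * B $$ (i, i)" .
  qed
  also have "\<dots> \<in> \<real>\<^sub>\<ge>\<^sub>0"
  proof -
    have sq: "z * z \<in> \<real>\<^sub>\<ge>\<^sub>0" if z: "z \<in> \<real>" for z :: complex
    proof -
      obtain r where "z = of_real r" using z by (auto elim: Reals_cases)
      then have "z * z = of_real (r * r)" by simp
      then show ?thesis by (simp add: nonneg_Reals_of_real_iff del: of_real_mult)
    qed
    have "(\<Sum>i<m. B $$ (i, i) * B $$ (i, i)) \<in> \<real>\<^sub>\<ge>\<^sub>0" if "m \<le> n" for m
      using that by (induction m) (auto intro!: nonneg_Reals_add_I sq diag)
    then show ?thesis by blast
  qed
  finally show ?thesis .
qed

section \<open>Semisimple algebras with a definite involution\<close>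

locale star_algebra = semisimple_algebra A for A :: "'a::complex_algebra_1 set" +
  fixes star :: "'a \<Rightarrow> 'a"
  assumes involution: "involution_on A star" and norm_exists: "\<exists>nrm. cstar_norm A star nrm"
begin

lemma star_in: "x \<in> A \<Longrightarrow> star x \<in> A"
  using involution by (simp add: involution_on_def)

lemma star_star: "x \<in> A \<Longrightarrow> star (star x) = x"
  using involution by (simp add: involution_on_def)

lemma star_add: "x \<in> A \<Longrightarrow> y \<in> A \<Longrightarrow> star (x + y) = star x + star y"
  using involution by (simp add: involution_on_def)

lemma star_mult: "x \<in> A \<Longrightarrow> y \<in> A \<Longrightarrow> star (x * y) = star y * star x"
  using involution by (simp add: involution_on_def)

lemma star_scale: "x \<in> A \<Longrightarrow> star (c *\<^sub>C x) = cnj c *\<^sub>C star x"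
  using involution by (simp add: involution_on_def)

text \<open>The positivity results below rest on this consequence of the norm identity.\<close>

lemma star_mult_self_zero:
  assumes x: "x \<in> A" and z: "star x * x = 0"
  shows "x = 0"
proof -
  obtain nrm where n: "cstar_norm A star nrm" using norm_exists by blast
  have "nrm 0 = 0" using n subalgebra_zero[OF sub] by (simp add: cstar_norm_def)
  moreover have "nrm (star x * x) = (nrm x)\<^sup>2" using n x by (simp add: cstar_norm_def)
  ultimately have "nrm x = 0" using z by simp
  then show ?thesis using n x by (simp add: cstar_norm_def)
qed

text \<open>
  An eigenvector of \<open>\<rho>\<^sub>\<kappa> h\<close>, placed in the first column of the block of \<open>\<kappa>\<close>, is an element \<open>z\<close> of the algebra
  with \<open>h z = \<mu> z\<close>, whence \<open>\<mu> z\<^sup>*z = z\<^sup>*h z = \<mu>\<^sup>* z\<^sup>*z\<close>.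
\<close>

lemma selfadjoint_eigenvalue_real:
  assumes h: "h \<in> A" "star h = h" and k: "\<kappa> \<in> Cl" and ev: "eigenvalue (action (rep A \<kappa>) h) \<mu>"
  shows "\<mu> \<in> \<real>"
proof -
  have M: "is_module A (rep A \<kappa>)" by (rule rep_module[OF k])
  have Hc: "action (rep A \<kappa>) h \<in> carrier_mat (dm \<kappa>) (dm \<kappa>)" by (rule is_module_carrier[OF M h(1)])
  obtain v where v: "v \<in> carrier_vec (dm \<kappa>)" "v \<noteq> 0\<^sub>v (dm \<kappa>)" "action (rep A \<kappa>) h *\<^sub>v v = \<mu> \<cdot>\<^sub>v v"
    using ev Hc by (auto simp: eigenvalue_def eigenvector_def)
  have d0: "0 < dm \<kappa>" by (rule dm_pos[OF k])
  define z where "z = (\<Sum>p<dm \<kappa>. v $ p *\<^sub>C mat_unit \<kappa> p 0)"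
  have sA: "v $ p *\<^sub>C mat_unit \<kappa> p 0 \<in> A" for p by (intro subalgebra_scale[OF sub] mat_unit_in)
  have zA: "z \<in> A" unfolding z_def by (rule subalgebra_sum[OF sub sA])
  have z0: "z \<noteq> 0"
  proof
    assume z: "z = 0"
    have "v $ q = 0" if q: "q < dm \<kappa>" for q
    proof -
      have "en \<kappa> z q 0 = (\<Sum>p<dm \<kappa>. v $ p * en \<kappa> (mat_unit \<kappa> p 0) q 0)"
        unfolding z_def by (simp add: ent_sum[OF sub M sA q d0] ent_scale[OF M mat_unit_in q d0])
      also have "\<dots> = (\<Sum>p<dm \<kappa>. if p = q then v $ q else 0)"
        by (intro sum.cong refl) (auto simp: ent_mat_unit[OF k q d0])
      also have "\<dots> = v $ q" using q by simp
      finally show ?thesis using z ent_zero[OF sub M q d0] by simp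
    qed
    then show False using v(1,2) by (auto intro: eq_vecI)
  qed
  have hz: "h * z = \<mu> *\<^sub>C z"
  proof -
    have "h * z = (\<Sum>p<dm \<kappa>. \<Sum>r<dm \<kappa>. (en \<kappa> h r p * v $ p) *\<^sub>C mat_unit \<kappa> r 0)"
      unfolding z_def sum_distrib_left mult_scaleC_right
      by (intro sum.cong refl, subst mult_mat_unit[OF h(1) k _ d0])
         (simp_all add: cvec.scale_sum_right scaleC_scaleC mult.commute)
    also have "\<dots> = (\<Sum>r<dm \<kappa>. \<Sum>p<dm \<kappa>. (en \<kappa> h r p * v $ p) *\<^sub>C mat_unit \<kappa> r 0)" by (rule sum.swap)
    also have "\<dots> = (\<Sum>r<dm \<kappa>. (\<mu> * v $ r) *\<^sub>C mat_unit \<kappa> r 0)"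
    proof (intro sum.cong refl)
      fix r assume "r \<in> {..<dm \<kappa>}"
      then have r: "r < dm \<kappa>" by simp
      have "(\<Sum>p<dm \<kappa>. en \<kappa> h r p * v $ p) = (action (rep A \<kappa>) h *\<^sub>v v) $ r"
        unfolding ent_def by (rule index_mult_mat_vec_sum[OF Hc v(1) r, symmetric])
      also have "\<dots> = \<mu> * v $ r" using v r by simp
      finally show "(\<Sum>p<dm \<kappa>. (en \<kappa> h r p * v $ p) *\<^sub>C mat_unit \<kappa> r 0) = (\<mu> * v $ r) *\<^sub>C mat_unit \<kappa> r 0"
        by (simp add: cvec.scale_sum_left[symmetric])
    qed
    also have "\<dots> = \<mu> *\<^sub>C z" by (simp add: z_def cvec.scale_sum_right scaleC_scaleC)
    finally show ?thesis .
  qed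
  have "star z * h = cnj \<mu> *\<^sub>C star z"
    using arg_cong[OF hz, of star] star_mult[OF h(1) zA] star_scale[OF zA] h(2) by simp
  then have "cnj \<mu> *\<^sub>C (star z * z) = star z * h * z" by (simp add: mult_scaleC_left)
  also have "\<dots> = \<mu> *\<^sub>C (star z * z)" by (simp add: mult.assoc hz mult_scaleC_right)
  finally have "\<mu> = cnj \<mu> \<or> star z * z = 0"
    using cvec.scale_right_imp_eq by metis
  then have "\<mu> = cnj \<mu>" using star_mult_self_zero[OF zA] z0 by blast
  then show ?thesis by (simp add: Reals_cnj_iff)
qed

lemma character_square_nonneg:
  assumes h: "h \<in> A" "star h = h" and k: "\<kappa> \<in> Cl"
  shows "character (rep A \<kappa>) (h * h) \<in> \<real>\<^sub>\<ge>\<^sub>0"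
proof -
  have M: "is_module A (rep A \<kappa>)" by (rule rep_module[OF k])
  have "character (rep A \<kappa>) (h * h) = mat_trace (action (rep A \<kappa>) h * action (rep A \<kappa>) h)"
    using character_trace[OF M subalgebra_mult[OF sub h(1) h(1)]] is_module_mult[OF M h(1) h(1)] by simp
  also have "\<dots> \<in> \<real>\<^sub>\<ge>\<^sub>0"
    by (rule real_eigenvalues_trace_square[OF is_module_carrier[OF M h(1)] selfadjoint_eigenvalue_real[OF h k]])
  finally show ?thesis .
qed

text \<open>With \<open>h = x + x\<^sup>*\<close> and \<open>g = i (x - x\<^sup>*)\<close> one has \<open>h\<^sup>2 + g\<^sup>2 = 2 (x\<^sup>*x + x x\<^sup>*)\<close>.\<close>

lemma character_nonneg:
  assumes x: "x \<in> A" and k: "\<kappa> \<in> Cl"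
  shows "character (rep A \<kappa>) (star x * x) \<in> \<real>\<^sub>\<ge>\<^sub>0"
proof -
  let ?\<chi> = "character (rep A \<kappa>)"
  have M: "is_module A (rep A \<kappa>)" by (rule rep_module[OF k])
  define y where "y = star x"
  have y: "y \<in> A" "star y = x" "star x = y" using star_in[OF x] star_star[OF x] by (simp_all add: y_def)
  \<comment> \<open>The scalar -1 gets a name so that differences are sums of \<open>scaleC\<close>
    terms and the same rewriting rules expand both squares.\<close>
  define m :: complex where "m = -1"
  have m: "m * m = 1" "cnj m = m" "\<i> * \<i> = m" by (simp_all add: m_def)
  define h where "h = x + y"
  define u where "u = x + m *\<^sub>C y"
  define g where "g = \<i> *\<^sub>C u"
  have mA: "m *\<^sub>C y \<in> A" by (rule subalgebra_scale[OF sub y(1)])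
  have hA: "h \<in> A" unfolding h_def by (rule subalgebra_add[OF sub x y(1)])
  have uA: "u \<in> A" unfolding u_def by (rule subalgebra_add[OF sub x mA])
  have gA: "g \<in> A" unfolding g_def by (rule subalgebra_scale[OF sub uA])
  have hs: "star h = h" unfolding h_def by (simp add: star_add x y add.commute)
  have us: "star u = y + m *\<^sub>C x" unfolding u_def star_add[OF x mA] star_scale[OF y(1)] y(2,3) m(2) ..
  have "star g = (m * \<i>) *\<^sub>C (y + m *\<^sub>C x)"
    unfolding g_def star_scale[OF uA] us by (simp add: m_def)
  also have "\<dots> = (m * \<i>) *\<^sub>C y + (m * \<i> * m) *\<^sub>C x"
    unfolding scaleC_add_right scaleC_scaleC ..
  also have "m * \<i> * m = \<i>" by (simp add: m_def)
  also have "(m * \<i>) *\<^sub>C y + \<i> *\<^sub>C x = \<i> *\<^sub>C (x + m *\<^sub>C y)"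
    unfolding scaleC_add_right scaleC_scaleC by (simp only: add.commute mult.commute)
  finally have gs: "star g = g" unfolding g_def u_def .
  have xx: "x * x \<in> A" "x * y \<in> A" "y * x \<in> A" "y * y \<in> A" using x y by (auto intro: subalgebra_mult[OF sub])
  have comm: "?\<chi> (x * y) = ?\<chi> (y * x)" by (rule character_mult_comm[OF M x y(1) xx(2,3)])
  have "h * h = (x * x + x * y) + (y * x + y * y)"
    unfolding h_def by (simp add: distrib_left distrib_right add_ac)
  then have 1: "?\<chi> (h * h) = ?\<chi> (x * x) + 2 * ?\<chi> (y * x) + ?\<chi> (y * y)"
    using xx by (simp add: character_add[OF M] subalgebra_add[OF sub] comm)
  have "g * g = m *\<^sub>C (u * u)"
    unfolding g_def mult_scaleC_left mult_scaleC_right scaleC_scaleC m(3) ..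
  also have "u * u = (x * x + m *\<^sub>C (x * y)) + (m *\<^sub>C (y * x) + y * y)"
    unfolding u_def distrib_left distrib_right mult_scaleC_left mult_scaleC_right scaleC_add_right scaleC_scaleC m(1) scaleC_one
    by (simp only: add_ac)
  finally have "?\<chi> (g * g) = m * (?\<chi> (x * x) + m * ?\<chi> (y * x) + (m * ?\<chi> (y * x) + ?\<chi> (y * y)))"
    using xx by (simp add: character_add[OF M] character_scale[OF M] subalgebra_add[OF sub] subalgebra_scale[OF sub] comm)
  then have "?\<chi> (g * g) = - (?\<chi> (x * x) - 2 * ?\<chi> (y * x) + ?\<chi> (y * y))" by (simp add: m_def)
  then have "?\<chi> (h * h) + ?\<chi> (g * g) = 4 * ?\<chi> (y * x)" using 1 by simp
  moreover have "?\<chi> (h * h) + ?\<chi> (g * g) \<in> \<real>\<^sub>\<ge>\<^sub>0"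
    by (intro nonneg_Reals_add_I character_square_nonneg hA hs gA gs k)
  ultimately have "4 * ?\<chi> (y * x) \<in> \<real>\<^sub>\<ge>\<^sub>0" by simp
  then have "4 * ?\<chi> (y * x) / 4 \<in> \<real>\<^sub>\<ge>\<^sub>0" by (rule nonneg_Reals_divide_I[OF _ nonneg_Reals_numeral_I])
  then show ?thesis by (simp add: y_def)
qed

text \<open>For a simple class, this is the identity of its block, a minimal central idempotent of
  \<open>A\<close>.\<close>

definition central_unit :: "'a fdmod set \<Rightarrow> 'a" where
  "central_unit \<kappa> = (\<Sum>p<dm \<kappa>. mat_unit \<kappa> p p)"

lemma central_unit_in: "central_unit \<kappa> \<in> A"
  unfolding central_unit_def by (rule subalgebra_sum[OF sub mat_unit_in])

lemma ent_central_unit: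
  assumes k: "\<kappa>' \<in> Cl" and rs: "r < dm \<kappa>'" "s < dm \<kappa>'"
  shows "en \<kappa>' (central_unit \<kappa>) r s = (if \<kappa>' = \<kappa> \<and> r = s then 1 else 0)"
proof -
  have "en \<kappa>' (central_unit \<kappa>) r s = (\<Sum>p<dm \<kappa>. en \<kappa>' (mat_unit \<kappa> p p) r s)"
    unfolding central_unit_def by (rule ent_sum[OF sub rep_module[OF k] mat_unit_in rs])
  also have "\<dots> = (\<Sum>p<dm \<kappa>. if p = r then (if \<kappa>' = \<kappa> \<and> r = s then 1 else 0) else 0)"
    by (intro sum.cong refl) (auto simp: ent_mat_unit[OF k rs])
  also have "\<dots> = (if \<kappa>' = \<kappa> \<and> r = s then 1 else 0)" using rs by auto
  finally show ?thesis .
qed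

lemma ent_mult_central_unit:
  assumes k: "\<kappa>' \<in> Cl" and rs: "r < dm \<kappa>'" "s < dm \<kappa>'" and a: "a \<in> A"
  shows "en \<kappa>' (a * central_unit \<kappa>) r s = (if \<kappa>' = \<kappa> then en \<kappa>' a r s else 0)"
    and "en \<kappa>' (central_unit \<kappa> * a) r s = (if \<kappa>' = \<kappa> then en \<kappa>' a r s else 0)"
proof -
  have "en \<kappa>' (a * central_unit \<kappa>) r s = (\<Sum>l<dm \<kappa>'. if l = s then (if \<kappa>' = \<kappa> then en \<kappa>' a r s else 0) else 0)"
    unfolding ent_mult[OF rep_module[OF k] a central_unit_in rs]
    by (intro sum.cong refl) (auto simp: ent_central_unit[OF k _ rs(2)])
  then show "en \<kappa>' (a * central_unit \<kappa>) r s = (if \<kappa>' = \<kappa> then en \<kappa>' a r s else 0)" using rs by simp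
  have "en \<kappa>' (central_unit \<kappa> * a) r s = (\<Sum>l<dm \<kappa>'. if l = r then (if \<kappa>' = \<kappa> then en \<kappa>' a r s else 0) else 0)"
    unfolding ent_mult[OF rep_module[OF k] central_unit_in a rs]
    by (intro sum.cong refl) (auto simp: ent_central_unit[OF k rs(1)])
  then show "en \<kappa>' (central_unit \<kappa> * a) r s = (if \<kappa>' = \<kappa> then en \<kappa>' a r s else 0)" using rs by simp
qed

lemma central_unit_comm: "a \<in> A \<Longrightarrow> a * central_unit \<kappa> = central_unit \<kappa> * a"
  by (rule ent_eqI) (simp_all add: subalgebra_mult[OF sub] central_unit_in ent_mult_central_unit)

lemma central_unit_idem: "central_unit \<kappa> * central_unit \<kappa> = central_unit \<kappa>"
  by (rule ent_eqI) (auto simp: subalgebra_mult[OF sub] central_unit_in ent_mult_central_unit ent_central_unit)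

text \<open>An abstract involution might exchange blocks, as the swap of coordinates on a product
  does; definiteness forbids this. The product \<open>w\<close> of the central idempotent with its
  adjoint is a scalar \<open>c\<close> times the block identity, and it is idempotent and nonzero.
  Hence \<open>c = 1\<close>, so \<open>w\<close> is the block identity, and \<open>w\<close> is its
  own adjoint.\<close>

lemma star_central_unit:
  assumes k: "\<kappa> \<in> Cl"
  shows "star (central_unit \<kappa>) = central_unit \<kappa>"
proof -
  let ?e = "central_unit \<kappa>"
  define z where "z = star ?e"
  have eA: "?e \<in> A" and zA: "z \<in> A" by (simp_all add: z_def star_in central_unit_in)
  have sz: "star z = ?e" by (simp add: z_def star_star eA)
  have d0: "0 < dm \<kappa>" by (rule dm_pos[OF k])
  have z_comm: "a * z = z * a" if a: "a \<in> A" for a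
  proof -
    have "star (?e * star a) = star (star a * ?e)" using central_unit_comm[OF star_in[OF a]] by simp
    then show ?thesis by (simp add: star_mult eA star_in a star_star z_def)
  qed
  have z_idem: "z * z = z"
    using arg_cong[OF central_unit_idem[of \<kappa>], of star] by (simp add: star_mult eA z_def)
  define w where "w = z * ?e"
  have wA: "w \<in> A" unfolding w_def by (rule subalgebra_mult[OF sub zA eA])
  have w_ent: "en \<kappa>' w r s = (if \<kappa>' = \<kappa> then en \<kappa>' z r s else 0)" if "\<kappa>' \<in> Cl" "r < dm \<kappa>'" "s < dm \<kappa>'" for \<kappa>' r s
    unfolding w_def by (rule ent_mult_central_unit(1)[OF that zA])
  have mu: "en \<kappa> z r p * (if s = q then 1 else 0) = (if r = p then 1 else 0) * en \<kappa> z q s"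
    if pq: "p < dm \<kappa>" "q < dm \<kappa>" "r < dm \<kappa>" "s < dm \<kappa>" for p q r s
  proof -
    have "en \<kappa> (z * mat_unit \<kappa> p q) r s = (\<Sum>l<dm \<kappa>. if l = p then en \<kappa> z r p * (if s = q then 1 else 0) else 0)"
      unfolding ent_mult[OF rep_module[OF k] zA mat_unit_in pq(3,4)]
      by (intro sum.cong refl) (auto simp: ent_mat_unit[OF k _ pq(4)])
    moreover have "en \<kappa> (mat_unit \<kappa> p q * z) r s = (\<Sum>l<dm \<kappa>. if l = q then (if r = p then 1 else 0) * en \<kappa> z q s else 0)"
      unfolding ent_mult[OF rep_module[OF k] mat_unit_in zA pq(3,4)]
      by (intro sum.cong refl) (auto simp: ent_mat_unit[OF k pq(3)])
    ultimately show ?thesis using z_comm[OF mat_unit_in, of \<kappa> p q] pq by simp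
  qed
  define c where "c = en \<kappa> z 0 0"
  have z_scalar: "en \<kappa> z r s = (if r = s then c else 0)" if "r < dm \<kappa>" "s < dm \<kappa>" for r s
    using mu[of s 0 r 0] that d0 by (auto simp: c_def)
  have w_c: "w = c *\<^sub>C ?e"
    by (rule ent_eqI)
       (auto simp: wA subalgebra_scale[OF sub] eA ent_scale[OF rep_module] w_ent ent_central_unit z_scalar)
  have "w * w = w"
  proof -
    have "w * w = z * (?e * z) * ?e" by (simp add: w_def mult.assoc)
    also have "?e * z = z * ?e" by (rule z_comm[OF eA])
    also have "z * (z * ?e) * ?e = (z * z) * (?e * ?e)" by (simp add: mult.assoc)
    finally show ?thesis by (simp add: z_idem central_unit_idem w_def)
  qed
  moreover have "en \<kappa> (w * w) 0 0 = c * c"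
    unfolding w_c by (simp add: mult_scaleC_left mult_scaleC_right scaleC_scaleC central_unit_idem
      ent_scale[OF rep_module[OF k] eA d0 d0] ent_central_unit[OF k d0 d0])
  moreover have "en \<kappa> w 0 0 = c"
    unfolding w_c by (simp add: ent_scale[OF rep_module[OF k] eA d0 d0] ent_central_unit[OF k d0 d0])
  ultimately have cc: "c * c = c" by simp
  have "?e \<noteq> 0" using ent_central_unit[OF k d0 d0, of \<kappa>] ent_zero[OF sub rep_module[OF k] d0 d0] by auto
  then have "w \<noteq> 0" using star_mult_self_zero[OF eA] unfolding w_def z_def by blast
  then have "c \<noteq> 0" using w_c by auto
  then have "c = 1" using cc by simp
  then have we: "w = ?e" using w_c by (simp add: scaleC_one)
  have "star w = w" unfolding w_def star_mult[OF zA eA] sz by (simp add: z_def[symmetric])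
  then show ?thesis using we by simp
qed

text \<open>The minimal idempotent \<open>mat_unit \<kappa> 0 0\<close> need not be selfadjoint, so
  positivity is tested on the central unit, which has the form \<open>star x * x\<close>. Its trace
  is the block size times the value sought.\<close>

lemma positive_trace_mat_unit:
  assumes add: "\<And>x y. x \<in> A \<Longrightarrow> y \<in> A \<Longrightarrow> f (x + y) = f x + f y"
    and scale: "\<And>c x. x \<in> A \<Longrightarrow> f (c *\<^sub>C x) = c * f x"
    and comm: "\<And>x y. x \<in> A \<Longrightarrow> y \<in> A \<Longrightarrow> f (x * y) = f (y * x)"
    and pos: "\<And>x. x \<in> A \<Longrightarrow> f (star x * x) \<in> \<real>\<^sub>\<ge>\<^sub>0"
    and k: "\<kappa> \<in> Cl"
  shows "f (mat_unit \<kappa> 0 0) \<in> \<real>\<^sub>\<ge>\<^sub>0"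
proof -
  have d0: "0 < dm \<kappa>" by (rule dm_pos[OF k])
  have "f (central_unit \<kappa>) = (\<Sum>p<dm \<kappa>. f (mat_unit \<kappa> p p))"
    unfolding central_unit_def by (rule tracial_sum[of f, OF add scale mat_unit_in])
  also have "\<dots> = (\<Sum>p<dm \<kappa>. f (mat_unit \<kappa> 0 0))"
  proof (intro sum.cong refl)
    fix p assume "p \<in> {..<dm \<kappa>}"
    then have "p < dm \<kappa>" by simp
    from tracial_mat_unit[of f, OF add scale comm k this this]
    show "f (mat_unit \<kappa> p p) = f (mat_unit \<kappa> 0 0)" by (simp only: if_True refl)
  qed
  finally have e: "f (central_unit \<kappa>) = of_nat (dm \<kappa>) * f (mat_unit \<kappa> 0 0)" by simp
  have "f (star (central_unit \<kappa>) * central_unit \<kappa>) \<in> \<real>\<^sub>\<ge>\<^sub>0" by (rule pos[OF central_unit_in])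
  then have "f (central_unit \<kappa>) \<in> \<real>\<^sub>\<ge>\<^sub>0" by (simp add: star_central_unit[OF k] central_unit_idem)
  then obtain s where s: "f (central_unit \<kappa>) = of_real s" "s \<ge> 0" by (auto elim: nonneg_Reals_cases)
  then have "f (mat_unit \<kappa> 0 0) = of_real (s / dm \<kappa>)" using e d0 by (simp add: field_simps)
  then show ?thesis using s(2) by (simp add: nonneg_Reals_of_real_iff del: of_real_divide)
qed

end

subsection \<open>Traces and central measures\<close>

lemma (in semisimple_algebra) normalized_character_eq:
  assumes k: "\<kappa> \<in> Cl" and b: "b \<in> A"
  shows "normalized_character \<kappa> b = character (rep A \<kappa>) b / of_nat (dm \<kappa>)"
proof -
  have e: "(\<Sum>i<mod_dim N. action N b $$ (i, i)) / of_nat (mod_dim N) = character (rep A \<kappa>) b / of_nat (dm \<kappa>)"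
    if "N \<in> \<kappa>" for N
    using character_class[OF k that b] dim_class[OF k that] by (simp add: character_def ent_def)
  show ?thesis unfolding normalized_character_def
  proof (rule the_equality)
    show "\<exists>N\<in>\<kappa>. character (rep A \<kappa>) b / of_nat (dm \<kappa>) = (\<Sum>i<mod_dim N. action N b $$ (i, i)) / of_nat (mod_dim N)"
      by (rule bexI[where x = "rep A \<kappa>"], rule e[symmetric]; rule rep_in_class[OF k])
    fix z assume "\<exists>N\<in>\<kappa>. z = (\<Sum>i<mod_dim N. action N b $$ (i, i)) / of_nat (mod_dim N)"
    then obtain N where "N \<in> \<kappa>" "z = (\<Sum>i<mod_dim N. action N b $$ (i, i)) / of_nat (mod_dim N)" by (elim bexE)
    then show "z = character (rep A \<kappa>) b / of_nat (dm \<kappa>)" using e by simp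
  qed
qed

locale bratteli_algebra = bratteli_graph G r for G :: "'v graded_graph" and r +
  fixes B :: "nat \<Rightarrow> 'b::complex_algebra_1 set" and star :: "'b \<Rightarrow> 'b"
    and \<phi> :: "nat \<Rightarrow> 'v \<Rightarrow> 'b fdmod set"
  assumes lss: "locally_semisimple B star" and iso: "graph_iso G (branching_graph B) \<phi>"
begin

lemma family: "semisimple_family B"
  using lss by (simp add: locally_semisimple_def)

lemma star_algebra: "star_algebra (B n) star"
  using lss semisimple_familyD(1)[OF family, of n]
  by (simp add: locally_semisimple_def star_algebra_def star_algebra_axioms_def)

interpretation B: star_algebra "B n" star for n by (rule star_algebra)

lemma B_Suc: "B n \<subseteq> B (Suc n)"
  by (rule semisimple_familyD(2)[OF family])

lemma B_mono: "n \<le> m \<Longrightarrow> B n \<subseteq> B m"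
  by (rule lift_Suc_mono_le[of B, OF B_Suc])

lemma bij_\<phi>: "bij_betw (\<phi> n) (level G n) (simple_classes (B n))"
  using iso by (simp add: graph_iso_def level_branching_graph)

lemma \<phi>_class: "v \<in> level G n \<Longrightarrow> \<phi> n v \<in> simple_classes (B n)"
  using bij_betwE[OF bij_\<phi>] by blast

lemma sum_classes: "(\<Sum>\<kappa>\<in>simple_classes (B n). h \<kappa>) = (\<Sum>v\<in>level G n. h (\<phi> n v))"
  by (rule sum.reindex_bij_betw[OF bij_\<phi>, symmetric])

lemma mult_\<phi>: "v \<in> level G n \<Longrightarrow> w \<in> level G (Suc n) \<Longrightarrow>
    mult_edges (branching_graph B) n (\<phi> n v) (\<phi> (Suc n) w) = mult_edges G n v w"
  using iso by (simp add: graph_iso_def)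

definition vdim :: "nat \<Rightarrow> 'v \<Rightarrow> nat" where
  "vdim n v = mod_dim (rep (B n) (\<phi> n v))"

definition vchar :: "nat \<Rightarrow> 'v \<Rightarrow> 'b \<Rightarrow> complex" where
  "vchar n v b = character (rep (B n) (\<phi> n v)) b"

definition vunit :: "nat \<Rightarrow> 'v \<Rightarrow> 'b" where
  "vunit n v = semisimple_algebra.mat_unit (B n) (\<phi> n v) 0 0"

lemma vunit_in: "vunit n v \<in> B n"
  unfolding vunit_def by (rule B.mat_unit_in)

lemma vdim_pos: "v \<in> level G n \<Longrightarrow> 0 < vdim n v"
  unfolding vdim_def by (rule B.dm_pos[OF \<phi>_class])

lemma vdim_Suc: "w \<in> level G (Suc n) \<Longrightarrow> vdim (Suc n) w = (\<Sum>v\<in>level G n. mult_edges G n v w * vdim n v)"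
  unfolding vdim_def dim_restrict[OF family \<phi>_class, symmetric] sum_classes
  by (intro sum.cong refl) (simp add: mult_\<phi>)

text \<open>Nothing forces \<open>B 0\<close> to be the scalars: it is a single matrix block, and
  the size of that block multiplies every path count.\<close>

lemma vdim_eq: "v \<in> level G n \<Longrightarrow> vdim n v = vdim 0 r * num_paths G n v"
proof (induction n arbitrary: v)
  case 0
  then show ?case using level_0 by (simp add: num_paths_def finite_paths_0)
next
  case (Suc n)
  have "vdim (Suc n) v = (\<Sum>u\<in>level G n. mult_edges G n u v * (vdim 0 r * num_paths G n u))"
    unfolding vdim_Suc[OF Suc.prems] by (intro sum.cong refl) (simp add: Suc.IH)
  also have "\<dots> = vdim 0 r * num_paths G (Suc n) v"
    by (simp add: num_paths_Suc sum_distrib_left mult_ac)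
  finally show ?case .
qed

lemma root_in: "r \<in> level G 0" using level_0 by simp

lemma vchar_restrict:
  assumes "w \<in> level G (Suc n)" "b \<in> B n"
  shows "vchar (Suc n) w b = (\<Sum>v\<in>level G n. of_nat (mult_edges G n v w) * vchar n v b)"
  unfolding vchar_def character_restrict[OF family \<phi>_class[OF assms(1)] assms(2)] sum_classes
  by (intro sum.cong refl) (simp add: mult_\<phi> assms)

lemma vchar_vunit:
  assumes "u \<in> level G n" "v \<in> level G n"
  shows "vchar n u (vunit n v) = (if u = v then 1 else 0)"
proof -
  have "\<phi> n u = \<phi> n v \<longleftrightarrow> u = v" using bij_\<phi>[of n] assms by (auto simp: bij_betw_def inj_on_def)
  then show ?thesis unfolding vchar_def vunit_def
    using B.character_rep_mat_unit[OF \<phi>_class[OF assms(2)] \<phi>_class[OF assms(1)]] by simp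
qed

lemma vchar_Suc_vunit:
  assumes "v \<in> level G n" "w \<in> level G (Suc n)"
  shows "vchar (Suc n) w (vunit n v) = of_nat (mult_edges G n v w)"
  unfolding vchar_def vunit_def
  using mult_branching_graph[OF family \<phi>_class[OF assms(1)] \<phi>_class[OF assms(2)]] by (simp add: mult_\<phi> assms)

lemma module_rep: "v \<in> level G n \<Longrightarrow> is_module (B n) (rep (B n) (\<phi> n v))"
  by (rule rep_module[OF \<phi>_class])

lemma normalized_character_\<phi>:
  "v \<in> level G n \<Longrightarrow> b \<in> B n \<Longrightarrow> normalized_character (\<phi> n v) b = vchar n v b / of_nat (vdim n v)"
  unfolding vchar_def vdim_def by (rule B.normalized_character_eq[OF \<phi>_class])

text \<open>The right-hand side of \<open>trace_of_measure\<close> on one level, as a function of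
  its own so that different levels can be compared.\<close>

definition mtrace :: "'v path measure \<Rightarrow> nat \<Rightarrow> 'b \<Rightarrow> complex" where
  "mtrace M n b = (\<Sum>v\<in>level G n. of_real (measure M (paths_through G n v)) * (vchar n v b / of_nat (vdim n v)))"

lemma trace_of_measure_iff: "trace_of_measure G \<phi> B f M \<longleftrightarrow> (\<forall>n. \<forall>b\<in>B n. f b = mtrace M n b)"
proof -
  have "(\<Sum>v\<in>level G n. of_real (measure M (paths_through G n v)) * normalized_character (\<phi> n v) b) = mtrace M n b"
    if "b \<in> B n" for n b
    unfolding mtrace_def by (intro sum.cong refl) (simp add: normalized_character_\<phi> that)
  then show ?thesis unfolding trace_of_measure_def by auto
qed

text \<open>By \<open>vdim_eq\<close>, vertex mass over vertex dimension is \<psi> over the root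
  dimension. Compatibility of the levels is then the pairing of a harmonic function with the
  branching rule for characters.\<close>

lemma mtrace_Suc:
  assumes M: "M \<in> Cent G" and b: "b \<in> B n"
  shows "mtrace M (Suc n) b = mtrace M n b"
proof -
  define \<psi> where "\<psi> = (\<lambda>n v. measure M (paths_through G n v) / num_paths G n v)"
  have h: "harmonic G \<psi>" unfolding \<psi>_def by (rule Cent_harmonic[OF M])
  have m: "mtrace M k c = (\<Sum>v\<in>level G k. of_real (\<psi> k v) * vchar k v c) / of_nat (vdim 0 r)" for k c
    unfolding mtrace_def sum_divide_distrib
    by (intro sum.cong refl) (simp add: \<psi>_def vdim_eq)
  have "(\<Sum>w\<in>level G (Suc n). of_real (\<psi> (Suc n) w) * vchar (Suc n) w b) =
      (\<Sum>w\<in>level G (Suc n). \<Sum>v\<in>level G n. of_real (\<psi> (Suc n) w) * (of_nat (mult_edges G n v w) * vchar n v b))"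
    by (intro sum.cong refl) (simp add: vchar_restrict b sum_distrib_left)
  also have "\<dots> = (\<Sum>v\<in>level G n. \<Sum>w\<in>level G (Suc n). of_real (\<psi> (Suc n) w) * (of_nat (mult_edges G n v w) * vchar n v b))"
    by (rule sum.swap)
  also have "\<dots> = (\<Sum>v\<in>level G n. of_real (\<psi> n v) * vchar n v b)"
  proof (intro sum.cong refl)
    fix v assume v: "v \<in> level G n"
    have "complex_of_real (\<psi> n v) = (\<Sum>w\<in>level G (Suc n). of_nat (mult_edges G n v w) * of_real (\<psi> (Suc n) w))"
      by (subst harmonic_step[OF h v]) simp
    then show "(\<Sum>w\<in>level G (Suc n). of_real (\<psi> (Suc n) w) * (of_nat (mult_edges G n v w) * vchar n v b)) =
        of_real (\<psi> n v) * vchar n v b"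
      by (simp add: sum_distrib_right sum_distrib_left mult_ac)
  qed
  finally show ?thesis by (simp add: m)
qed

lemma mtrace_mono:
  assumes M: "M \<in> Cent G" and b: "b \<in> B n" and "n \<le> m"
  shows "mtrace M m b = mtrace M n b"
  using \<open>n \<le> m\<close>
proof (induction m rule: dec_induct)
  case (step m)
  have "b \<in> B m" using B_mono[OF step.hyps(1)] b by blast
  then show ?case using mtrace_Suc[OF M] step by simp
qed simp

lemma mtrace_indep:
  assumes M: "M \<in> Cent G" and b: "b \<in> B n" "b \<in> B m"
  shows "mtrace M m b = mtrace M n b"
  using mtrace_mono[OF M b(1), of m] mtrace_mono[OF M b(2), of n] by (cases "n \<le> m") auto

text \<open>On the union every level containing \<open>b\<close> gives the same value for central
  \<open>M\<close>, by \<open>mtrace_indep\<close>; the least one is a definite choice. Restriction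
  yields the extensional function that \<open>finite_traces\<close> asks for.\<close>

definition trace_of :: "'v path measure \<Rightarrow> 'b \<Rightarrow> complex" where
  "trace_of M = (\<lambda>b\<in>\<Union>n. B n. mtrace M (LEAST n. b \<in> B n) b)"

lemma trace_of_eq:
  assumes M: "M \<in> Cent G" and b: "b \<in> B n"
  shows "trace_of M b = mtrace M n b"
proof -
  have l: "b \<in> B (LEAST n. b \<in> B n)" using b by (rule LeastI)
  have "b \<in> (\<Union>n. B n)" using b by blast
  then have "trace_of M b = mtrace M (LEAST n. b \<in> B n) b" unfolding trace_of_def by (rule restrict_apply')
  also have "\<dots> = mtrace M n b" by (rule mtrace_indep[OF M b l])
  finally show ?thesis .
qed

lemma trace_of_measure_trace_of: "M \<in> Cent G \<Longrightarrow> trace_of_measure G \<phi> B (trace_of M) M"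
  unfolding trace_of_measure_iff using trace_of_eq by blast

lemma mtrace_add: "a \<in> B n \<Longrightarrow> b \<in> B n \<Longrightarrow> mtrace M n (a + b) = mtrace M n a + mtrace M n b"
  unfolding mtrace_def sum.distrib[symmetric]
  by (intro sum.cong refl) (simp add: vchar_def character_add[OF module_rep] add_divide_distrib distrib_left)

lemma mtrace_scale: "b \<in> B n \<Longrightarrow> mtrace M n (c *\<^sub>C b) = c * mtrace M n b"
  unfolding mtrace_def sum_distrib_left
  by (intro sum.cong refl) (simp add: vchar_def character_scale[OF module_rep])

lemma mtrace_comm:
  assumes "a \<in> B n" "b \<in> B n" shows "mtrace M n (a * b) = mtrace M n (b * a)"
proof -
  have "vchar n v (a * b) = vchar n v (b * a)" if "v \<in> level G n" for v
    unfolding vchar_def by (rule character_mult_comm[OF module_rep[OF that] assms])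
      (intro subalgebra_mult[OF B.sub] assms)+
  then show ?thesis unfolding mtrace_def by simp
qed

lemma mtrace_nonneg:
  assumes "b \<in> B n" shows "mtrace M n (star b * b) \<in> \<real>\<^sub>\<ge>\<^sub>0"
proof -
  have t: "of_real (measure M (paths_through G n v)) * (vchar n v (star b * b) / of_nat (vdim n v)) \<in> \<real>\<^sub>\<ge>\<^sub>0"
    if "v \<in> level G n" for v
    using B.character_nonneg[OF assms \<phi>_class[OF that]] unfolding vchar_def
    by (intro nonneg_Reals_mult_I nonneg_Reals_divide_I) auto
  have "(\<Sum>v\<in>S. of_real (measure M (paths_through G n v)) * (vchar n v (star b * b) / of_nat (vdim n v))) \<in> \<real>\<^sub>\<ge>\<^sub>0"
    if "finite S" "S \<subseteq> level G n" for S
    using that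
  proof (induction S rule: finite_induct)
    case (insert x F)
    then show ?case unfolding sum.insert[OF insert.hyps] by (intro nonneg_Reals_add_I t) auto
  qed simp
  then show ?thesis unfolding mtrace_def using finite_level by blast
qed

lemma common_level:
  assumes "x \<in> (\<Union>n. B n)" "y \<in> (\<Union>n. B n)"
  obtains n where "x \<in> B n" "y \<in> B n"
proof -
  obtain n m where "x \<in> B n" "y \<in> B m" using assms by blast
  then have "x \<in> B (max n m)" "y \<in> B (max n m)" using B_mono[of n "max n m"] B_mono[of m "max n m"] by auto
  then show ?thesis by (rule that)
qed

lemma trace_of_finite_trace:
  assumes M: "M \<in> Cent G"
  shows "trace_of M \<in> finite_traces B star"
  unfolding finite_traces_def
proof (intro CollectI conjI ballI allI)
  show "trace_of M \<in> extensional (\<Union>n. B n)" by (simp add: trace_of_def)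
  show "trace_of M (x + y) = trace_of M x + trace_of M y" if xy: "x \<in> (\<Union>n. B n)" "y \<in> (\<Union>n. B n)" for x y
  proof -
    obtain n where n: "x \<in> B n" "y \<in> B n" using common_level[OF xy] .
    show ?thesis unfolding trace_of_eq[OF M n(1)] trace_of_eq[OF M n(2)] trace_of_eq[OF M subalgebra_add[OF B.sub n]]
      by (rule mtrace_add[OF n])
  qed
  show "trace_of M (c *\<^sub>C x) = c * trace_of M x" if x: "x \<in> (\<Union>n. B n)" for c x
  proof -
    obtain n where n: "x \<in> B n" using x by blast
    show ?thesis unfolding trace_of_eq[OF M n] trace_of_eq[OF M subalgebra_scale[OF B.sub n]]
      by (rule mtrace_scale[OF n])
  qed
  show "trace_of M (x * y) = trace_of M (y * x)" if xy: "x \<in> (\<Union>n. B n)" "y \<in> (\<Union>n. B n)" for x y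
  proof -
    obtain n where n: "x \<in> B n" "y \<in> B n" using common_level[OF xy] .
    show ?thesis unfolding trace_of_eq[OF M subalgebra_mult[OF B.sub n(1,2)]] trace_of_eq[OF M subalgebra_mult[OF B.sub n(2,1)]]
      by (rule mtrace_comm[OF n])
  qed
  show "trace_of M (star x * x) \<in> \<real>\<^sub>\<ge>\<^sub>0" if x: "x \<in> (\<Union>n. B n)" for x
  proof -
    obtain n where n: "x \<in> B n" using x by blast
    show ?thesis unfolding trace_of_eq[OF M subalgebra_mult[OF B.sub B.star_in[OF n] n]] by (rule mtrace_nonneg[OF n])
  qed
  have p: "prob_space M" "sets M = sets (path_borel G)" using M by (simp_all add: Cent_def)
  have "space M = paths G" using sets_eq_imp_space_eq[OF p(2)] by simp
  moreover have "paths_through G 0 r = paths G" using level_0 by (auto simp: paths_through_def paths_def)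
  ultimately have "measure M (paths_through G 0 r) = 1" using prob_space.prob_space[OF p(1)] by simp
  then have "mtrace M 0 1 = 1"
    unfolding mtrace_def level_0 using vdim_pos[OF root_in]
    by (simp add: vchar_def character_one[OF module_rep[OF root_in]] vdim_def)
  then show "trace_of M 1 = 1" unfolding trace_of_eq[OF M subalgebra_one[OF B.sub[of 0]]] .
qed

section \<open>Recovering the measure from the trace\<close>

lemma mtrace_vunit:
  assumes v: "v \<in> level G n"
  shows "mtrace M n (vunit n v) = of_real (measure M (paths_through G n v)) / of_nat (vdim n v)"
proof -
  have "mtrace M n (vunit n v) = (\<Sum>u\<in>level G n. if u = v then of_real (measure M (paths_through G n v)) / of_nat (vdim n v) else 0)"
    unfolding mtrace_def by (intro sum.cong refl) (auto simp: vchar_vunit[OF _ v])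
  then show ?thesis using v finite_level by simp
qed

lemma trace_of_measure_unique:
  assumes M: "M \<in> Cent G" "M' \<in> Cent G"
    and f: "trace_of_measure G \<phi> B f M" "trace_of_measure G \<phi> B f M'"
  shows "M = M'"
proof (rule Cent_eqI[OF M])
  fix n v assume v: "v \<in> level G n"
  have "mtrace M n (vunit n v) = mtrace M' n (vunit n v)"
    using f(1)[unfolded trace_of_measure_iff, rule_format, OF vunit_in]
      f(2)[unfolded trace_of_measure_iff, rule_format, OF vunit_in] by simp
  then show "measure M (paths_through G n v) = measure M' (paths_through G n v)"
    unfolding mtrace_vunit[OF v] using vdim_pos[OF v] by simp
qed

text \<open>Rescaled by the root dimension, the values of \<open>f\<close> on minimal idempotents
  form a harmonic function. The rescaling makes the value at the root equal to \<open>f 1\<close>;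
  expanding \<open>f\<close> at a minimal idempotent of level \<open>n\<close> over the blocks of
  level \<open>n + 1\<close> gives the equation, with the edge numbers as character values.\<close>

lemma finite_trace_measure:
  assumes f: "f \<in> finite_traces B star"
  shows "\<exists>M\<in>Cent G. trace_of_measure G \<phi> B f M"
proof -
  have sub: "B n \<subseteq> (\<Union>n. B n)" for n by blast
  have add: "f (x + y) = f x + f y" if "x \<in> B n" "y \<in> B n" for n x y
    using f that unfolding finite_traces_def by blast
  have scale: "f (c *\<^sub>C x) = c * f x" if "x \<in> B n" for n c x
    using f that unfolding finite_traces_def by blast
  have comm: "f (x * y) = f (y * x)" if "x \<in> B n" "y \<in> B n" for n x y
    using f that unfolding finite_traces_def by blast
  have pos: "f (star x * x) \<in> \<real>\<^sub>\<ge>\<^sub>0" if "x \<in> B n" for n x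
    using f that unfolding finite_traces_def by blast
  have one: "f 1 = 1" using f unfolding finite_traces_def by blast
  have expand: "f b = (\<Sum>v\<in>level G n. f (vunit n v) * vchar n v b)" if b: "b \<in> B n" for n b
    using B.tracial_expand[of n f b, OF add scale comm b] unfolding sum_classes vunit_def vchar_def .
  have nn: "f (vunit n v) \<in> \<real>\<^sub>\<ge>\<^sub>0" if "v \<in> level G n" for n v
    unfolding vunit_def by (rule B.positive_trace_mat_unit[of n f, OF add scale comm pos \<phi>_class[OF that]])
  have re: "f (vunit n v) = of_real (Re (f (vunit n v)))" "0 \<le> Re (f (vunit n v))" if v: "v \<in> level G n" for n v
    using nn[OF v] by (auto elim!: nonneg_Reals_cases)
  define \<psi> where "\<psi> = (\<lambda>n v. real (vdim 0 r) * Re (f (vunit n v)))"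
  have "harmonic G \<psi>"
    unfolding harmonic_def
  proof (intro conjI ballI allI)
    fix v assume "v \<in> level G 0"
    then have v: "v = r" using level_0 by simp
    have "f 1 = f (vunit 0 r) * of_nat (vdim 0 r)"
      using expand[OF subalgebra_one[OF B.sub], of 0]
      by (simp add: level_0 vchar_def character_one[OF module_rep[OF root_in]] vdim_def)
    then have "of_real (\<psi> 0 r) = (1 :: complex)" using one re(1)[OF root_in] by (simp add: \<psi>_def mult.commute)
    then show "\<psi> 0 v = 1" by (simp add: v)
  next
    fix n v assume v: "v \<in> level G n"
    show "0 \<le> \<psi> n v" using re(2)[OF v] by (simp add: \<psi>_def)
    have "f (vunit n v) = (\<Sum>w\<in>level G (Suc n). f (vunit (Suc n) w) * of_nat (mult_edges G n v w))"
      unfolding expand[OF subsetD[OF B_Suc vunit_in[of n v]]] by (intro sum.cong refl) (simp add: vchar_Suc_vunit[OF v])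
    then have "Re (f (vunit n v)) = (\<Sum>w\<in>level G (Suc n). Re (f (vunit (Suc n) w)) * mult_edges G n v w)"
      by (simp add: Re_sum)
    then show "\<psi> n v = (\<Sum>w\<in>level G (Suc n). mult_edges G n v w * \<psi> (Suc n) w)"
      by (simp add: \<psi>_def sum_distrib_left mult_ac)
  qed
  then obtain M where M: "M \<in> Cent G"
    and mu: "\<And>n v. v \<in> level G n \<Longrightarrow> measure M (paths_through G n v) = num_paths G n v * \<psi> n v"
    using harmonic_Cent_paths_through by blast
  have "f b = mtrace M n b" if b: "b \<in> B n" for n b
  proof -
    have "of_real (measure M (paths_through G n v)) * (vchar n v b / of_nat (vdim n v)) = f (vunit n v) * vchar n v b"
      if v: "v \<in> level G n" for v
    proof -
      have "measure M (paths_through G n v) = vdim n v * Re (f (vunit n v))"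
        using mu[OF v] vdim_eq[OF v] by (simp add: \<psi>_def)
      then have "complex_of_real (measure M (paths_through G n v)) = of_nat (vdim n v) * f (vunit n v)"
        by (subst re(1)[OF v]) simp
      then show ?thesis using vdim_pos[OF v] by simp
    qed
    then show ?thesis unfolding expand[OF b] mtrace_def by simp
  qed
  then show ?thesis using M unfolding trace_of_measure_iff by blast
qed

lemma bij_betw_trace_of: "bij_betw trace_of (Cent G) (finite_traces B star)"
  unfolding bij_betw_def
proof (intro conjI inj_onI equalityI subsetI)
  fix M M' assume M: "M \<in> Cent G" "M' \<in> Cent G" and e: "trace_of M = trace_of M'"
  show "M = M'"
    by (rule trace_of_measure_unique[OF M trace_of_measure_trace_of[OF M(1)] trace_of_measure_trace_of[OF M(2), folded e]])
next
  fix f assume "f \<in> trace_of ` Cent G"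
  then show "f \<in> finite_traces B star" using trace_of_finite_trace by blast
next
  fix f assume f: "f \<in> finite_traces B star"
  obtain M where M: "M \<in> Cent G" "trace_of_measure G \<phi> B f M" using finite_trace_measure[OF f] by blast
  have "f b = trace_of M b" for b
  proof (cases "b \<in> (\<Union>n. B n)")
    case True
    then obtain n where n: "b \<in> B n" by blast
    have "f b = mtrace M n b" using M(2) n unfolding trace_of_measure_iff by blast
    then show ?thesis unfolding trace_of_eq[OF M(1) n] .
  next
    case False
    have "f \<in> extensional (\<Union>n. B n)" using f unfolding finite_traces_def by blast
    from extensional_arb[OF this False] have "f b = undefined" .
    moreover have "trace_of M b = undefined" unfolding trace_of_def restrict_def if_not_P[OF False] ..
    ultimately show ?thesis by simp
  qed
  then have "f = trace_of M" by blast
  then show "f \<in> trace_of ` Cent G" using M(1) by blast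
qed

end

subsection \<open>The branching graph of the family\<close>

text \<open>Scalars form one block: the minimal idempotent of a class would be a scalar equal to 1
  by its own block and to 0 by any other. A class exists because 1 is nonzero and the simple modules
  are faithful. Successors exist because induced modules are nonzero, predecessors because
  restrictions are.\<close>

lemma bratteli_graph_branching_graph:
  assumes fam: "semisimple_family A" and A_0: "A 0 = range (\<lambda>c. c *\<^sub>C (1 :: 'a::complex_algebra_1))"
    and ind: "\<And>l \<kappa>. \<kappa> \<in> simple_classes (A l) \<Longrightarrow> 0 < induced_dim (A l) (A (Suc l)) (rep (A l) \<kappa>)"
  shows "\<exists>r. bratteli_graph (branching_graph A) r"
proof -
  interpret A: semisimple_algebra "A l" for l by (rule semisimple_familyD(1)[OF fam])
  have "simple_classes (A 0) \<noteq> {}"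
  proof
    assume e: "simple_classes (A 0) = {}"
    have "(1 :: 'a) = 0" by (rule A.faithful[OF subalgebra_one[OF A.sub], of 0]) (simp add: e)
    then show False by simp
  qed
  then obtain r where r: "r \<in> simple_classes (A 0)" by blast
  have "\<kappa> = r" if k: "\<kappa> \<in> simple_classes (A 0)" for \<kappa>
  proof (rule ccontr)
    assume ne: "\<kappa> \<noteq> r"
    obtain c where c: "A.mat_unit 0 \<kappa> 0 0 = c *\<^sub>C 1" using A.mat_unit_in[of 0 \<kappa> 0 0] unfolding A_0 by blast
    have e: "ent (rep (A 0) \<kappa>') (c *\<^sub>C 1) 0 0 = c" if k': "\<kappa>' \<in> simple_classes (A 0)" for \<kappa>'
      using ent_scale[OF rep_module[OF k'] subalgebra_one[OF A.sub] A.dm_pos[OF k'] A.dm_pos[OF k']]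
        ent_one[OF rep_module[OF k'] A.dm_pos[OF k'] A.dm_pos[OF k']] by simp
    have "c = 1" using e[OF k] A.ent_mat_unit[OF k A.dm_pos[OF k] A.dm_pos[OF k], of \<kappa> 0 0] unfolding c by simp
    moreover have "c = 0" using e[OF r] A.ent_mat_unit[OF r A.dm_pos[OF r] A.dm_pos[OF r], of \<kappa> 0 0] ne unfolding c by simp
    ultimately show False by simp
  qed
  then have S0: "simple_classes (A 0) = {r}" using r by blast
  have "bratteli_graph (branching_graph A) r"
  proof
    show "finite (level (branching_graph A) n)" for n unfolding level_branching_graph by (rule A.finite_Cl)
    show "level (branching_graph A) 0 = {r}" unfolding level_branching_graph by (rule S0)
    show "\<exists>u\<in>level (branching_graph A) n. 0 < mult_edges (branching_graph A) n u v"
      if v: "v \<in> level (branching_graph A) (Suc n)" for n v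
    proof (rule ccontr)
      assume "\<not> ?thesis"
      then have "(\<Sum>u\<in>simple_classes (A n). mult_edges (branching_graph A) n u v * mod_dim (rep (A n) u)) = 0"
        unfolding level_branching_graph by (intro sum.neutral) simp
      then show False using dim_restrict[OF fam, of v n] A.dm_pos[of v "Suc n"] v unfolding level_branching_graph by simp
    qed
    show "\<exists>w\<in>level (branching_graph A) (Suc n). 0 < mult_edges (branching_graph A) n v w"
      if v: "v \<in> level (branching_graph A) n" for n v
    proof (rule ccontr)
      assume "\<not> ?thesis"
      then have "(\<Sum>w\<in>simple_classes (A (Suc n)). mult_edges (branching_graph A) n v w * mod_dim (rep (A (Suc n)) w)) = 0"
        unfolding level_branching_graph by (intro sum.neutral) simp
      then show False using dim_induce[OF fam, of v n] ind[of v n] v unfolding level_branching_graph by simp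
    qed
  qed
  then show ?thesis ..
qed

text \<open>Dimension is monotone along the inclusions. In the theorem this makes induced modules
  nonzero and gives each step down a weight of at least 1.\<close>

lemma dim_ratio_pos:
  assumes fam: "semisimple_family A"
  shows "1 \<le> cvec.dim (A (Suc l)) div cvec.dim (A l :: 'a::complex_algebra_1 set)"
proof -
  have sub: "cvec.subspace (A n)" and fd: "finite_dimensional (A n)" and one: "1 \<in> A n" and inc: "A n \<subseteq> A (Suc n)" for n
    using fam by (auto simp: semisimple_family_def unital_subalgebra_def)
  have lt: "cvec.dim L < cvec.dim (A n)" if "cvec.subspace L" "L \<subset> A n" for L n
  proof -
    obtain S where S: "finite S" "A n \<subseteq> cvec.span S" using fd[of n] by (auto simp: finite_dimensional_def)
    show ?thesis by (rule proper_subspace_dim[OF that S])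
  qed
  have "A l \<noteq> {0}" using one[of l] by (metis singletonD one_neq_zero)
  then have "{0} \<subset> A l" using cvec.subspace_0[OF sub[of l]] by blast
  then have pos: "0 < cvec.dim (A l)" using lt[of "{0}" l] cvec.subspace_single_0 by simp
  have "cvec.dim (A l) \<le> cvec.dim (A (Suc l))"
  proof (cases "A l = A (Suc l)")
    case False
    then have "A l \<subset> A (Suc l)" using inc[of l] by blast
    then show ?thesis using lt[OF sub] by (simp add: less_imp_le)
  qed simp
  then show ?thesis using pos div_le_mono[of "cvec.dim (A l)" "cvec.dim (A (Suc l))" "cvec.dim (A l)"] by simp
qed

theorem mainTheorem3:
  fixes A :: "nat \<Rightarrow> 'a::complex_algebra_1 set"
    and a :: "nat \<Rightarrow> nat"
    and \<Gamma> :: "'a fdmod set graded_graph"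
  assumes family: "semisimple_family A"
    and A_0: "A 0 = range (\<lambda>c. c *\<^sub>C 1)"
    and \<Gamma>_def: "\<Gamma> = branching_graph A"
    and a_def: "\<And>l. a (Suc l) = cvec.dim (A (Suc l)) div cvec.dim (A l)"
    and dim_Ind: "\<And>l M. simple_module (A l) M \<Longrightarrow>
                    induced_dim (A l) (A (Suc l)) M = a (Suc l) * mod_dim M"
    and sup_a: "\<not> bdd_above (range (\<lambda>l. a (Suc l)))"
  shows
    "(\<forall>M\<in>Cent (pascalized \<Gamma>).
        (\<forall>n i v. (i, v) \<in> level (pascalized \<Gamma>) n \<and> i < n \<longrightarrow>
           measure M (paths_through (pascalized \<Gamma>) n (i, v)) = 0) \<and>
        (\<exists>M\<^sub>0\<in>Cent \<Gamma>. M = pascal_measure \<Gamma> M\<^sub>0)) \<and>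
     bij_betw (pascal_measure \<Gamma>) (Cent \<Gamma>) (Cent (pascalized \<Gamma>)) \<and>
     (\<forall>(B :: nat \<Rightarrow> 'b::complex_algebra_1 set) star \<phi>
       (B' :: nat \<Rightarrow> 'c::complex_algebra_1 set) star' \<phi>'.
        locally_semisimple B star \<and> graph_iso \<Gamma> (branching_graph B) \<phi> \<and>
        locally_semisimple B' star' \<and> graph_iso (pascalized \<Gamma>) (branching_graph B') \<phi>' \<longrightarrow>
        (\<exists>T. bij_betw T (finite_traces B star) (finite_traces B' star') \<and>
           (\<forall>f\<in>finite_traces B star. \<exists>M\<in>Cent \<Gamma>.
              trace_of_measure \<Gamma> \<phi> B f M \<and>
              trace_of_measure (pascalized \<Gamma>) \<phi>' B' (T f) (pascal_measure \<Gamma> M))))"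
proof -
  have a_pos: "1 \<le> a (Suc l)" for l unfolding a_def by (rule dim_ratio_pos[OF family])
  have ind: "induced_dim (A l) (A (Suc l)) (rep (A l) \<kappa>) = a (Suc l) * mod_dim (rep (A l) \<kappa>)"
    if "\<kappa> \<in> simple_classes (A l)" for l \<kappa> by (rule dim_Ind[OF rep_simple[OF that]])
  have dim_pos: "0 < mod_dim (rep (A l) \<kappa>)" if "\<kappa> \<in> simple_classes (A l)" for l \<kappa>
    by (rule simple_dim[OF rep_simple[OF that]])
  have "\<exists>r. bratteli_graph \<Gamma> r"
    unfolding \<Gamma>_def
  proof (rule bratteli_graph_branching_graph[OF family A_0])
    fix l \<kappa> assume k: "\<kappa> \<in> simple_classes (A l)"
    show "0 < induced_dim (A l) (A (Suc l)) (rep (A l) \<kappa>)"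
      unfolding ind[OF k] using dim_pos[OF k] a_pos[of l] by simp
  qed
  then obtain r where br: "bratteli_graph \<Gamma> r" by blast
  interpret bratteli_graph \<Gamma> r by (rule br)
  have lev: "level \<Gamma> l = simple_classes (A l)" for l by (simp add: \<Gamma>_def level_branching_graph)
  have down: "(\<Sum>u\<in>level \<Gamma> n. mult_edges \<Gamma> n u v * mod_dim (rep (A n) u)) = mod_dim (rep (A (Suc n)) v)"
    if "v \<in> level \<Gamma> (Suc n)" for n v
    using dim_restrict[OF family, of v n] that unfolding lev unfolding \<Gamma>_def by simp
  have up: "(\<Sum>v\<in>level \<Gamma> (Suc n). mult_edges \<Gamma> n u v * mod_dim (rep (A (Suc n)) v)) = a (Suc n) * mod_dim (rep (A n) u)"
    if "u \<in> level \<Gamma> n" for n u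
    using dim_induce[OF family, of u n] ind[of u n] that unfolding lev unfolding \<Gamma>_def by simp
  have null: "measure M (paths_through (pascalized \<Gamma>) n (i, v)) = 0"
    if M: "M \<in> Cent (pascalized \<Gamma>)" and iv: "(i, v) \<in> level (pascalized \<Gamma>) n" "i < n" for M n i v
    by (rule Cent_pascalized_null[of "\<lambda>n v. mod_dim (rep (A n) v)" a, OF _ down up a_pos sup_a M iv])
       (simp_all add: lev dim_pos)
  have ex: "\<exists>M\<^sub>0\<in>Cent \<Gamma>. M = pascal_measure \<Gamma> M\<^sub>0" if M: "M \<in> Cent (pascalized \<Gamma>)" for M
    by (rule ex_pascal_measure[OF M null[OF M]])
  have bij: "bij_betw (pascal_measure \<Gamma>) (Cent \<Gamma>) (Cent (pascalized \<Gamma>))"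
    unfolding bij_betw_def using inj_on_pascal_measure pascal_measure_Cent ex by blast
  have traces: "\<exists>T. bij_betw T (finite_traces B star) (finite_traces B' star') \<and>
           (\<forall>f\<in>finite_traces B star. \<exists>M\<in>Cent \<Gamma>.
              trace_of_measure \<Gamma> \<phi> B f M \<and>
              trace_of_measure (pascalized \<Gamma>) \<phi>' B' (T f) (pascal_measure \<Gamma> M))"
    if B: "locally_semisimple B star" "graph_iso \<Gamma> (branching_graph B) \<phi>"
      and B': "locally_semisimple B' star'" "graph_iso (pascalized \<Gamma>) (branching_graph B') \<phi>'"
    for B :: "nat \<Rightarrow> 'b::complex_algebra_1 set" and star \<phi>
      and B' :: "nat \<Rightarrow> 'c::complex_algebra_1 set" and star' \<phi>'
  proof -
    interpret B: bratteli_algebra \<Gamma> r B star \<phi>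
      using br B by (simp add: bratteli_algebra_def bratteli_algebra_axioms_def)
    interpret B': bratteli_algebra "pascalized \<Gamma>" "(0, r)" B' star' \<phi>'
      using bratteli_pascalized[OF br] B' by (simp add: bratteli_algebra_def bratteli_algebra_axioms_def)
    let ?M = "inv_into (Cent \<Gamma>) B.trace_of"
    \<comment> \<open>From the trace to its measure on \<Gamma>, to the image measure on the
      pascalized graph, to the trace there: a composition of three bijections.\<close>
    let ?T = "B'.trace_of \<circ> (pascal_measure \<Gamma> \<circ> ?M)"
    have bT: "bij_betw ?T (finite_traces B star) (finite_traces B' star')"
      by (rule bij_betw_trans[OF bij_betw_trans[OF bij_betw_inv_into[OF B.bij_betw_trace_of] bij] B'.bij_betw_trace_of])
    have "\<exists>M\<in>Cent \<Gamma>. trace_of_measure \<Gamma> \<phi> B f M \<and>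
        trace_of_measure (pascalized \<Gamma>) \<phi>' B' (?T f) (pascal_measure \<Gamma> M)"
      if f: "f \<in> finite_traces B star" for f
    proof (rule bexI)
      have im: "f \<in> B.trace_of ` Cent \<Gamma>" using f B.bij_betw_trace_of by (simp add: bij_betw_def)
      show M: "?M f \<in> Cent \<Gamma>" by (rule inv_into_into[OF im])
      have "B.trace_of (?M f) = f" by (rule f_inv_into_f[OF im])
      then have "trace_of_measure \<Gamma> \<phi> B f (?M f)" using B.trace_of_measure_trace_of[OF M] by simp
      moreover have "trace_of_measure (pascalized \<Gamma>) \<phi>' B' (?T f) (pascal_measure \<Gamma> (?M f))"
        using B'.trace_of_measure_trace_of[OF pascal_measure_Cent[OF M]] by simp
      ultimately show "trace_of_measure \<Gamma> \<phi> B f (?M f) \<and>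
          trace_of_measure (pascalized \<Gamma>) \<phi>' B' (?T f) (pascal_measure \<Gamma> (?M f))" ..
    qed
    then show ?thesis using bT by blast
  qed
  show ?thesis
  proof (intro conjI ballI allI impI; (elim conjE)?)
    show "measure M (paths_through (pascalized \<Gamma>) n (i, v)) = 0"
      if "M \<in> Cent (pascalized \<Gamma>)" "(i, v) \<in> level (pascalized \<Gamma>) n" "i < n" for M n i v
      using that by (rule null)
    show "\<exists>M\<^sub>0\<in>Cent \<Gamma>. M = pascal_measure \<Gamma> M\<^sub>0" if "M \<in> Cent (pascalized \<Gamma>)" for M
      using that by (rule ex)
  qed (rule bij, rule traces)
qed

end
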